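(* For any $\varepsilon>0$ and $\lambda>(1+\varepsilon)\frac1\rho$, there exists $\delta:=\delta(\varepsilon)$ such that, with high probability as $N\to\infty$, the estimator $v_{\hat S}$ produced by the spectral rounding algorithm with parameter $\delta$ recovers the support of $v$ approximately.
   Context: Let $\rho\in(0,1)$ and $\rho_N\to\rho$ with $N\rho_N\in\mathbb N$ and $N\rho\in(N\rho_N-1/2,N\rho_N+1/2]$. One observes $A=\frac\lambda Nvv^T+W$, where $v\in\{0,1\}^N$ has $\sum_iv_i=N\rho_N$, and $W$ is symmetric with independent centered Gaussian entries on and above the diagonal, of variance $1/N$ off the diagonal and $2/N$ on it; $\lambda>0$ and $\rho$ do not depend on $N$. Approximate recovery: a sequence of estimators $\hat v_N\in\{0,1\}^N$ with $N\rho_N$ ones recovers the support of $v$ approximately if there is $c>0$, independent of $N$ and $\rho$, such that $(v,\hat v_N)>c\rho N$ with high probability (probability tending to $1$) as $N\to\infty$; here $(\cdot,\cdot)$ is the Euclidean inner product. Spectral rounding algorithm with parameter $\delta$: (1) Let $\hat v=(\hat v_i)$ denote the eigenvector corresponding to the largest eigenvalue of $A$, normalized so that $\|\hat v\|^2=N\rho_N$; let $\tilde S=\{i\in[N]:\hat v_i\ge\delta/2\}$. (2) If $|\tilde S|<N\rho_N$, sample $N\rho_N-|\tilde S|$ elements at random from $[N]\setminus\tilde S$ and add them to $\tilde S$ to construct $\hat S$. (3) Otherwise, sample $N\rho_N$ elements uniformly at random from $\tilde S$, and call this set $\hat S$. (4) Output $v_{\hat S}=\mathbf 1_{\hat S}$,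 the vector with ones at the entries in $\hat S$ and zeros otherwise.
   Formalization: The eigenvector in step (1) is determined only up to sign, and with the wrong sign the claim fails for small ρ; the formal statement fixes the sign by requiring the coordinates of the eigenvector to have nonnegative sum (and takes any measurable choice of such an eigenvector). *)

theory Defs
  imports "HOL-Probability.Probability" "Jordan_Normal_Form.Char_Poly"
begin

text \<open>Coordinates are indexed by \<open>{..<N}\<close>; \<open>K\<close> (or \<open>K N\<close>) stands for the natural number
  \<open>N * \<rho>\<^sub>N\<close>.\<close>

definition binary_vecs :: "nat \<Rightarrow> nat \<Rightarrow> real vec set" where
  "binary_vecs N K = {v \<in> carrier_vec N.
     (\<forall>i<N. vec_index v i \<in> {0, 1}) \<and> (\<Sum>i<N. vec_index v i) = real K}"

definition sparsity_sequence :: "real \<Rightarrow> (nat \<Rightarrow> real) \<Rightarrow> (nat \<Rightarrow> nat) \<Rightarrow> bool" where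
  "sparsity_sequence \<rho> \<rho>N K \<longleftrightarrow>
     \<rho>N \<longlonglongrightarrow> \<rho> \<and>
     (\<forall>N. real (K N) = real N * \<rho>N N) \<and>
     (\<forall>N. real N * \<rho> \<in> {real N * \<rho>N N - 1/2 <.. real N * \<rho>N N + 1/2})"

definition upper_triangle :: "nat \<Rightarrow> (nat \<times> nat) set" where
  "upper_triangle N = {(i, j). i \<le> j \<and> j < N}"

text \<open>Law of the entries of \<open>W\<close> on and above the diagonal. The second argument of
  \<^const>\<open>normal_density\<close> is the standard deviation.\<close>

definition noise_law :: "nat \<Rightarrow> (nat \<times> nat \<Rightarrow> real) measure" where
  "noise_law N = (\<Pi>\<^sub>M (i, j)\<in>upper_triangle N.
     density lborel (normal_density 0 (sqrt ((if i = j then 2 else 1) / real N))))"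

definition sym_mat :: "nat \<Rightarrow> (nat \<times> nat \<Rightarrow> real) \<Rightarrow> real mat" where
  "sym_mat N w = mat N N (\<lambda>(i, j). w (min i j, max i j))"

definition observation :: "nat \<Rightarrow> real \<Rightarrow> real vec \<Rightarrow> (nat \<times> nat \<Rightarrow> real) \<Rightarrow> real mat" where
  "observation N lam v w =
     (lam / real N) \<cdot>\<^sub>m mat N N (\<lambda>(i, j). vec_index v i * vec_index v j) + sym_mat N w"

definition largest_eigenvalue :: "real mat \<Rightarrow> real \<Rightarrow> bool" where
  "largest_eigenvalue A \<mu> \<longleftrightarrow> eigenvalue A \<mu> \<and> (\<forall>\<mu>'. eigenvalue A \<mu>' \<longrightarrow> \<mu>' \<le> \<mu>)"

text \<open>The normalization determines an eigenvector of a simple eigenvalue only up to sign, and for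
  the wrong sign thresholding at \<open>\<delta>/2\<close> is not informative. The sign is fixed, using the data only,
  by requiring a nonnegative coordinate sum (\<open>v\<close> itself has nonnegative entries).\<close>

definition principal_eigenvector :: "nat \<Rightarrow> real mat \<Rightarrow> real vec \<Rightarrow> bool" where
  "principal_eigenvector K A x \<longleftrightarrow>
     (\<exists>\<mu>. largest_eigenvalue A \<mu> \<and> eigenvector A x \<mu>) \<and>
     scalar_prod x x = real K \<and>
     (\<Sum>i<dim_vec x. vec_index x i) \<ge> 0"

text \<open>A measurable choice \<open>A \<mapsto> x A\<close> of the eigenvector used in the algorithm, defined for every
  symmetric matrix; where the largest eigenvalue is multiple, or the coordinate sum vanishes, the
  choice is arbitrary.\<close>

definition eigenvector_selection :: "nat \<Rightarrow> nat \<Rightarrow> (real mat \<Rightarrow> real vec) \<Rightarrow> bool" where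
  "eigenvector_selection N K x \<longleftrightarrow>
     (\<forall>w. principal_eigenvector K (sym_mat N w) (x (sym_mat N w))) \<and>
     (\<forall>i<N. (\<lambda>w. vec_index (x (sym_mat N w)) i)
        \<in> borel_measurable (\<Pi>\<^sub>M p\<in>upper_triangle N. borel))"

definition threshold_set :: "nat \<Rightarrow> real \<Rightarrow> real vec \<Rightarrow> nat set" where
  "threshold_set N \<delta> x = {i. i < N \<and> vec_index x i \<ge> \<delta> / 2}"

definition rounded_set :: "nat \<Rightarrow> nat \<Rightarrow> real \<Rightarrow> real vec \<Rightarrow> nat set pmf" where
  "rounded_set N K \<delta> x = (let S = threshold_set N \<delta> x in
     if card S < K
     then map_pmf (\<lambda>T. S \<union> T) (pmf_of_set {T. T \<subseteq> {..<N} - S \<and> card T = K - card S})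
     else pmf_of_set {T. T \<subseteq> S \<and> card T = K})"

definition indicator_vec :: "nat \<Rightarrow> nat set \<Rightarrow> real vec" where
  "indicator_vec N S = vec N (\<lambda>i. if i \<in> S then 1 else 0)"

text \<open>Law of the output, over both the noise and the internal randomness of the algorithm, which is
  independent of the noise.\<close>

definition spectral_rounding ::
  "nat \<Rightarrow> nat \<Rightarrow> real \<Rightarrow> real \<Rightarrow> real vec \<Rightarrow> (real mat \<Rightarrow> real vec) \<Rightarrow> real vec measure" where
  "spectral_rounding N K \<delta> lam v x =
     noise_law N \<bind> (\<lambda>w. measure_pmf
       (map_pmf (indicator_vec N) (rounded_set N K \<delta> (x (observation N lam v w)))))"

text \<open>\<open>Q N\<close> is the law of the \<open>N\<close>-th estimator. The constant \<open>c\<close> is a parameter, because it must not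
  depend on \<open>\<rho>\<close>: it has to be quantified before \<open>\<rho>\<close> by the user of the definition.\<close>

definition recovers_approximately ::
  "real \<Rightarrow> real \<Rightarrow> (nat \<Rightarrow> nat) \<Rightarrow> (nat \<Rightarrow> real vec) \<Rightarrow> (nat \<Rightarrow> real vec measure) \<Rightarrow> bool" where
  "recovers_approximately c \<rho> K v Q \<longleftrightarrow>
     (\<forall>\<^sub>F N in sequentially. AE u in Q N. u \<in> binary_vecs N (K N)) \<and>
     (\<lambda>N. measure (Q N) {u \<in> space (Q N). scalar_prod (v N) u > c * \<rho> * real N}) \<longlonglongrightarrow> 1"

end

theory Submission
  imports Defs
begin

text \<open>Let \<open>\<theta> = \<lambda> K / N\<close> and let \<open>u\<close> be the unit vector along \<open>v\<close>, so that \<open>A = \<theta> u u\<^sup>T + W\<close>.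
  Orthogonal invariance of \<open>W\<close> allows one to condition on its last column, reflect that column onto
  a coordinate axis, and continue with the remaining block: this is Householder tridiagonalisation,
  after which the diagonal entries are uniformly small and the off-diagonal ones are at most \<open>1 + o(1)\<close>,
  the first few of them also at least \<open>1 - o(1)\<close>. Only the consequences for quadratic forms are carried
  along. For a fixed unit vector \<open>e\<close>, with high probability simultaneously for all \<open>q > 0\<close> and \<open>y\<close>,
  \<open>(y, W y) \<le> (q + 1/q + o(1)) \<parallel>y\<parallel>\<^sup>2 - (1/q) (e, y)\<^sup>2\<close>, while the geometric test vector with ratio \<open>q\<close>
  gives a matching lower bound.

  With \<open>e = u\<close> and \<open>q = 1/\<theta>\<close> the test vector shows that the top eigenvalue of \<open>A\<close> is at least
  \<open>\<theta> + 1/\<theta> - o(1)\<close>; with \<open>q = 1\<close> the upper bound is \<open>2 + o(1)\<close> for \<open>W\<close>, so the top unit eigenvector \<open>y\<close>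
  satisfies \<open>(u, y)\<^sup>2 \<ge> (1 - 1/\<theta>)\<^sup>2 - o(1)\<close>. Applying the upper bound to the slightly tilted spikes
  \<open>\<theta> u \<plusminus> t f\<close>, where \<open>f\<close> is the unit vector along \<open>1 - v\<close>, shows that \<open>(f, y)\<close> is negligible, so the
  nonnegative coordinate sum forces \<open>(u, y) > 0\<close>. Rounding then succeeds by Cauchy--Schwarz and by
  Chebyshev's inequality for the hypergeometric distribution.\<close>

section \<open>Lebesgue measure and linear involutions\<close>

text \<open>The sign of the eigenvector is the obstacle. A lower bound on (u, y)^2 does not see it,
  and the normalisation controls only the sum of all coordinates, in which those outside the support
  could outweigh the others. Hence the two tilts next to \<open>u\<close>: they bound the product
  (u, y) (f, y), which is all that the sign argument uses. The good events belong to one fixed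
  direction but hold for all q and y at once, because y is a random eigenvector and one event must
  serve several values of q. The value q = 1/\<theta> is natural: the term -(1/q) (e, y)^2 then
  absorbs a spike of strength \<theta> exactly. All N columns must be controlled together, so a
  single column may fail only with exponentially small probability. The part of column n above the
  diagonal has squared norm about n/N; hence it is bounded above by 1 + o(1) throughout, but below
  by 1 - o(1) only for columns near the end. This is harmless, since cutting the geometric test
  vector after M links costs about \<theta>^(-2M), so that M can be fixed before N.\<close>

lemma measurable_restrict_borel:
  fixes h :: "'a \<Rightarrow> 'i \<Rightarrow> real"
  assumes "\<And>i. i \<in> I \<Longrightarrow> (\<lambda>p. h p i) \<in> borel_measurable M"
  shows "(\<lambda>p. \<lambda>i\<in>I. h p i) \<in> measurable M (Pi\<^sub>M I (\<lambda>_. lborel))"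
  using assms by (intro measurable_restrict) simp

lemma distr_PiM_lborel_translate:
  fixes a :: "'i \<Rightarrow> real"
  assumes "finite I"
  shows "distr (Pi\<^sub>M I (\<lambda>_. lborel)) (Pi\<^sub>M I (\<lambda>_. lborel)) (\<lambda>x. \<lambda>i\<in>I. x i + a i) = Pi\<^sub>M I (\<lambda>_. lborel)"
proof -
  interpret product_sigma_finite "\<lambda>_::'i. lborel :: real measure" ..
  let ?L = "Pi\<^sub>M I (\<lambda>_. lborel :: real measure)"
  let ?s = "\<lambda>x. \<lambda>i\<in>I. x i + a i"
  have meas: "?s \<in> measurable ?L ?L"
    by measurable
  show ?thesis
  proof (rule PiM_eqI)
    fix A :: "'i \<Rightarrow> real set" assume A: "\<And>i. i \<in> I \<Longrightarrow> A i \<in> sets lborel"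
    have vimage: "?s -` Pi\<^sub>E I A \<inter> space ?L = Pi\<^sub>E I (\<lambda>i. (\<lambda>t. a i + t) -` A i)"
      by (auto simp: space_PiM PiE_def extensional_def Pi_def add.commute)
    have 1: "emeasure lborel ((\<lambda>t. a i + t) -` A i) = emeasure lborel (A i)" if "i \<in> I" for i
      using A[OF that] by (subst (2) lborel_distr_plus[of "a i", symmetric]) (simp add: emeasure_distr)
    have 2: "(\<lambda>t. a i + t) -` A i \<in> sets borel" if "i \<in> I" for i
      using A[OF that] measurable_sets[of "\<lambda>t. a i + t" borel borel "A i"] by simp
    have "emeasure (distr ?L ?L ?s) (Pi\<^sub>E I A) = emeasure ?L (Pi\<^sub>E I (\<lambda>i. (\<lambda>t. a i + t) -` A i))"
      using A assms by (subst emeasure_distr[OF meas]) (auto simp: vimage intro!: sets_PiM_I_finite)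
    also have "\<dots> = (\<Prod>i\<in>I. emeasure lborel ((\<lambda>t. a i + t) -` A i))"
      using 2 assms by (intro emeasure_PiM) auto
    also have "\<dots> = (\<Prod>i\<in>I. emeasure lborel (A i))"
      by (intro prod.cong refl 1)
    finally show "emeasure (distr ?L ?L ?s) (Pi\<^sub>E I A) = (\<Prod>i\<in>I. emeasure lborel (A i))" .
  qed (use assms in auto)
qed

lemma nn_integral_PiM_lborel_translate:
  fixes a :: "'i \<Rightarrow> real"
  assumes "finite I" and g: "g \<in> borel_measurable (Pi\<^sub>M I (\<lambda>_. lborel))"
  shows "(\<integral>\<^sup>+x. g (\<lambda>i\<in>I. x i + a i) \<partial>Pi\<^sub>M I (\<lambda>_. lborel)) = (\<integral>\<^sup>+x. g x \<partial>Pi\<^sub>M I (\<lambda>_. lborel))"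
  using g by (subst (2) distr_PiM_lborel_translate[OF assms(1), of a, symmetric], subst nn_integral_distr) auto

text \<open>Uniqueness of Haar measure in disguise: comparing the two orders of integration of
  \<open>f x * g (T y + x)\<close> shows that \<open>T\<close> preserves Lebesgue measure.\<close>

lemma nn_integral_PiM_lborel_involution:
  fixes T :: "('i \<Rightarrow> real) \<Rightarrow> 'i \<Rightarrow> real" and f g :: "('i \<Rightarrow> real) \<Rightarrow> ennreal"
  defines "L \<equiv> \<lambda>I. Pi\<^sub>M I (\<lambda>_. lborel :: real measure)"
  assumes "finite I"
    and T [measurable]: "T \<in> measurable (L I) (L I)"
    and add: "\<And>x y. x \<in> space (L I) \<Longrightarrow> y \<in> space (L I) \<Longrightarrow> T (\<lambda>i\<in>I. x i + y i) = (\<lambda>i\<in>I. T x i + T y i)"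
    and diff: "\<And>x y. x \<in> space (L I) \<Longrightarrow> y \<in> space (L I) \<Longrightarrow> T (\<lambda>i\<in>I. x i - y i) = (\<lambda>i\<in>I. T x i - T y i)"
    and inv: "\<And>x. x \<in> space (L I) \<Longrightarrow> T (T x) = x"
    and f [measurable]: "f \<in> borel_measurable (L I)"
    and fT: "\<And>x. x \<in> space (L I) \<Longrightarrow> f (T x) = f x"
    and even: "\<And>x. x \<in> space (L I) \<Longrightarrow> f (\<lambda>i\<in>I. - x i) = f x"
    and fin: "(\<integral>\<^sup>+x. f x \<partial>L I) \<noteq> 0" "(\<integral>\<^sup>+x. f x \<partial>L I) \<noteq> \<infinity>"
    and g [measurable]: "g \<in> borel_measurable (L I)"
  shows "(\<integral>\<^sup>+x. g (T x) \<partial>L I) = (\<integral>\<^sup>+x. g x \<partial>L I)"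
proof -
  interpret product_sigma_finite "\<lambda>_::'i. lborel :: real measure" ..
  interpret L: sigma_finite_measure "L I" unfolding L_def by (rule sigma_finite[OF assms(2)])
  interpret LL: pair_sigma_finite "L I" "L I" ..
  note fin_I = assms(2)
  have space: "T x \<in> space (L I)" if "x \<in> space (L I)" for x
    using T that by (rule measurable_space)
  have space': "(\<lambda>i\<in>I. h i) \<in> space (L I)" for h
    by (simp add: L_def space_PiM)
  have restr: "(\<lambda>i\<in>I. x i) = x" if "x \<in> space (L I)" for x
    using that by (auto simp: L_def space_PiM PiE_def extensional_def)
  have comp [measurable]: "(\<lambda>x. x i) \<in> borel_measurable (L I)" if "i \<in> I" for i
    unfolding L_def using that by measurable
  have Tcomp [measurable]: "(\<lambda>x. T x i) \<in> borel_measurable (L I)" if "i \<in> I" for i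
    using measurable_compose[OF T comp[OF that]] .
  have T_snd: "(\<lambda>p. T (snd p) i) \<in> borel_measurable (L I \<Otimes>\<^sub>M L I)"
    and fst_comp: "(\<lambda>p. fst p i) \<in> borel_measurable (L I \<Otimes>\<^sub>M L I)"
    if "i \<in> I" for i
    using measurable_compose[OF measurable_snd Tcomp[OF that]] measurable_compose[OF measurable_fst comp[OF that]] .
  have [measurable]: "(\<lambda>p. \<lambda>i\<in>I. T (snd p) i + fst p i) \<in> measurable (L I \<Otimes>\<^sub>M L I) (L I)"
    unfolding L_def
    by (rule measurable_restrict_borel)
      (intro borel_measurable_add T_snd[unfolded L_def] fst_comp[unfolded L_def])
  have shift: "(\<integral>\<^sup>+x. h (\<lambda>i\<in>I. x i + a i) \<partial>L I) = (\<integral>\<^sup>+x. h x \<partial>L I)"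
    if "h \<in> borel_measurable (L I)" for h a
    using nn_integral_PiM_lborel_translate[OF fin_I] that unfolding L_def .
  have sm [measurable]: "(\<lambda>x. \<lambda>i\<in>I. x i + a i) \<in> measurable (L I) (L I)" for a :: "'i \<Rightarrow> real"
    unfolding L_def by measurable
  have sm' [measurable]: "(\<lambda>x. \<lambda>i\<in>I. a i + x i) \<in> measurable (L I) (L I)" for a :: "'i \<Rightarrow> real"
    unfolding L_def by measurable
  have sm'' [measurable]: "(\<lambda>x. \<lambda>i\<in>I. T x i + a i) \<in> measurable (L I) (L I)" for a :: "'i \<Rightarrow> real"
    using measurable_compose[OF T sm] .
  \<comment> \<open>Translating \<open>y\<close> by \<open>T x\<close> and using
    \<open>T (T x) = x\<close> replaces \<open>T y\<close> by \<open>T y + x\<close>, so the inner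
    integral does not depend on \<open>x\<close>.\<close>
  have A: "(\<integral>\<^sup>+y. g (\<lambda>i\<in>I. T y i + x i) \<partial>L I) = (\<integral>\<^sup>+y. g (T y) \<partial>L I)" if x: "x \<in> space (L I)" for x
  proof -
    have "(\<integral>\<^sup>+y. g (T y) \<partial>L I) = (\<integral>\<^sup>+y. g (T (\<lambda>i\<in>I. y i + T x i)) \<partial>L I)"
      by (subst shift) auto
    also have "\<dots> = (\<integral>\<^sup>+y. g (\<lambda>i\<in>I. T y i + x i) \<partial>L I)"
      by (intro nn_integral_cong) (auto simp: add space x inv cong: restrict_cong)
    finally show ?thesis by simp
  qed
  have B: "(\<integral>\<^sup>+x. f x * g (\<lambda>i\<in>I. T y i + x i) \<partial>L I) = (\<integral>\<^sup>+x. f (\<lambda>i\<in>I. x i - T y i) * g x \<partial>L I)"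
    if y: "y \<in> space (L I)" for y
  proof -
    have "(\<integral>\<^sup>+x. f x * g (\<lambda>i\<in>I. T y i + x i) \<partial>L I) =
      (\<integral>\<^sup>+x. f (\<lambda>i\<in>I. x i + - T y i) * g (\<lambda>i\<in>I. T y i + (\<lambda>i\<in>I. x i + - T y i) i) \<partial>L I)"
      by (subst shift[where h="\<lambda>x. f x * g (\<lambda>i\<in>I. T y i + x i)"]) auto
    also have "\<dots> = (\<integral>\<^sup>+x. f (\<lambda>i\<in>I. x i - T y i) * g x \<partial>L I)"
      by (intro nn_integral_cong) (auto simp: restr cong: restrict_cong)
    finally show ?thesis .
  qed
  \<comment> \<open>In the other order, invariance under \<open>T\<close> and evenness turn
    \<open>f (x - T y)\<close> into \<open>f (y - T x)\<close>, and a translation removes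
    \<open>T x\<close>. That \<open>T\<close> preserves the measure is nowhere presupposed.\<close>
  have C: "(\<integral>\<^sup>+y. f (\<lambda>i\<in>I. x i - T y i) \<partial>L I) = (\<integral>\<^sup>+y. f y \<partial>L I)" if x: "x \<in> space (L I)" for x
  proof -
    have "f (\<lambda>i\<in>I. x i - T y i) = f (\<lambda>i\<in>I. y i + - T x i)" if y: "y \<in> space (L I)" for y
    proof -
      have "f (\<lambda>i\<in>I. x i - T y i) = f (T (\<lambda>i\<in>I. x i - T y i))"
        by (simp add: fT space')
      also have "T (\<lambda>i\<in>I. x i - T y i) = (\<lambda>i\<in>I. T x i - y i)"
        by (simp add: diff x y space inv)
      also have "f \<dots> = f (\<lambda>i\<in>I. - (\<lambda>i\<in>I. T x i - y i) i)"
        by (rule even[symmetric, OF space'])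
      also have "(\<lambda>i\<in>I. - (\<lambda>i\<in>I. T x i - y i) i) = (\<lambda>i\<in>I. y i + - T x i)"
        by auto
      finally show ?thesis .
    qed
    then have "(\<integral>\<^sup>+y. f (\<lambda>i\<in>I. x i - T y i) \<partial>L I) = (\<integral>\<^sup>+y. f (\<lambda>i\<in>I. y i + - T x i) \<partial>L I)"
      by (intro nn_integral_cong) auto
    then show ?thesis by (subst (asm) shift) auto
  qed
  \<comment> \<open>Both orders of integration yield a multiple of \<open>?F\<close>, which cancels
    because it is neither 0 nor infinite.\<close>
  let ?F = "\<integral>\<^sup>+x. f x \<partial>L I"
  have "?F * (\<integral>\<^sup>+y. g (T y) \<partial>L I) = (\<integral>\<^sup>+x. f x * (\<integral>\<^sup>+y. g (T y) \<partial>L I) \<partial>L I)"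
    by (simp add: nn_integral_multc)
  also have "\<dots> = (\<integral>\<^sup>+x. (\<integral>\<^sup>+y. f x * g (\<lambda>i\<in>I. T y i + x i) \<partial>L I) \<partial>L I)"
    by (intro nn_integral_cong) (subst nn_integral_cmult, auto simp: A)
  also have "\<dots> = (\<integral>\<^sup>+y. (\<integral>\<^sup>+x. f x * g (\<lambda>i\<in>I. T y i + x i) \<partial>L I) \<partial>L I)"
    by (rule LL.Fubini'[symmetric]) (simp add: case_prod_beta')
  also have "\<dots> = (\<integral>\<^sup>+y. (\<integral>\<^sup>+x. f (\<lambda>i\<in>I. x i - T y i) * g x \<partial>L I) \<partial>L I)"
    by (intro nn_integral_cong B) auto
  also have "\<dots> = (\<integral>\<^sup>+x. (\<integral>\<^sup>+y. f (\<lambda>i\<in>I. x i - T y i) * g x \<partial>L I) \<partial>L I)"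
  proof (rule LL.Fubini')
    have "(\<lambda>p. \<lambda>i\<in>I. fst p i - T (snd p) i) \<in> measurable (L I \<Otimes>\<^sub>M L I) (L I)"
      unfolding L_def
      by (rule measurable_restrict_borel)
        (intro borel_measurable_diff fst_comp[unfolded L_def] T_snd[unfolded L_def])
    from measurable_compose[OF this f]
    show "(\<lambda>(x, y). f (\<lambda>i\<in>I. x i - T y i) * g x) \<in> borel_measurable (L I \<Otimes>\<^sub>M L I)"
      by (simp add: case_prod_beta')
  qed
  also have "\<dots> = (\<integral>\<^sup>+x. g x * ?F \<partial>L I)"
  proof (rule nn_integral_cong)
    fix x assume x: "x \<in> space (L I)"
    have "(\<lambda>y. \<lambda>i\<in>I. x i - T y i) \<in> measurable (L I) (L I)"
      unfolding L_def
      by (rule measurable_restrict_borel)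
        (intro borel_measurable_diff borel_measurable_const Tcomp[unfolded L_def])
    from measurable_compose[OF this f]
    show "(\<integral>\<^sup>+y. f (\<lambda>i\<in>I. x i - T y i) * g x \<partial>L I) = g x * ?F"
      by (subst nn_integral_multc) (auto simp: C x mult.commute)
  qed
  also have "\<dots> = ?F * (\<integral>\<^sup>+x. g x \<partial>L I)"
    by (simp add: nn_integral_multc mult.commute)
  finally show ?thesis
    using fin by (simp add: ennreal_mult_cancel_left)
qed

lemma PiM_density:
  fixes f :: "'i \<Rightarrow> 'a \<Rightarrow> ennreal"
  assumes I: "finite I" and M: "\<And>i. sigma_finite_measure (M i)"
    and D: "\<And>i. sigma_finite_measure (density (M i) (f i))"
    and f [measurable]: "\<And>i. f i \<in> borel_measurable (M i)"
  shows "Pi\<^sub>M I (\<lambda>i. density (M i) (f i)) = density (Pi\<^sub>M I M) (\<lambda>x. \<Prod>i\<in>I. f i (x i))"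
proof -
  interpret M: product_sigma_finite M by (intro product_sigma_finite.intro M)
  interpret D: product_sigma_finite "\<lambda>i. density (M i) (f i)" by (intro product_sigma_finite.intro D)
  have fm [measurable]: "(\<lambda>x. \<Prod>i\<in>I. f i (x i)) \<in> borel_measurable (Pi\<^sub>M I M)"
    by measurable
  show ?thesis
  proof (rule D.PiM_eqI[symmetric])
    show "sets (density (Pi\<^sub>M I M) (\<lambda>x. \<Prod>i\<in>I. f i (x i))) = sets (Pi\<^sub>M I (\<lambda>i. density (M i) (f i)))"
      by (simp cong: sets_PiM_cong)
    fix A assume "\<And>i. i \<in> I \<Longrightarrow> A i \<in> sets (density (M i) (f i))"
    then have A [measurable]: "A i \<in> sets (M i)" if "i \<in> I" for i using that by simp
    have "emeasure (density (Pi\<^sub>M I M) (\<lambda>x. \<Prod>i\<in>I. f i (x i))) (Pi\<^sub>E I A) =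
      (\<integral>\<^sup>+x. (\<Prod>i\<in>I. f i (x i)) * indicator (Pi\<^sub>E I A) x \<partial>Pi\<^sub>M I M)"
      using A I by (intro emeasure_density) (auto intro!: sets_PiM_I_finite)
    also have "\<dots> = (\<integral>\<^sup>+x. (\<Prod>i\<in>I. f i (x i) * indicator (A i) (x i)) \<partial>Pi\<^sub>M I M)"
    proof (rule nn_integral_cong)
      fix x assume x: "x \<in> space (Pi\<^sub>M I M)"
      have "indicator (Pi\<^sub>E I A) x = (\<Prod>i\<in>I. indicator (A i) (x i) :: ennreal)"
      proof (cases "x \<in> Pi\<^sub>E I A")
        case False
        with x obtain i where "i \<in> I" "x i \<notin> A i" by (auto simp: space_PiM PiE_def)
        with False I show ?thesis by (subst prod_zero) (auto intro!: bexI[of _ i])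
      qed (simp add: PiE_iff)
      then show "(\<Prod>i\<in>I. f i (x i)) * indicator (Pi\<^sub>E I A) x = (\<Prod>i\<in>I. f i (x i) * indicator (A i) (x i))"
        by (simp add: prod.distrib)
    qed
    also have "\<dots> = (\<Prod>i\<in>I. \<integral>\<^sup>+t. f i t * indicator (A i) t \<partial>M i)"
      by (intro M.product_nn_integral_prod I) (use A in measurable)
    also have "\<dots> = (\<Prod>i\<in>I. emeasure (density (M i) (f i)) (A i))"
      by (intro prod.cong refl emeasure_density[symmetric] A f)
    finally show "emeasure (density (Pi\<^sub>M I M) (\<lambda>x. \<Prod>i\<in>I. f i (x i))) (Pi\<^sub>E I A) =
      (\<Prod>i\<in>I. emeasure (density (M i) (f i)) (A i))" .
  qed (rule I)
qed

text \<open>A density that is even, \<open>T\<close>-invariant and of finite nonzero mass can itself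
  serve as the auxiliary function \<open>f\<close> of
  \<open>nn_integral_PiM_lborel_involution\<close>, so no Jacobian determinant has to be computed.
  It is applied with \<open>T = sym_conj n d\<close> and the Gaussian density.\<close>

lemma emeasure_density_PiM_lborel_involution:
  fixes T :: "('i \<Rightarrow> real) \<Rightarrow> 'i \<Rightarrow> real" and f :: "('i \<Rightarrow> real) \<Rightarrow> ennreal"
  defines "L \<equiv> \<lambda>I. Pi\<^sub>M I (\<lambda>_. lborel :: real measure)"
  assumes I: "finite I"
    and T: "T \<in> measurable (L I) (L I)"
    and add: "\<And>x y. x \<in> space (L I) \<Longrightarrow> y \<in> space (L I) \<Longrightarrow> T (\<lambda>i\<in>I. x i + y i) = (\<lambda>i\<in>I. T x i + T y i)"
    and diff: "\<And>x y. x \<in> space (L I) \<Longrightarrow> y \<in> space (L I) \<Longrightarrow> T (\<lambda>i\<in>I. x i - y i) = (\<lambda>i\<in>I. T x i - T y i)"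
    and inv: "\<And>x. x \<in> space (L I) \<Longrightarrow> T (T x) = x"
    and f: "f \<in> borel_measurable (L I)"
    and fT: "\<And>x. x \<in> space (L I) \<Longrightarrow> f (T x) = f x"
    and even: "\<And>x. x \<in> space (L I) \<Longrightarrow> f (\<lambda>i\<in>I. - x i) = f x"
    and fin: "(\<integral>\<^sup>+x. f x \<partial>L I) \<noteq> 0" "(\<integral>\<^sup>+x. f x \<partial>L I) \<noteq> \<infinity>"
    and B: "B \<in> sets (L I)"
  shows "emeasure (density (L I) f) (T -` B \<inter> space (L I)) = emeasure (density (L I) f) B"
proof -
  have "emeasure (density (L I) f) (T -` B \<inter> space (L I)) =
     (\<integral>\<^sup>+x. f x * indicator (T -` B \<inter> space (L I)) x \<partial>L I)"
    using T B f by (intro emeasure_density) auto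
  also have "\<dots> = (\<integral>\<^sup>+x. (\<lambda>x. f x * indicator B x) (T x) \<partial>L I)"
    by (intro nn_integral_cong) (auto simp: fT indicator_def)
  also have "\<dots> = (\<integral>\<^sup>+x. f x * indicator B x \<partial>L I)"
    using f B unfolding L_def
    by (intro nn_integral_PiM_lborel_involution[OF I T[unfolded L_def] add[unfolded L_def]
        diff[unfolded L_def] inv[unfolded L_def] f[unfolded L_def] fT[unfolded L_def]
        even[unfolded L_def] fin[unfolded L_def]]) auto
  also have "\<dots> = emeasure (density (L I) f) B"
    using B f by (intro emeasure_density[symmetric]) auto
  finally show ?thesis .
qed

section \<open>Quadratic forms and Householder reflections\<close>

definition inner_n :: "nat \<Rightarrow> (nat \<Rightarrow> real) \<Rightarrow> (nat \<Rightarrow> real) \<Rightarrow> real" where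
  "inner_n n x y = (\<Sum>i<n. x i * y i)"

text \<open>Indexing by \<open>min\<close> and \<open>max\<close> reads \<open>w\<close> as the
  symmetric matrix \<open>sym_mat n w\<close>, so that only entries on and above the diagonal
  matter.\<close>

definition sym_form :: "nat \<Rightarrow> (nat \<times> nat \<Rightarrow> real) \<Rightarrow> (nat \<Rightarrow> real) \<Rightarrow> real" where
  "sym_form n w y = (\<Sum>i<n. \<Sum>j<n. w (min i j, max i j) * y i * y j)"

text \<open>For \<open>d = 0\<close> the division by zero makes this the identity matrix, so that it is orthogonal
  for every \<open>d\<close>.\<close>

definition householder :: "nat \<Rightarrow> (nat \<Rightarrow> real) \<Rightarrow> nat \<Rightarrow> nat \<Rightarrow> real" where
  "householder n d i j = (if i = j then 1 else 0) - 2 * d i * d j / inner_n n d d"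

definition reflect :: "nat \<Rightarrow> (nat \<Rightarrow> real) \<Rightarrow> (nat \<Rightarrow> real) \<Rightarrow> nat \<Rightarrow> real" where
  "reflect n d y i = (\<Sum>k<n. householder n d i k * y k)"

text \<open>This is H S H for the symmetric matrix S coded by \<open>w\<close> and the reflection H,
  which is its own transpose. Restricting to the upper triangle gives a point of the product space
  that carries the noise law.\<close>

definition sym_conj :: "nat \<Rightarrow> (nat \<Rightarrow> real) \<Rightarrow> (nat \<times> nat \<Rightarrow> real) \<Rightarrow> nat \<times> nat \<Rightarrow> real" where
  "sym_conj n d w = (\<lambda>(i, j)\<in>upper_triangle n.
     \<Sum>k<n. \<Sum>l<n. householder n d i k * w (min k l, max k l) * householder n d l j)"

lemma inner_n_nonneg: "inner_n n d d \<ge> 0"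
  by (auto simp: inner_n_def intro!: sum_nonneg)

lemma inner_n_eq_0: "inner_n n d d = 0 \<Longrightarrow> i < n \<Longrightarrow> d i = 0"
  by (auto simp: inner_n_def sum_nonneg_eq_0_iff)

lemma inner_n_commute: "inner_n n x y = inner_n n y x"
  by (simp add: inner_n_def mult.commute)

lemma inner_n_add_left: "inner_n n (\<lambda>i. x i + y i) z = inner_n n x z + inner_n n y z"
  by (simp add: inner_n_def sum.distrib algebra_simps)

lemma inner_n_diff_left: "inner_n n (\<lambda>i. x i - y i) z = inner_n n x z - inner_n n y z"
  by (simp add: inner_n_def sum_subtractf algebra_simps)

lemma inner_n_scale_left: "inner_n n (\<lambda>i. c * x i) z = c * inner_n n x z"
  by (simp add: inner_n_def sum_distrib_left algebra_simps)

lemma inner_n_add_right: "inner_n n z (\<lambda>i. x i + y i) = inner_n n z x + inner_n n z y"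
  by (simp add: inner_n_def sum.distrib algebra_simps)

lemma inner_n_diff_right: "inner_n n z (\<lambda>i. x i - y i) = inner_n n z x - inner_n n z y"
  by (simp add: inner_n_def sum_subtractf algebra_simps)

lemma inner_n_scale_right: "inner_n n z (\<lambda>i. c * x i) = c * inner_n n z x"
  by (simp add: inner_n_def sum_distrib_left algebra_simps)

lemmas inner_n_linear = inner_n_add_left inner_n_diff_left inner_n_scale_left
  inner_n_add_right inner_n_diff_right inner_n_scale_right

lemma inner_n_cong:
  "(\<And>i. i < n \<Longrightarrow> x i = x' i) \<Longrightarrow> (\<And>i. i < n \<Longrightarrow> y i = y' i) \<Longrightarrow> inner_n n x y = inner_n n x' y'"
  by (simp add: inner_n_def)

lemma inner_n_Suc: "inner_n (Suc n) x y = inner_n n x y + x n * y n"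
  by (simp add: inner_n_def)

lemma sym_form_cong:
  assumes "\<And>p. p \<in> upper_triangle n \<Longrightarrow> w p = w' p" "\<And>i. i < n \<Longrightarrow> y i = y' i"
  shows "sym_form n w y = sym_form n w' y'"
proof -
  have "(min i j, max i j) \<in> upper_triangle n" if "i < n" "j < n" for i j
    using that by (auto simp: upper_triangle_def min_def max_def)
  with assms show ?thesis by (simp add: sym_form_def)
qed

lemma sym_form_Suc:
  "sym_form (Suc n) w y = sym_form n w y + 2 * y n * inner_n n (\<lambda>i. w (i, n)) y + w (n, n) * (y n)\<^sup>2"
proof -
  have "sym_form (Suc n) w y = (\<Sum>i<n. (\<Sum>j<n. w (min i j, max i j) * y i * y j) + w (min i n, max i n) * y i * y n)
     + ((\<Sum>j<n. w (min n j, max n j) * y n * y j) + w (n, n) * y n * y n)"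
    unfolding sym_form_def by simp
  also have "(\<Sum>j<n. w (min n j, max n j) * y n * y j) = y n * inner_n n (\<lambda>i. w (i, n)) y"
    unfolding inner_n_def sum_distrib_left by (intro sum.cong) (auto simp: min_def max_def)
  also have "(\<Sum>i<n. (\<Sum>j<n. w (min i j, max i j) * y i * y j) + w (min i n, max i n) * y i * y n) =
     sym_form n w y + y n * inner_n n (\<lambda>i. w (i, n)) y"
    unfolding inner_n_def sum_distrib_left sym_form_def sum.distrib
    by (intro arg_cong2[of _ _ _ _ "(+)"] refl sum.cong) (auto simp: min_def max_def)
  finally show ?thesis by (simp add: power2_eq_square algebra_simps)
qed

lemma sym_form_scale: "sym_form n w (\<lambda>i. c * y i) = c\<^sup>2 * sym_form n w y"
  by (simp add: sym_form_def sum_distrib_left power2_eq_square algebra_simps)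

lemma householder_commute: "householder n d i j = householder n d j i"
  by (simp add: householder_def)

lemma reflect_eq: "i < n \<Longrightarrow> reflect n d y i = y i - 2 * inner_n n d y / inner_n n d d * d i"
proof -
  assume i: "i < n"
  have "reflect n d y i = (\<Sum>k<n. (if i = k then y k else 0) - 2 * d i / inner_n n d d * (d k * y k))"
    unfolding reflect_def householder_def by (intro sum.cong) (auto simp: algebra_simps)
  also have "\<dots> = y i - 2 * d i / inner_n n d d * inner_n n d y"
    using i unfolding sum_subtractf sum_distrib_left[symmetric] inner_n_def[symmetric] by simp
  finally show ?thesis by simp
qed

text \<open>Settles the degenerate reflection: if the norm of \<open>d\<close> vanishes, so do its
  coordinates below \<open>n\<close>, and both sides are 0. The isometry and involution proofs then
  need no case split.\<close>

lemma householder_coefficient: "2 * inner_n n d y / inner_n n d d * inner_n n d d = 2 * inner_n n d y"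
proof (cases "inner_n n d d = 0")
  case True
  then have "inner_n n d y = 0" by (auto simp: inner_n_def[of n d y] dest: inner_n_eq_0 intro!: sum.neutral)
  then show ?thesis by simp
qed simp

lemma inner_n_reflect: "inner_n n (reflect n d x) (reflect n d y) = inner_n n x y"
proof -
  define a b where "a = 2 * inner_n n d x / inner_n n d d" and "b = 2 * inner_n n d y / inner_n n d d"
  have a: "a * inner_n n d d = 2 * inner_n n d x" and b: "b * inner_n n d d = 2 * inner_n n d y"
    by (simp_all only: a_def b_def householder_coefficient)
  have "inner_n n (reflect n d x) (reflect n d y) = inner_n n (\<lambda>i. x i - a * d i) (\<lambda>i. y i - b * d i)"
    unfolding a_def b_def by (intro inner_n_cong reflect_eq)
  also have "\<dots> = inner_n n x y - b * inner_n n d x - a * inner_n n d y + b * (a * inner_n n d d)"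
    by (simp add: inner_n_linear inner_n_commute[of n x d]) (simp add: algebra_simps)
  also have "\<dots> = inner_n n x y - a * inner_n n d y + b * inner_n n d x"
    by (simp add: a algebra_simps)
  \<comment> \<open>Computing \<open>b * (a * inner_n n d d)\<close> in two ways gives this without
    dividing by the norm.\<close>
  also have "b * inner_n n d x = a * inner_n n d y"
  proof -
    have "2 * (b * inner_n n d x) = b * (a * inner_n n d d)" by (simp add: a)
    also have "\<dots> = a * (b * inner_n n d d)" by simp
    finally show ?thesis by (simp add: b)
  qed
  finally show ?thesis by simp
qed

lemma reflect_reflect: "i < n \<Longrightarrow> reflect n d (reflect n d y) i = y i"
proof -
  assume i: "i < n"
  define b where "b = 2 * inner_n n d y / inner_n n d d"
  have b: "b * inner_n n d d = 2 * inner_n n d y"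
    by (simp only: b_def householder_coefficient)
  have "inner_n n d (reflect n d y) = inner_n n d (\<lambda>i. y i - b * d i)"
    unfolding b_def by (intro inner_n_cong reflect_eq refl)
  also have "\<dots> = - inner_n n d y"
    by (simp add: inner_n_linear b)
  finally show ?thesis using i by (simp add: reflect_eq)
qed

lemma inner_n_reflect_left: "inner_n n (reflect n d x) y = inner_n n x (reflect n d y)"
proof -
  have "inner_n n (reflect n d x) y = inner_n n (reflect n d x) (reflect n d (reflect n d y))"
    by (intro inner_n_cong) (simp_all add: reflect_reflect)
  then show ?thesis by (simp add: inner_n_reflect)
qed

text \<open>Two vectors of equal norm are swapped by the reflection along their difference; here
  they are \<open>c\<close> and its norm times \<open>f\<close>. Equal norms make (d, d) = 2 (d, c),
  so the reflection subtracts \<open>d\<close> exactly once. If \<open>d\<close> vanishes,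
  \<open>c\<close> already lies on the ray of \<open>f\<close>.\<close>

lemma reflect_to_axis:
  assumes f: "inner_n n f f = 1" and d: "\<And>i. i < n \<Longrightarrow> d i = c i - sqrt (inner_n n c c) * f i" and i: "i < n"
  shows "reflect n d c i = sqrt (inner_n n c c) * f i"
proof -
  define b where "b = sqrt (inner_n n c c)"
  have b2: "b * b = inner_n n c c" using inner_n_nonneg[of n c] by (simp add: b_def)
  have d': "d i = c i - b * f i" if "i < n" for i using d[OF that] by (simp add: b_def)
  have dc: "inner_n n d c = inner_n n c c - b * inner_n n f c"
    using inner_n_cong[of n d "\<lambda>i. c i - b * f i" c c] d' by (simp add: inner_n_linear)
  have "inner_n n d d = inner_n n (\<lambda>i. c i - b * f i) (\<lambda>i. c i - b * f i)"
    using d' by (intro inner_n_cong) auto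
  also have "\<dots> = 2 * inner_n n d c"
    using b2 by (simp add: inner_n_linear dc f inner_n_commute[of n c f] algebra_simps)
  finally have dd: "inner_n n d d = 2 * inner_n n d c" .
  show ?thesis
  proof (cases "inner_n n d d = 0")
    case True
    with inner_n_eq_0[OF True i] d[OF i] show ?thesis by (simp add: reflect_eq i)
  next
    case False
    then have "2 * inner_n n d c / inner_n n d d = 1" by (simp add: dd)
    then show ?thesis using d[OF i] by (simp add: reflect_eq i)
  qed
qed

lemma sum_householder:
  assumes "i < n" "j < n"
  shows "(\<Sum>k<n. householder n d i k * householder n d k j) = (if i = j then 1 else 0)"
proof -
  let ?e = "\<lambda>k. if k = j then 1 else 0 :: real"
  have "reflect n d ?e k = householder n d k j" if "k < n" for k
    using assms by (simp add: reflect_def if_distrib[of "\<lambda>x. _ * x"] cong: if_cong)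
  then have "(\<Sum>k<n. householder n d i k * householder n d k j) = reflect n d (reflect n d ?e) i"
    by (subst reflect_def[of n d "reflect n d ?e"]) simp
  then show ?thesis using assms by (simp add: reflect_reflect)
qed

lemma sym_conj_entry:
  assumes "i < n" "j < n"
  shows "sym_conj n d w (min i j, max i j) =
    (\<Sum>k<n. \<Sum>l<n. householder n d i k * w (min k l, max k l) * householder n d l j)"
proof (cases "i \<le> j")
  case True
  with assms show ?thesis by (simp add: sym_conj_def upper_triangle_def min_def max_def)
next
  case False
  with assms have "sym_conj n d w (min i j, max i j) =
    (\<Sum>k<n. \<Sum>l<n. householder n d j k * w (min k l, max k l) * householder n d l i)"
    by (simp add: sym_conj_def upper_triangle_def min_def max_def)
  also have "\<dots> = (\<Sum>l<n. \<Sum>k<n. householder n d j k * w (min k l, max k l) * householder n d l i)"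
    by (rule sum.swap)
  also have "\<dots> = (\<Sum>l<n. \<Sum>k<n. householder n d i l * w (min l k, max l k) * householder n d k j)"
    by (intro sum.cong refl) (simp add: householder_commute min.commute max.commute)
  finally show ?thesis .
qed

lemma sym_form_conj: "sym_form n (sym_conj n d w) y = sym_form n w (reflect n d y)"
proof -
  let ?h = "householder n d" and ?S = "\<lambda>k l. w (min k l, max k l)"
  have "sym_form n (sym_conj n d w) y = (\<Sum>i<n. \<Sum>j<n. \<Sum>k<n. \<Sum>l<n. ?h i k * ?S k l * ?h l j * y i * y j)"
    unfolding sym_form_def by (intro sum.cong refl) (simp add: sym_conj_entry sum_distrib_right)
  also have "\<dots> = (\<Sum>i<n. \<Sum>k<n. \<Sum>j<n. \<Sum>l<n. ?h i k * ?S k l * ?h l j * y i * y j)"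
    by (intro sum.cong refl sum.swap)
  also have "\<dots> = (\<Sum>k<n. \<Sum>i<n. \<Sum>j<n. \<Sum>l<n. ?h i k * ?S k l * ?h l j * y i * y j)"
    by (rule sum.swap)
  also have "\<dots> = (\<Sum>k<n. \<Sum>i<n. \<Sum>l<n. \<Sum>j<n. ?h i k * ?S k l * ?h l j * y i * y j)"
    by (intro sum.cong refl sum.swap)
  also have "\<dots> = (\<Sum>k<n. \<Sum>l<n. \<Sum>i<n. \<Sum>j<n. ?h i k * ?S k l * ?h l j * y i * y j)"
    by (intro sum.cong refl sum.swap)
  also have "\<dots> = (\<Sum>k<n. \<Sum>l<n. ?S k l * reflect n d y k * reflect n d y l)"
  proof (intro sum.cong refl)
    fix k l
    have "(\<Sum>i<n. \<Sum>j<n. ?h i k * ?S k l * ?h l j * y i * y j) =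
       ?S k l * ((\<Sum>i<n. ?h k i * y i) * (\<Sum>j<n. ?h l j * y j))"
      unfolding sum_product unfolding sum_distrib_left
      by (intro sum.cong refl) (simp add: householder_commute algebra_simps)
    then show "(\<Sum>i<n. \<Sum>j<n. ?h i k * ?S k l * ?h l j * y i * y j) = ?S k l * reflect n d y k * reflect n d y l"
      by (simp add: reflect_def)
  qed
  finally show ?thesis by (simp add: sym_form_def)
qed

lemma sum_householder_square:
  "(\<Sum>i<n. (\<Sum>k<n. householder n d i k * z k)\<^sup>2) = (\<Sum>k<n. (z k)\<^sup>2)"
  using inner_n_reflect[of n d z z] by (simp add: inner_n_def reflect_def power2_eq_square)

text \<open>The two factors of H S H act isometrically, one on the columns and one on the rows of S.
  Up to the factor \<open>N / 4\<close>, this invariant sum is the exponent of the Gaussian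
  density.\<close>

lemma frobenius_sym_conj:
  "(\<Sum>i<n. \<Sum>j<n. (sym_conj n d w (min i j, max i j))\<^sup>2) = (\<Sum>i<n. \<Sum>j<n. (w (min i j, max i j))\<^sup>2)"
proof -
  let ?h = "householder n d" and ?S = "\<lambda>k l. w (min k l, max k l)"
  have "(\<Sum>i<n. \<Sum>j<n. (sym_conj n d w (min i j, max i j))\<^sup>2) =
     (\<Sum>i<n. \<Sum>j<n. (\<Sum>l<n. ?h j l * (\<Sum>k<n. ?h i k * ?S k l))\<^sup>2)"
  proof (intro sum.cong refl arg_cong[of _ _ "\<lambda>x. x\<^sup>2"])
    fix i j assume "i \<in> {..<n}" "j \<in> {..<n}"
    then have "sym_conj n d w (min i j, max i j) = (\<Sum>k<n. \<Sum>l<n. ?h i k * ?S k l * ?h l j)"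
      by (simp add: sym_conj_entry)
    also have "\<dots> = (\<Sum>l<n. \<Sum>k<n. ?h i k * ?S k l * ?h l j)" by (rule sum.swap)
    also have "\<dots> = (\<Sum>l<n. ?h j l * (\<Sum>k<n. ?h i k * ?S k l))"
      unfolding sum_distrib_left by (intro sum.cong refl) (simp add: householder_commute[of n d j] algebra_simps)
    finally show "sym_conj n d w (min i j, max i j) = (\<Sum>l<n. ?h j l * (\<Sum>k<n. ?h i k * ?S k l))" .
  qed
  also have "\<dots> = (\<Sum>i<n. \<Sum>l<n. (\<Sum>k<n. ?h i k * ?S k l)\<^sup>2)"
    by (simp add: sum_householder_square)
  also have "\<dots> = (\<Sum>l<n. \<Sum>i<n. (\<Sum>k<n. ?h i k * ?S k l)\<^sup>2)" by (rule sum.swap)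
  also have "\<dots> = (\<Sum>l<n. \<Sum>k<n. (?S k l)\<^sup>2)" by (simp add: sum_householder_square)
  also have "\<dots> = (\<Sum>k<n. \<Sum>l<n. (?S k l)\<^sup>2)" by (rule sum.swap)
  finally show ?thesis .
qed

lemma sym_conj_add:
  "sym_conj n d (\<lambda>p\<in>upper_triangle n. w p + w' p) = (\<lambda>p\<in>upper_triangle n. sym_conj n d w p + sym_conj n d w' p)"
proof (rule ext)
  fix p
  have "(min k l, max k l) \<in> upper_triangle n" if "k < n" "l < n" for k l
    using that by (auto simp: upper_triangle_def min_def max_def)
  then show "sym_conj n d (\<lambda>p\<in>upper_triangle n. w p + w' p) p =
      (\<lambda>p\<in>upper_triangle n. sym_conj n d w p + sym_conj n d w' p) p"
    by (cases p) (auto simp: sym_conj_def restrict_def sum.distrib[symmetric] algebra_simps intro!: sum.cong)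
qed

lemma sym_conj_diff:
  "sym_conj n d (\<lambda>p\<in>upper_triangle n. w p - w' p) = (\<lambda>p\<in>upper_triangle n. sym_conj n d w p - sym_conj n d w' p)"
proof (rule ext)
  fix p
  have "(min k l, max k l) \<in> upper_triangle n" if "k < n" "l < n" for k l
    using that by (auto simp: upper_triangle_def min_def max_def)
  then show "sym_conj n d (\<lambda>p\<in>upper_triangle n. w p - w' p) p =
      (\<lambda>p\<in>upper_triangle n. sym_conj n d w p - sym_conj n d w' p) p"
    by (cases p) (auto simp: sym_conj_def restrict_def sum_subtractf[symmetric] algebra_simps intro!: sum.cong)
qed

lemma sym_conj_sym_conj:
  assumes "w \<in> extensional (upper_triangle n)"
  shows "sym_conj n d (sym_conj n d w) = w"
proof (rule ext)
  fix p :: "nat \<times> nat"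
  obtain i j where p: "p = (i, j)" by (cases p)
  let ?h = "householder n d" and ?S = "\<lambda>k l. w (min k l, max k l)"
  show "sym_conj n d (sym_conj n d w) p = w p"
  proof (cases "p \<in> upper_triangle n")
    case True
    then have ij: "i \<le> j" "i < n" "j < n" by (auto simp: p upper_triangle_def)
    have "sym_conj n d (sym_conj n d w) p =
      (\<Sum>k<n. \<Sum>l<n. ?h i k * sym_conj n d w (min k l, max k l) * ?h l j)"
      using sym_conj_entry[of i n j d "sym_conj n d w"] ij by (simp add: p min_def max_def)
    also have "\<dots> = (\<Sum>k<n. \<Sum>l<n. \<Sum>a<n. \<Sum>b<n. ?h i k * ?h k a * ?S a b * (?h b l * ?h l j))"
      by (intro sum.cong refl) (simp add: sym_conj_entry sum_distrib_left sum_distrib_right algebra_simps)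
    also have "\<dots> = (\<Sum>k<n. \<Sum>a<n. \<Sum>l<n. \<Sum>b<n. ?h i k * ?h k a * ?S a b * (?h b l * ?h l j))"
      by (intro sum.cong refl sum.swap)
    also have "\<dots> = (\<Sum>a<n. \<Sum>k<n. \<Sum>l<n. \<Sum>b<n. ?h i k * ?h k a * ?S a b * (?h b l * ?h l j))"
      by (rule sum.swap)
    also have "\<dots> = (\<Sum>a<n. \<Sum>k<n. \<Sum>b<n. \<Sum>l<n. ?h i k * ?h k a * ?S a b * (?h b l * ?h l j))"
      by (intro sum.cong refl sum.swap)
    also have "\<dots> = (\<Sum>a<n. \<Sum>b<n. \<Sum>k<n. \<Sum>l<n. ?h i k * ?h k a * ?S a b * (?h b l * ?h l j))"
      by (intro sum.cong refl sum.swap)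
    also have "\<dots> = (\<Sum>a<n. \<Sum>b<n. (\<Sum>k<n. ?h i k * ?h k a) * ?S a b * (\<Sum>l<n. ?h b l * ?h l j))"
    proof (intro sum.cong refl)
      fix a b
      have "(\<Sum>k<n. \<Sum>l<n. ?h i k * ?h k a * ?S a b * (?h b l * ?h l j)) =
        ?S a b * ((\<Sum>k<n. ?h i k * ?h k a) * (\<Sum>l<n. ?h b l * ?h l j))"
        unfolding sum_product unfolding sum_distrib_left by (simp add: algebra_simps)
      then show "(\<Sum>k<n. \<Sum>l<n. ?h i k * ?h k a * ?S a b * (?h b l * ?h l j)) =
        (\<Sum>k<n. ?h i k * ?h k a) * ?S a b * (\<Sum>l<n. ?h b l * ?h l j)" by simp
    qed
    also have "\<dots> = (\<Sum>a<n. \<Sum>b<n. if a = i then (if b = j then ?S a b else 0) else 0)"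
      using ij by (intro sum.cong refl) (auto simp: sum_householder)
    also have "\<dots> = (\<Sum>a<n. if a = i then ?S a j else 0)"
      using ij by (intro sum.cong refl) auto
    also have "\<dots> = ?S i j" using ij by simp
    finally show ?thesis using ij by (simp add: p min_def max_def)
  next
    case False
    then show ?thesis by (simp add: sym_conj_def extensional_arb[OF assms False])
  qed
qed

lemma sym_conj_extensional: "sym_conj n d w \<in> extensional (upper_triangle n)"
  by (simp add: sym_conj_def)

lemma sym_conj_cong:
  assumes "\<And>p. p \<in> upper_triangle n \<Longrightarrow> w p = w' p" "\<And>i. i < n \<Longrightarrow> d i = d' i"
  shows "sym_conj n d w = sym_conj n d' w'"
proof (rule ext)
  fix p
  have 1: "(min k l, max k l) \<in> upper_triangle n" if "k < n" "l < n" for k l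
    using that by (auto simp: upper_triangle_def min_def max_def)
  have 2: "householder n d i j = householder n d' i j" if "i < n" "j < n" for i j
    using that assms(2) by (simp add: householder_def inner_n_cong[of n d d' d d'])
  show "sym_conj n d w p = sym_conj n d' w' p"
    by (cases p) (auto simp: sym_conj_def restrict_def assms(1) 1 2 upper_triangle_def intro!: sum.cong)
qed

section \<open>Quadratic-form bounds under one Householder step\<close>

definition axis_n :: "nat \<Rightarrow> nat \<Rightarrow> real" where
  "axis_n n i = (if Suc i = n then 1 else 0)"

lemma inner_axis_n: "n > 0 \<Longrightarrow> inner_n n (axis_n n) y = y (n - 1)"
  by (cases n) (auto simp: inner_n_def axis_n_def if_distrib[of "\<lambda>x. x * _"] cong: if_cong)

text \<open>In a tridiagonal form with diagonal at most \<open>\<tau>\<close> and off-diagonal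
  entries in [0, \<open>R\<close>], each link between coordinates s and t costs at most R (q t^2 +
  s^2 / q). A coordinate with two links collects q + 1/q; the end \<open>e\<close> of the chain has
  one link and collects only q, which leaves the term \<open>R / q\<close> with a minus sign. That
  term makes room for a spike in direction \<open>e\<close>.\<close>

definition quadratic_upper :: "real \<Rightarrow> real \<Rightarrow> nat \<Rightarrow> (nat \<times> nat \<Rightarrow> real) \<Rightarrow> (nat \<Rightarrow> real) \<Rightarrow> bool" where
  "quadratic_upper \<tau> R n w e \<longleftrightarrow> (\<forall>q>0. \<forall>y.
     sym_form n w y \<le> (\<tau> + R * (q + 1/q)) * inner_n n y y - R / q * (inner_n n e y)\<^sup>2)"

text \<open>The test vector has coordinates 1, q, ..., q^m along a chain of \<open>m\<close> links
  that starts at \<open>e\<close>; the odd powers are the products of neighbouring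
  coordinates.\<close>

definition geometric_test :: "real \<Rightarrow> real \<Rightarrow> nat \<Rightarrow> nat \<Rightarrow> (nat \<times> nat \<Rightarrow> real) \<Rightarrow> (nat \<Rightarrow> real) \<Rightarrow> bool" where
  "geometric_test \<tau> r m n w e \<longleftrightarrow> (\<forall>q>0. \<exists>y. inner_n n e y = 1 \<and>
     inner_n n y y = (\<Sum>k<Suc m. q ^ (2 * k)) \<and>
     sym_form n w y \<ge> - \<tau> * inner_n n y y + 2 * r * (\<Sum>k<m. q ^ (2 * k + 1)))"

text \<open>The new coordinate t = \<open>y n\<close> meets the block only through 2 b t s, where s
  is the overlap of the reflected \<open>y\<close> with \<open>e\<close>. The weighted
  arithmetic-geometric inequality charges R s^2 / q, exactly what the bound for the block holds in
  reserve, and R q t^2, which is R t^2 / q below the allowance of t and becomes the new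
  reserve.\<close>

lemma quadratic_upper_Suc:
  assumes U: "quadratic_upper \<tau> R n (sym_conj n d w) e"
    and c: "\<And>i. i < n \<Longrightarrow> reflect n d (\<lambda>i. w (i, n)) i = b * e i"
    and b: "0 \<le> b" "b \<le> R" and a: "w (n, n) \<le> \<tau>"
  shows "quadratic_upper \<tau> R (Suc n) w (axis_n (Suc n))"
  unfolding quadratic_upper_def
proof (intro allI impI)
  fix q :: real and y assume q: "q > 0"
  let ?z = "reflect n d y" and ?t = "y n"
  let ?s = "inner_n n e ?z"
  have "sym_form n w y = sym_form n (sym_conj n d w) ?z"
    by (simp add: sym_form_conj) (intro sym_form_cong, auto simp: reflect_reflect)
  also have "\<dots> \<le> (\<tau> + R * (q + 1/q)) * inner_n n ?z ?z - R / q * ?s\<^sup>2"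
    using U q by (simp add: quadratic_upper_def)
  finally have 1: "sym_form n w y \<le> (\<tau> + R * (q + 1/q)) * inner_n n y y - R / q * ?s\<^sup>2"
    by (simp add: inner_n_reflect)
  have "inner_n n (\<lambda>i. w (i, n)) y = inner_n n (reflect n d (\<lambda>i. w (i, n))) ?z"
    by (simp add: inner_n_reflect)
  also have "\<dots> = inner_n n (\<lambda>i. b * e i) ?z"
    by (intro inner_n_cong) (auto simp: c)
  finally have 2: "inner_n n (\<lambda>i. w (i, n)) y = b * ?s" by (simp add: inner_n_linear)
  have "0 \<le> (q * \<bar>?t\<bar> - \<bar>?s\<bar>)\<^sup>2 / q" using q by simp
  also have "\<dots> = q * ?t\<^sup>2 + ?s\<^sup>2 / q - 2 * \<bar>?t * ?s\<bar>"
    using q by (simp add: power2_diff power_mult_distrib abs_mult field_simps power2_eq_square)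
  finally have 3: "2 * \<bar>?t * ?s\<bar> \<le> q * ?t\<^sup>2 + ?s\<^sup>2 / q" by simp
  have "2 * ?t * (b * ?s) \<le> b * (2 * \<bar>?t * ?s\<bar>)"
    using b by (simp add: algebra_simps mult_left_mono)
  also have "\<dots> \<le> R * (q * ?t\<^sup>2 + ?s\<^sup>2 / q)"
    using b q by (intro mult_mono 3) auto
  finally have 4: "2 * ?t * (b * ?s) \<le> R * (q * ?t\<^sup>2 + ?s\<^sup>2 / q)" .
  have 5: "w (n, n) * ?t\<^sup>2 \<le> \<tau> * ?t\<^sup>2" using a by (intro mult_right_mono) auto
  have "sym_form (Suc n) w y \<le> (\<tau> + R * (q + 1/q)) * inner_n n y y - R / q * ?s\<^sup>2
      + R * (q * ?t\<^sup>2 + ?s\<^sup>2 / q) + \<tau> * ?t\<^sup>2"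
    unfolding sym_form_Suc 2 using 1 4 5 by linarith
  also have "\<dots> = (\<tau> + R * (q + 1/q)) * inner_n (Suc n) y y - R / q * (inner_n (Suc n) (axis_n (Suc n)) y)\<^sup>2"
  proof -
    have "inner_n (Suc n) (axis_n (Suc n)) y = y n" by (simp add: inner_axis_n)
    then show ?thesis by (simp add: inner_n_Suc power2_eq_square algebra_simps)
  qed
  finally show "sym_form (Suc n) w y \<le> (\<tau> + R * (q + 1/q)) * inner_n (Suc n) y y
      - R / q * (inner_n (Suc n) (axis_n (Suc n)) y)\<^sup>2" .
qed

text \<open>The axis vector alone is a chain without links, so the lower bound can start at a block
  of any positive size; the columns before that need no lower bound on their norm.\<close>

lemma geometric_test_0:
  assumes "- \<tau> \<le> w (n, n)"
  shows "geometric_test \<tau> r 0 (Suc n) w (axis_n (Suc n))"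
  unfolding geometric_test_def
proof (intro allI impI)
  fix q :: real
  have "inner_n n (\<lambda>i. w (i, n)) (axis_n (Suc n)) = 0" "sym_form n w (axis_n (Suc n)) = 0"
    "inner_n n (axis_n (Suc n)) (axis_n (Suc n)) = 0"
    by (simp_all add: inner_n_def sym_form_def axis_n_def)
  with assms show "\<exists>y. inner_n (Suc n) (axis_n (Suc n)) y = 1 \<and>
     inner_n (Suc n) y y = (\<Sum>k<Suc 0. q ^ (2 * k)) \<and>
     sym_form (Suc n) w y \<ge> - \<tau> * inner_n (Suc n) y y + 2 * r * (\<Sum>k<0. q ^ (2 * k + 1))"
    by (intro exI[of _ "axis_n (Suc n)"]) (simp add: inner_n_Suc sym_form_Suc, simp add: axis_n_def)
qed

text \<open>The chain grows by a 1 in the new coordinate, while the old test vector is reflected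
  back and scaled by q. As the old one has component 1 along \<open>e\<close>, the new link
  contributes 2 q b, which accounts for the lowest odd power.\<close>

lemma geometric_test_Suc:
  assumes L: "geometric_test \<tau> r m n (sym_conj n d w) e"
    and c: "\<And>i. i < n \<Longrightarrow> reflect n d (\<lambda>i. w (i, n)) i = b * e i"
    and b: "r \<le> b" and a: "- \<tau> \<le> w (n, n)"
  shows "geometric_test \<tau> r (Suc m) (Suc n) w (axis_n (Suc n))"
  unfolding geometric_test_def
proof (intro allI impI)
  fix q :: real assume q: "q > 0"
  with L obtain z where z: "inner_n n e z = 1" "inner_n n z z = (\<Sum>k<Suc m. q ^ (2 * k))"
     "sym_form n (sym_conj n d w) z \<ge> - \<tau> * inner_n n z z + 2 * r * (\<Sum>k<m. q ^ (2 * k + 1))"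
    by (auto simp: geometric_test_def)
  let ?z = "\<lambda>i. q * reflect n d z i"
  let ?y = "\<lambda>i. if i = n then 1 else ?z i"
  have "inner_n n ?y ?y = inner_n n ?z ?z" by (intro inner_n_cong) auto
  also have "\<dots> = q\<^sup>2 * inner_n n z z"
    by (simp only: inner_n_linear inner_n_reflect) (simp add: power2_eq_square)
  finally have y1: "inner_n n ?y ?y = q\<^sup>2 * inner_n n z z" .
  have "inner_n n (\<lambda>i. w (i, n)) ?y = inner_n n (\<lambda>i. w (i, n)) ?z" by (intro inner_n_cong) auto
  also have "\<dots> = q * inner_n n (reflect n d (\<lambda>i. w (i, n))) z"
    by (simp add: inner_n_linear inner_n_reflect_left)
  also have "inner_n n (reflect n d (\<lambda>i. w (i, n))) z = inner_n n (\<lambda>i. b * e i) z"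
    by (intro inner_n_cong) (auto simp: c)
  finally have y2: "inner_n n (\<lambda>i. w (i, n)) ?y = q * b" by (simp add: inner_n_linear z)
  have "sym_form n w ?y = sym_form n w ?z" by (intro sym_form_cong) auto
  also have "\<dots> = q\<^sup>2 * sym_form n (sym_conj n d w) z" by (simp only: sym_form_scale sym_form_conj)
  finally have y3: "sym_form n w ?y = q\<^sup>2 * sym_form n (sym_conj n d w) z" .
  have s: "(\<Sum>k<Suc (Suc m). q ^ (2 * k)) = 1 + q\<^sup>2 * (\<Sum>k<Suc m. q ^ (2 * k))"
    by (subst sum.lessThan_Suc_shift) (simp add: sum_distrib_left power_add power2_eq_square algebra_simps)
  have s': "(\<Sum>k<Suc m. q ^ (2 * k + 1)) = q + q\<^sup>2 * (\<Sum>k<m. q ^ (2 * k + 1))"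
    by (subst sum.lessThan_Suc_shift) (simp add: sum_distrib_left power_add power2_eq_square algebra_simps)
  have "q\<^sup>2 * sym_form n (sym_conj n d w) z \<ge> q\<^sup>2 * (- \<tau> * inner_n n z z + 2 * r * (\<Sum>k<m. q ^ (2 * k + 1)))"
    using z(3) by (intro mult_left_mono) auto
  moreover have "q * b \<ge> q * r" using b q by simp
  ultimately have "sym_form (Suc n) w ?y \<ge> - \<tau> * inner_n (Suc n) ?y ?y + 2 * r * (\<Sum>k<Suc m. q ^ (2 * k + 1))"
    unfolding sym_form_Suc inner_n_Suc y1 y2 y3 s' using a by (simp add: algebra_simps)
  moreover have "inner_n (Suc n) (axis_n (Suc n)) ?y = 1"
    by (simp add: inner_axis_n)
  moreover have "inner_n (Suc n) ?y ?y = (\<Sum>k<Suc (Suc m). q ^ (2 * k))"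
    unfolding inner_n_Suc y1 s z by simp
  ultimately show "\<exists>y. inner_n (Suc n) (axis_n (Suc n)) y = 1 \<and>
     inner_n (Suc n) y y = (\<Sum>k<Suc (Suc m). q ^ (2 * k)) \<and>
     sym_form (Suc n) w y \<ge> - \<tau> * inner_n (Suc n) y y + 2 * r * (\<Sum>k<Suc m. q ^ (2 * k + 1))"
    by blast
qed

text \<open>An orthogonal change of basis transports the bound to any direction that is reflected
  onto \<open>e'\<close>. Together with \<open>geometric_test_reflect\<close> this frees the result
  from the coordinate axis.\<close>

lemma quadratic_upper_reflect:
  assumes "quadratic_upper \<tau> R n (sym_conj n d w) e'" and e: "\<And>i. i < n \<Longrightarrow> reflect n d e i = e' i"
  shows "quadratic_upper \<tau> R n w e"
  unfolding quadratic_upper_def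
proof (intro allI impI)
  fix q :: real and y assume q: "q > 0"
  let ?z = "reflect n d y"
  have "sym_form n w y = sym_form n (sym_conj n d w) ?z"
    by (simp add: sym_form_conj) (intro sym_form_cong, auto simp: reflect_reflect)
  also have "\<dots> \<le> (\<tau> + R * (q + 1/q)) * inner_n n ?z ?z - R / q * (inner_n n e' ?z)\<^sup>2"
    using assms q by (simp add: quadratic_upper_def)
  also have "inner_n n e' ?z = inner_n n (reflect n d e) ?z" by (intro inner_n_cong) (auto simp: e)
  finally show "sym_form n w y \<le> (\<tau> + R * (q + 1/q)) * inner_n n y y - R / q * (inner_n n e y)\<^sup>2"
    by (simp add: inner_n_reflect)
qed

lemma geometric_test_reflect:
  assumes "geometric_test \<tau> r m n (sym_conj n d w) e'" and e: "\<And>i. i < n \<Longrightarrow> reflect n d e i = e' i"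
  shows "geometric_test \<tau> r m n w e"
  unfolding geometric_test_def
proof (intro allI impI)
  fix q :: real assume q: "q > 0"
  with assms obtain z where z: "inner_n n e' z = 1" "inner_n n z z = (\<Sum>k<Suc m. q ^ (2 * k))"
     "sym_form n (sym_conj n d w) z \<ge> - \<tau> * inner_n n z z + 2 * r * (\<Sum>k<m. q ^ (2 * k + 1))"
    by (auto simp: geometric_test_def)
  have "inner_n n e (reflect n d z) = inner_n n (reflect n d e) z" by (simp add: inner_n_reflect_left)
  also have "\<dots> = inner_n n e' z" by (intro inner_n_cong) (auto simp: e)
  finally show "\<exists>y. inner_n n e y = 1 \<and> inner_n n y y = (\<Sum>k<Suc m. q ^ (2 * k)) \<and>
     sym_form n w y \<ge> - \<tau> * inner_n n y y + 2 * r * (\<Sum>k<m. q ^ (2 * k + 1))"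
    using z by (intro exI[of _ "reflect n d z"]) (simp add: inner_n_reflect sym_form_conj)
qed

section \<open>Gaussian symmetric matrices\<close>

definition last_column :: "nat \<Rightarrow> (nat \<times> nat) set" where
  "last_column n = (\<lambda>i. (i, n)) ` {..n}"

lemma finite_last_column [simp]: "finite (last_column n)"
  by (simp add: last_column_def)

lemma upper_triangle_Suc: "upper_triangle (Suc n) = last_column n \<union> upper_triangle n"
  by (auto simp: upper_triangle_def last_column_def)

lemma last_column_disjoint: "last_column n \<inter> upper_triangle n = {}"
  by (auto simp: upper_triangle_def last_column_def)

lemma upper_triangle_0 [simp]: "upper_triangle 0 = {}"
  by (simp add: upper_triangle_def)

lemma finite_upper_triangle [simp]: "finite (upper_triangle n)"
  by (induction n) (auto simp: upper_triangle_Suc)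

lemma frobenius_eq_sum_upper_triangle:
  "(\<Sum>i<n. \<Sum>j<n. (w (min i j, max i j))\<^sup>2) = (\<Sum>(i, j)\<in>upper_triangle n. (if i = j then 1 else 2) * (w (i, j) :: real)\<^sup>2)"
proof (induction n)
  case (Suc n)
  have 1: "(\<Sum>i<Suc n. \<Sum>j<Suc n. (w (min i j, max i j))\<^sup>2) =
    (\<Sum>i<n. \<Sum>j<n. (w (min i j, max i j))\<^sup>2) + (\<Sum>i<n. (w (min i n, max i n))\<^sup>2)
    + (\<Sum>j<n. (w (min n j, max n j))\<^sup>2) + (w (n, n))\<^sup>2"
    by (simp add: sum.distrib)
  have 2: "(\<Sum>i<n. (w (min i n, max i n))\<^sup>2) = (\<Sum>i<n. (w (i, n))\<^sup>2)"
    "(\<Sum>j<n. (w (min n j, max n j))\<^sup>2) = (\<Sum>i<n. (w (i, n))\<^sup>2)"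
    by (auto intro!: sum.cong simp: min_def max_def)
  have "(\<Sum>(i, j)\<in>last_column n. (if i = j then 1 else 2) * (w (i, j))\<^sup>2) =
      (\<Sum>i\<le>n. (if i = n then 1 else 2) * (w (i, n))\<^sup>2)"
    unfolding last_column_def by (subst sum.reindex) (auto simp: inj_on_def)
  also have "\<dots> = (\<Sum>i<n. (if i = n then 1 else 2) * (w (i, n))\<^sup>2) + (w (n, n))\<^sup>2"
    by (simp add: lessThan_Suc_atMost[symmetric])
  also have "(\<Sum>i<n. (if i = n then 1 else 2) * (w (i, n))\<^sup>2) = 2 * (\<Sum>i<n. (w (i, n))\<^sup>2)"
    by (subst sum_distrib_left) (auto intro!: sum.cong)
  finally have 3: "(\<Sum>(i, j)\<in>last_column n. (if i = j then 1 else 2) * (w (i, j))\<^sup>2) =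
      2 * (\<Sum>i<n. (w (i, n))\<^sup>2) + (w (n, n))\<^sup>2" .
  have "(\<Sum>(i, j)\<in>upper_triangle (Suc n). (if i = j then 1 else 2) * (w (i, j))\<^sup>2) =
      (\<Sum>(i, j)\<in>last_column n. (if i = j then 1 else 2) * (w (i, j))\<^sup>2) +
      (\<Sum>(i, j)\<in>upper_triangle n. (if i = j then 1 else 2) * (w (i, j))\<^sup>2)"
    unfolding upper_triangle_Suc by (rule sum.union_disjoint) (auto simp: last_column_disjoint)
  then show ?case unfolding 1 2 3 Suc by simp
qed simp

definition entry_sd :: "nat \<Rightarrow> nat \<times> nat \<Rightarrow> real" where
  "entry_sd N = (\<lambda>(i, j). sqrt ((if i = j then 2 else 1) / real N))"

definition entry_law :: "nat \<Rightarrow> nat \<times> nat \<Rightarrow> real measure" where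
  "entry_law N p = density lborel (\<lambda>x. ennreal (normal_density 0 (entry_sd N p) x))"

lemma noise_law_eq: "noise_law N = Pi\<^sub>M (upper_triangle N) (entry_law N)"
  unfolding noise_law_def entry_law_def entry_sd_def
  by (intro arg_cong2[of _ _ _ _ Pi\<^sub>M] refl) (auto simp: fun_eq_iff)

lemma entry_sd_pos: "N > 0 \<Longrightarrow> entry_sd N p > 0"
  by (auto simp: entry_sd_def split: prod.split)

lemma prob_space_entry_law: "N > 0 \<Longrightarrow> prob_space (entry_law N p)"
  unfolding entry_law_def by (intro prob_space_normal_density entry_sd_pos)

lemma sets_entry_law [simp, measurable_cong]: "sets (entry_law N p) = sets borel"
  by (simp add: entry_law_def)

lemma space_entry_law [simp]: "space (entry_law N p) = UNIV"
  by (simp add: entry_law_def)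

lemma sets_PiM_entry_law: "sets (Pi\<^sub>M I (entry_law N)) = sets (Pi\<^sub>M I (\<lambda>_. borel))"
  by (intro sets_PiM_cong) auto

lemma space_PiM_entry_law: "space (Pi\<^sub>M I (entry_law N)) = extensional I"
  by (simp add: space_PiM PiE_def)

lemma prob_space_PiM_entry_law: "N > 0 \<Longrightarrow> prob_space (Pi\<^sub>M I (entry_law N))"
  by (intro prob_space_PiM prob_space_entry_law)

section \<open>Orthogonal invariance of the noise\<close>

lemma measurable_PiM_borel:
  fixes h :: "'a \<Rightarrow> 'i \<Rightarrow> real"
  assumes "\<And>x. x \<in> space M \<Longrightarrow> h x \<in> extensional I" "\<And>i. i \<in> I \<Longrightarrow> (\<lambda>x. h x i) \<in> borel_measurable M"
  shows "h \<in> measurable M (Pi\<^sub>M I (\<lambda>_. borel))"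
  using assms by (intro measurable_PiM_single') (auto simp: PiE_def)

text \<open>\<open>d\<close> may vary with the sample point because the reflection used in the
  induction is computed from the random last column.\<close>

lemma measurable_sym_conj:
  assumes [measurable]: "\<And>i. i < n \<Longrightarrow> (\<lambda>x. d x i) \<in> borel_measurable M"
    and w: "\<And>p. p \<in> upper_triangle n \<Longrightarrow> (\<lambda>x. w x p) \<in> borel_measurable M"
  shows "(\<lambda>x. sym_conj n (d x) (w x)) \<in> measurable M (Pi\<^sub>M (upper_triangle n) (\<lambda>_. borel))"
proof (rule measurable_PiM_borel)
  fix p assume p: "p \<in> upper_triangle n"
  obtain i j where ij: "p = (i, j)" by (cases p)
  have [measurable]: "(\<lambda>x. householder n (d x) k l) \<in> borel_measurable M" if "k < n" "l < n" for k l
    using that unfolding householder_def inner_n_def by measurable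
  have [measurable]: "(\<lambda>x. w x (min k l, max k l)) \<in> borel_measurable M" if "k < n" "l < n" for k l
    using that by (intro w) (auto simp: upper_triangle_def min_def max_def)
  from p ij have "i < n" "j < n" by (auto simp: upper_triangle_def)
  moreover from p ij have "(\<lambda>x. sym_conj n (d x) (w x) p) = (\<lambda>x. \<Sum>k<n. \<Sum>l<n. householder n (d x) i k * w x (min k l, max k l) * householder n (d x) l j)"
    by (simp add: sym_conj_def)
  ultimately show "(\<lambda>x. sym_conj n (d x) (w x) p) \<in> borel_measurable M"
    by (auto intro!: borel_measurable_sum borel_measurable_times)
qed (rule sym_conj_extensional)

lemma measurable_sym_conj_entry_law:
  "sym_conj n d \<in> measurable (Pi\<^sub>M (upper_triangle n) (entry_law N)) (Pi\<^sub>M (upper_triangle n) (entry_law N))"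
proof -
  have "(\<lambda>y. sym_conj n d y) \<in> measurable (Pi\<^sub>M (upper_triangle n) (entry_law N)) (Pi\<^sub>M (upper_triangle n) (\<lambda>_. borel))"
    using measurable_component_singleton[of _ "upper_triangle n" "entry_law N"]
    by (intro measurable_sym_conj) (auto cong: measurable_cong_sets)
  then show ?thesis by (simp add: sets_PiM_entry_law cong: measurable_cong_sets)
qed

lemma PiM_entry_law_density:
  assumes "N > 0" "finite I"
  shows "Pi\<^sub>M I (entry_law N) = density (Pi\<^sub>M I (\<lambda>_. lborel))
    (\<lambda>x. ennreal ((\<Prod>p\<in>I. 1 / sqrt (2 * pi * (entry_sd N p)\<^sup>2)) * exp (- (\<Sum>p\<in>I. (x p)\<^sup>2 / (2 * (entry_sd N p)\<^sup>2)))))"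
proof -
  have "Pi\<^sub>M I (entry_law N) = density (Pi\<^sub>M I (\<lambda>_. lborel)) (\<lambda>x. \<Prod>p\<in>I. ennreal (normal_density 0 (entry_sd N p) (x p)))"
    unfolding entry_law_def using assms
    by (intro PiM_density lborel.sigma_finite_measure_axioms
        prob_space_imp_sigma_finite[OF prob_space_normal_density[OF entry_sd_pos]]) auto
  also have "(\<lambda>x. \<Prod>p\<in>I. ennreal (normal_density 0 (entry_sd N p) (x p))) =
      (\<lambda>x. ennreal ((\<Prod>p\<in>I. 1 / sqrt (2 * pi * (entry_sd N p)\<^sup>2)) * exp (- (\<Sum>p\<in>I. (x p)\<^sup>2 / (2 * (entry_sd N p)\<^sup>2)))))"
  proof
    fix x
    have "(\<Prod>p\<in>I. ennreal (normal_density 0 (entry_sd N p) (x p))) = ennreal (\<Prod>p\<in>I. normal_density 0 (entry_sd N p) (x p))"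
      by (simp add: prod_ennreal)
    also have "(\<Prod>p\<in>I. normal_density 0 (entry_sd N p) (x p)) =
       (\<Prod>p\<in>I. 1 / sqrt (2 * pi * (entry_sd N p)\<^sup>2)) * (\<Prod>p\<in>I. exp (- ((x p)\<^sup>2 / (2 * (entry_sd N p)\<^sup>2))))"
      unfolding normal_density_def prod.distrib by simp
    also have "(\<Prod>p\<in>I. exp (- ((x p)\<^sup>2 / (2 * (entry_sd N p)\<^sup>2)))) = exp (- (\<Sum>p\<in>I. (x p)\<^sup>2 / (2 * (entry_sd N p)\<^sup>2)))"
      using assms by (simp add: exp_sum[symmetric] sum_negf)
    finally show "(\<Prod>p\<in>I. ennreal (normal_density 0 (entry_sd N p) (x p))) =
      ennreal ((\<Prod>p\<in>I. 1 / sqrt (2 * pi * (entry_sd N p)\<^sup>2)) * exp (- (\<Sum>p\<in>I. (x p)\<^sup>2 / (2 * (entry_sd N p)\<^sup>2))))" .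
  qed
  finally show ?thesis .
qed

text \<open>Off-diagonal entries occur twice in the Frobenius norm and have half the variance of the
  diagonal ones. The two effects match, so the Gaussian exponent is a function of that norm
  alone.\<close>

lemma sum_entry_sd_frobenius:
  assumes "N > 0"
  shows "(\<Sum>p\<in>upper_triangle n. (w p)\<^sup>2 / (2 * (entry_sd N p)\<^sup>2)) =
    real N / 4 * (\<Sum>i<n. \<Sum>j<n. (w (min i j, max i j))\<^sup>2)"
  unfolding frobenius_eq_sum_upper_triangle sum_distrib_left
  using assms by (intro sum.cong refl) (auto simp: entry_sd_def field_simps split: prod.split)

text \<open>\<open>sym_conj n d\<close> is a linear involution that preserves the Gaussian density,
  by \<open>sum_entry_sd_frobenius\<close> and \<open>frobenius_sym_conj\<close>.\<close>

lemma emeasure_sym_conj: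
  assumes "N > 0" and B: "B \<in> sets (Pi\<^sub>M (upper_triangle n) (entry_law N))"
  shows "emeasure (Pi\<^sub>M (upper_triangle n) (entry_law N))
      (sym_conj n d -` B \<inter> space (Pi\<^sub>M (upper_triangle n) (entry_law N))) =
    emeasure (Pi\<^sub>M (upper_triangle n) (entry_law N)) B"
proof -
  let ?I = "upper_triangle n"
  let ?L = "Pi\<^sub>M ?I (\<lambda>_. lborel :: real measure)"
  let ?f = "\<lambda>x. ennreal ((\<Prod>p\<in>?I. 1 / sqrt (2 * pi * (entry_sd N p)\<^sup>2)) * exp (- (\<Sum>p\<in>?I. (x p)\<^sup>2 / (2 * (entry_sd N p)\<^sup>2))))"
  have eq: "Pi\<^sub>M ?I (entry_law N) = density ?L ?f"
    using assms(1) by (intro PiM_entry_law_density) auto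
  have sp: "space ?L = extensional ?I" by (simp add: space_PiM PiE_def)
  have f [measurable]: "?f \<in> borel_measurable ?L" by measurable
  have "(\<integral>\<^sup>+x. ?f x \<partial>?L) = emeasure (density ?L ?f) (space ?L)"
    by (subst emeasure_density) (auto intro!: nn_integral_cong)
  also have "\<dots> = 1"
    unfolding eq[symmetric] using prob_space.emeasure_space_1[OF prob_space_PiM_entry_law[OF assms(1)], of ?I]
    by (simp add: sp space_PiM_entry_law)
  finally have one: "(\<integral>\<^sup>+x. ?f x \<partial>?L) = 1" .
  have m: "sym_conj n d \<in> measurable ?L ?L"
  proof -
    have "(\<lambda>x. sym_conj n d x) \<in> measurable ?L (Pi\<^sub>M ?I (\<lambda>_. borel))"
      by (intro measurable_sym_conj) auto
    moreover have "sets ?L = sets (Pi\<^sub>M ?I (\<lambda>_. borel))" by (intro sets_PiM_cong) auto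
    ultimately show ?thesis by (simp cong: measurable_cong_sets)
  qed
  have "emeasure (density ?L ?f) (sym_conj n d -` B \<inter> space ?L) = emeasure (density ?L ?f) B"
  proof (rule emeasure_density_PiM_lborel_involution[OF _ m])
    show "B \<in> sets ?L" using B by (simp add: eq)
    show "?f (sym_conj n d x) = ?f x" for x
      by (simp add: sum_entry_sd_frobenius[OF assms(1)] frobenius_sym_conj)
    show "?f (\<lambda>i\<in>?I. - x i) = ?f x" for x by simp
  qed (use one in \<open>auto simp: sp sym_conj_sym_conj sym_conj_add sym_conj_diff\<close>)
  then show ?thesis by (simp add: eq)
qed

section \<open>Exponential moments and tails of one column\<close>

lemma nn_integral_exp_square_normal:
  assumes "\<sigma> > 0" and c: "2 * c * \<sigma>\<^sup>2 < 1"
  shows "(\<integral>\<^sup>+x. ennreal (exp (c * x\<^sup>2)) \<partial>density lborel (\<lambda>x. ennreal (normal_density 0 \<sigma> x))) = ennreal (1 / sqrt (1 - 2 * c * \<sigma>\<^sup>2))"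
proof -
  define k where "k = 1 - 2 * c * \<sigma>\<^sup>2"
  have k: "k > 0" using c by (simp add: k_def)
  \<comment> \<open>Multiplying by \<open>exp (c * x^2)\<close> turns the density into a multiple of
    another centred normal density, with the variance divided by \<open>k\<close>.\<close>
  have eq: "normal_density 0 \<sigma> x * exp (c * x\<^sup>2) = 1 / sqrt k * normal_density 0 (\<sigma> / sqrt k) x" for x
  proof -
    have "- (x\<^sup>2 / (2 * \<sigma>\<^sup>2)) + c * x\<^sup>2 = - (x\<^sup>2 / (2 * (\<sigma> / sqrt k)\<^sup>2))"
      using assms k by (simp add: power_divide field_simps) (simp add: k_def field_simps)
    then have "exp (- (x\<^sup>2 / (2 * \<sigma>\<^sup>2))) * exp (c * x\<^sup>2) = exp (- (x\<^sup>2 / (2 * (\<sigma> / sqrt k)\<^sup>2)))"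
      by (simp add: mult_exp_exp)
    moreover have "1 / sqrt (2 * pi * \<sigma>\<^sup>2) = 1 / sqrt k * (1 / sqrt (2 * pi * (\<sigma> / sqrt k)\<^sup>2))"
      using assms k by (simp add: power_divide real_sqrt_divide real_sqrt_mult)
    ultimately show ?thesis by (simp add: normal_density_def)
  qed
  have "(\<integral>\<^sup>+x. ennreal (exp (c * x\<^sup>2)) \<partial>density lborel (\<lambda>x. ennreal (normal_density 0 \<sigma> x))) =
     (\<integral>\<^sup>+x. ennreal (1 / sqrt k) * ennreal (normal_density 0 (\<sigma> / sqrt k) x) \<partial>lborel)"
    using k by (subst nn_integral_density) (auto simp: ennreal_mult[symmetric] eq)
  also have "\<dots> = ennreal (1 / sqrt k) * (\<integral>\<^sup>+x. ennreal (normal_density 0 (\<sigma> / sqrt k) x) \<partial>lborel)"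
    by (rule nn_integral_cmult) simp
  also have "(\<integral>\<^sup>+x. ennreal (normal_density 0 (\<sigma> / sqrt k) x) \<partial>lborel) = 1"
    using assms k by (subst nn_integral_eq_integral) auto
  finally show ?thesis by (simp add: k_def)
qed

lemma emeasure_le_nn_integral:
  assumes u [measurable]: "u \<in> borel_measurable M" and "\<And>x. x \<in> space M \<Longrightarrow> P x \<Longrightarrow> 1 \<le> c * u x"
  shows "emeasure M {x \<in> space M. P x} \<le> c * (\<integral>\<^sup>+x. u x \<partial>M)"
proof -
  have "emeasure M {x \<in> space M. P x} \<le> emeasure M {x \<in> space M. 1 \<le> c * u x}"
    using assms by (intro emeasure_mono) auto
  also have "\<dots> \<le> c * (\<integral>\<^sup>+x. u x * indicator (space M) x \<partial>M)"
    by (intro nn_integral_Markov_inequality) auto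
  also have "(\<integral>\<^sup>+x. u x * indicator (space M) x \<partial>M) = (\<integral>\<^sup>+x. u x \<partial>M)"
    by (intro nn_integral_cong) auto
  finally show ?thesis .
qed

lemma nn_integral_exp_column:
  assumes "N > 0" "t < 1"
  shows "(\<integral>\<^sup>+x. ennreal (exp (t / 2 * N * (\<Sum>i<n. (x (i, n))\<^sup>2))) \<partial>Pi\<^sub>M (last_column n) (entry_law N)) =
    ennreal ((1 / sqrt (1 - t)) ^ n)"
proof -
  interpret product_sigma_finite "entry_law N"
    by (intro product_sigma_finite.intro prob_space_imp_sigma_finite prob_space_entry_law assms)
  \<comment> \<open>The diagonal entry has a different variance and is not part of the column norm,
    so it gets the constant factor 1.\<close>
  let ?g = "\<lambda>p y. if p = (n, n) then 1 else ennreal (exp (t / 2 * N * y\<^sup>2))"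
  have 1: "(\<Prod>p\<in>last_column n. h p) = (\<Prod>i<n. h (i, n)) * h (n, n)" for h :: "nat \<times> nat \<Rightarrow> ennreal"
    unfolding last_column_def by (subst prod.reindex) (auto simp: inj_on_def lessThan_Suc_atMost[symmetric])
  have "(\<integral>\<^sup>+x. ennreal (exp (t / 2 * N * (\<Sum>i<n. (x (i, n))\<^sup>2))) \<partial>Pi\<^sub>M (last_column n) (entry_law N)) =
    (\<integral>\<^sup>+x. (\<Prod>p\<in>last_column n. ?g p (x p)) \<partial>Pi\<^sub>M (last_column n) (entry_law N))"
    by (intro nn_integral_cong) (simp add: 1 prod_ennreal exp_sum[symmetric] sum_distrib_left)
  also have "\<dots> = (\<Prod>p\<in>last_column n. \<integral>\<^sup>+y. ?g p y \<partial>entry_law N p)"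
    by (intro product_nn_integral_prod) auto
  also have "\<dots> = (\<Prod>i<n. \<integral>\<^sup>+y. ennreal (exp (t / 2 * N * y\<^sup>2)) \<partial>entry_law N (i, n))"
    using prob_space.emeasure_space_1[OF prob_space_entry_law[OF assms(1)], of "(n, n)"] by (simp add: 1)
  also have "\<dots> = (\<Prod>i<n. ennreal (1 / sqrt (1 - t)))"
  proof (intro prod.cong refl)
    fix i assume i: "i \<in> {..<n}"
    have "(entry_sd N (i, n))\<^sup>2 = 1 / N" using i by (simp add: entry_sd_def)
    then show "(\<integral>\<^sup>+y. ennreal (exp (t / 2 * N * y\<^sup>2)) \<partial>entry_law N (i, n)) = ennreal (1 / sqrt (1 - t))"
      unfolding entry_law_def using assms
      by (subst nn_integral_exp_square_normal) (auto simp: entry_sd_pos)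
  qed
  also have "\<dots> = ennreal ((1 / sqrt (1 - t)) ^ n)"
    using assms by (simp add: ennreal_power)
  finally show ?thesis .
qed

text \<open>For the diagonal variance \<open>2 / N\<close> the exponential moment is finite below
  \<open>N / 4\<close>; half of this critical value is used.\<close>

lemma nn_integral_exp_diagonal:
  assumes "N > 0"
  shows "(\<integral>\<^sup>+x. ennreal (exp (N / 8 * (x (n, n))\<^sup>2)) \<partial>Pi\<^sub>M (last_column n) (entry_law N)) = ennreal (sqrt 2)"
proof -
  interpret product_prob_space "entry_law N" "last_column n"
    using assms by (intro product_prob_spaceI prob_space_entry_law)
  have "(\<integral>\<^sup>+x. ennreal (exp (N / 8 * (x (n, n))\<^sup>2)) \<partial>Pi\<^sub>M (last_column n) (entry_law N)) =
    (\<integral>\<^sup>+y. ennreal (exp (N / 8 * y\<^sup>2)) \<partial>distr (Pi\<^sub>M (last_column n) (entry_law N)) (entry_law N (n, n)) (\<lambda>x. x (n, n)))"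
    by (subst nn_integral_distr) (auto simp: last_column_def)
  also have "\<dots> = (\<integral>\<^sup>+y. ennreal (exp (N / 8 * y\<^sup>2)) \<partial>entry_law N (n, n))"
    by (subst PiM_component) (auto simp: last_column_def)
  also have "\<dots> = ennreal (1 / sqrt (1 / 2))"
    unfolding entry_law_def using assms
    by (subst nn_integral_exp_square_normal) (auto simp: entry_sd_pos entry_sd_def)
  finally show ?thesis by (simp add: real_sqrt_divide)
qed

text \<open>The squared norm of column \<open>n\<close> has mean \<open>n / N\<close>. The upper
  bound therefore suits all columns, while the lower one is switched on, by \<open>lower\<close>,
  only for the last few.\<close>

definition column_good :: "real \<Rightarrow> real \<Rightarrow> real \<Rightarrow> bool \<Rightarrow> nat \<Rightarrow> (nat \<times> nat \<Rightarrow> real) \<Rightarrow> bool" where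
  "column_good \<tau> R r lower n x \<longleftrightarrow> \<bar>x (n, n)\<bar> \<le> \<tau> \<and> (\<Sum>i<n. (x (i, n))\<^sup>2) \<le> R\<^sup>2 \<and>
     (lower \<longrightarrow> r\<^sup>2 \<le> (\<Sum>i<n. (x (i, n))\<^sup>2))"

text \<open>These are Chernoff rates for a chi-square variable, matching
  \<open>nn_integral_exp_column\<close>: exponent \<open>t\<close> for the upper tail,
  \<open>- s\<close> for the lower one. A rate below 1 gives decay exponential in N, enough for a
  union over N columns.\<close>

lemma column_tail_rates:
  fixes R r :: real
  assumes "R > 1" "0 < r" "r < 1"
  obtains t s where "0 < t" "t < 1" "exp (- t / 2 * R\<^sup>2) / sqrt (1 - t) < 1"
    "0 < s" "exp (s / 2 * r\<^sup>2) / sqrt (1 + s) < 1"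
proof -
  define K where "K = R\<^sup>2"
  \<comment> \<open>After \<open>1 + t * K \<le> exp (t * K)\<close> what is needed is
    \<open>1 < (1 - t) * (1 + t * K)\<close>, and this \<open>t\<close> maximises the right-hand
    side. For \<open>s\<close> the analogous requirement is
    \<open>1 < (1 - s * r^2) * (1 + s)\<close>, which holds because
    \<open>s * r^2 < 2 * s = 1 - r^2\<close>.\<close>
  define t where "t = (K - 1) / (2 * K)"
  define s where "s = (1 - r\<^sup>2) / 2"
  have K: "K > 1" using assms by (simp add: K_def one_less_power)
  have r2: "0 < r\<^sup>2" "r\<^sup>2 < 1" using assms by (auto simp: power_less_one_iff abs_square_less_1)
  have t: "0 < t" "t < 1" using K by (auto simp: t_def field_simps)
  have s: "0 < s" using r2 by (auto simp: s_def)
  have "(1 - t) * (1 + t * K) = 1 + (K - 1)\<^sup>2 / (4 * K)"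
    using K by (simp add: t_def field_simps power2_eq_square)
  moreover have "(K - 1)\<^sup>2 / (4 * K) > 0" using K by simp
  ultimately have "1 < (1 - t) * (1 + t * R\<^sup>2)" by (simp add: K_def)
  also have "\<dots> \<le> (1 - t) * exp (t * R\<^sup>2)" using t by (intro mult_left_mono exp_ge_add_one_self) auto
  finally have "exp (- (t * R\<^sup>2)) < 1 - t" by (simp add: exp_minus field_simps)
  moreover have "exp (- (t * R\<^sup>2)) = (exp (- t / 2 * R\<^sup>2))\<^sup>2"
    by (simp add: power2_eq_square mult_exp_exp)
  ultimately have "exp (- t / 2 * R\<^sup>2) < sqrt (1 - t)"
    by (simp add: real_less_rsqrt)
  then have A: "exp (- t / 2 * R\<^sup>2) / sqrt (1 - t) < 1" using t by simp
  have "(1 - s * r\<^sup>2) * (1 + s) = 1 + s * (1 - r\<^sup>2 - s * r\<^sup>2)" by (simp add: algebra_simps)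
  moreover have "s * r\<^sup>2 < 1 - r\<^sup>2"
  proof -
    have "s * r\<^sup>2 < s * 1" using s r2 by (intro mult_strict_left_mono) auto
    moreover have "1 - r\<^sup>2 = 2 * s" by (simp add: s_def)
    ultimately show ?thesis using s by linarith
  qed
  ultimately have "1 < (1 - s * r\<^sup>2) * (1 + s)" using s by simp
  also have "\<dots> \<le> exp (- (s * r\<^sup>2)) * (1 + s)"
    using exp_ge_add_one_self[of "- (s * r\<^sup>2)"] s by (intro mult_right_mono) auto
  finally have "exp (s * r\<^sup>2) < 1 + s" by (simp add: exp_minus field_simps)
  moreover have "exp (s * r\<^sup>2) = (exp (s / 2 * r\<^sup>2))\<^sup>2"
    by (simp add: power2_eq_square mult_exp_exp)
  ultimately have "exp (s / 2 * r\<^sup>2) < sqrt (1 + s)"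
    by (simp add: real_less_rsqrt)
  then have "exp (s / 2 * r\<^sup>2) / sqrt (1 + s) < 1" using s by simp
  with A t s that show ?thesis by blast
qed

lemma borel_measurable_last_column:
  shows "i \<le> n \<Longrightarrow> (\<lambda>x. x (i, n)) \<in> borel_measurable (Pi\<^sub>M (last_column n) (entry_law N))"
    and "(\<lambda>x. \<Sum>i<n. (x (i, n))\<^sup>2) \<in> borel_measurable (Pi\<^sub>M (last_column n) (entry_law N))"
proof -
  show *: "(\<lambda>x. x (i, n)) \<in> borel_measurable (Pi\<^sub>M (last_column n) (entry_law N))" if "i \<le> n" for i
    using measurable_component_singleton[of "(i, n)" "last_column n" "entry_law N"] that
    by (auto simp: last_column_def cong: measurable_cong_sets)
  show "(\<lambda>x. \<Sum>i<n. (x (i, n))\<^sup>2) \<in> borel_measurable (Pi\<^sub>M (last_column n) (entry_law N))"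
    by (intro borel_measurable_sum borel_measurable_power *) auto
qed

lemma sets_column_good:
  "{x \<in> space (Pi\<^sub>M (last_column n) (entry_law N)). column_good \<tau> R r lower n x} \<in> sets (Pi\<^sub>M (last_column n) (entry_law N))"
proof -
  note [measurable] = borel_measurable_last_column(1)[OF order.refl] borel_measurable_last_column(2)
  show ?thesis unfolding column_good_def by measurable
qed

lemma prob_column_good:
  fixes \<tau> R r :: real
  assumes \<tau>: "\<tau> > 0" and R: "R > 1" and r: "0 < r" "r < 1"
  obtains C \<beta> where "0 \<le> \<beta>" "\<beta> < 1" "\<And>N n. 0 < N \<Longrightarrow> n < N \<Longrightarrow>
    measure (Pi\<^sub>M (last_column n) (entry_law N))
      {x \<in> space (Pi\<^sub>M (last_column n) (entry_law N)). column_good \<tau> R r (N \<le> n + M) n x} \<ge> 1 - C * \<beta> ^ N"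
proof -
  obtain t s where t: "0 < t" "t < 1" "exp (- t / 2 * R\<^sup>2) / sqrt (1 - t) < 1"
    and s: "0 < s" "exp (s / 2 * r\<^sup>2) / sqrt (1 + s) < 1"
    using column_tail_rates[OF R r] by metis
  define b0 b1 b2 where "b0 = exp (- (\<tau>\<^sup>2 / 8))" and "b1 = exp (- t / 2 * R\<^sup>2) / sqrt (1 - t)"
    and "b2 = exp (s / 2 * r\<^sup>2) / sqrt (1 + s)"
  define \<beta> where "\<beta> = max b0 (max b1 b2)"
  \<comment> \<open>One summand per kind of failure: \<open>sqrt 2\<close> for the diagonal entry, 1
    for the upper tail, and \<open>sqrt (1 + s) ^ M\<close> for the lower tail, where a column with
    only n entries lacks up to M of the N factors \<open>1 / sqrt (1 + s)\<close>.\<close>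
  define C where "C = sqrt 2 + 1 + sqrt (1 + s) ^ M"
  have b: "0 \<le> b0" "b0 < 1" "0 \<le> b1" "b1 < 1" "0 \<le> b2" "b2 < 1"
    using \<tau> t s by (auto simp: b0_def b1_def b2_def)
  then have \<beta>: "0 \<le> \<beta>" "\<beta> < 1" "b0 \<le> \<beta>" "b1 \<le> \<beta>" "b2 \<le> \<beta>" by (auto simp: \<beta>_def)
  show thesis
  proof (rule that[OF \<beta>(1,2)])
    fix N n :: nat assume N: "0 < N" and n: "n < N"
    let ?P = "Pi\<^sub>M (last_column n) (entry_law N)"
    let ?Q = "\<lambda>x. \<Sum>i<n. (x (i, n) :: real)\<^sup>2"
    interpret prob_space ?P by (intro prob_space_PiM_entry_law N)
    note [measurable] = borel_measurable_last_column(1)[OF order.refl] borel_measurable_last_column(2)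
    have m0: "{x \<in> space ?P. \<tau> < \<bar>x (n, n)\<bar>} \<in> sets ?P" by measurable
    have m1: "{x \<in> space ?P. R\<^sup>2 < ?Q x} \<in> sets ?P" by measurable
    have m2: "{x \<in> space ?P. N \<le> n + M \<and> ?Q x < r\<^sup>2} \<in> sets ?P" by measurable
    have "emeasure ?P {x \<in> space ?P. \<tau> < \<bar>x (n, n)\<bar>} \<le>
        ennreal (b0 ^ N) * (\<integral>\<^sup>+x. ennreal (exp (N / 8 * (x (n, n))\<^sup>2)) \<partial>?P)"
    proof (rule emeasure_le_nn_integral)
      fix x :: "nat \<times> nat \<Rightarrow> real" assume "\<tau> < \<bar>x (n, n)\<bar>"
      then have "\<tau>\<^sup>2 \<le> (x (n, n))\<^sup>2" using \<tau> by (simp add: abs_le_square_iff[symmetric])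
      then have "0 \<le> N / 8 * (x (n, n))\<^sup>2 - N * (\<tau>\<^sup>2 / 8)" using N by simp
      moreover have "b0 ^ N = exp (- (N * (\<tau>\<^sup>2 / 8)))" by (simp add: b0_def exp_of_nat_mult[symmetric])
      ultimately have "1 \<le> b0 ^ N * exp (N / 8 * (x (n, n))\<^sup>2)" by (simp add: mult_exp_exp)
      then show "1 \<le> ennreal (b0 ^ N) * ennreal (exp (N / 8 * (x (n, n))\<^sup>2))"
        using b by (simp add: ennreal_mult[symmetric])
    qed measurable
    also have "\<dots> = ennreal (b0 ^ N * sqrt 2)"
      using b by (subst nn_integral_exp_diagonal[OF N]) (simp add: ennreal_mult)
    finally have 0: "prob {x \<in> space ?P. \<tau> < \<bar>x (n, n)\<bar>} \<le> b0 ^ N * sqrt 2"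
      using b by (simp add: emeasure_eq_measure)
    have "emeasure ?P {x \<in> space ?P. R\<^sup>2 < ?Q x} \<le>
        ennreal (exp (- t / 2 * R\<^sup>2) ^ N) * (\<integral>\<^sup>+x. ennreal (exp (t / 2 * N * ?Q x)) \<partial>?P)"
    proof (rule emeasure_le_nn_integral)
      fix x :: "nat \<times> nat \<Rightarrow> real" assume "R\<^sup>2 < ?Q x"
      then have "t / 2 * N * R\<^sup>2 \<le> t / 2 * N * ?Q x" using t by (intro mult_left_mono) auto
      moreover have "exp (- t / 2 * R\<^sup>2) ^ N = exp (- (t / 2 * N * R\<^sup>2))"
        by (simp add: exp_of_nat_mult[symmetric] algebra_simps)
      ultimately have "1 \<le> exp (- t / 2 * R\<^sup>2) ^ N * exp (t / 2 * N * ?Q x)" by (simp add: mult_exp_exp)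
      then show "1 \<le> ennreal (exp (- t / 2 * R\<^sup>2) ^ N) * ennreal (exp (t / 2 * N * ?Q x))"
        by (simp add: ennreal_mult[symmetric])
    qed measurable
    also have "\<dots> = ennreal (exp (- t / 2 * R\<^sup>2) ^ N * (1 / sqrt (1 - t)) ^ n)"
      using t by (subst nn_integral_exp_column[OF N t(2)]) (simp add: ennreal_mult)
    finally have "prob {x \<in> space ?P. R\<^sup>2 < ?Q x} \<le> exp (- t / 2 * R\<^sup>2) ^ N * (1 / sqrt (1 - t)) ^ n"
      using t by (simp add: emeasure_eq_measure)
    \<comment> \<open>Shorter columns only help here: each missing entry drops a factor
      \<open>1 / sqrt (1 - t) \<ge> 1\<close>.\<close>
    also have "\<dots> \<le> exp (- t / 2 * R\<^sup>2) ^ N * (1 / sqrt (1 - t)) ^ N"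
      using t n by (intro mult_left_mono power_increasing) (auto simp: real_le_lsqrt)
    also have "\<dots> = b1 ^ N" by (simp add: b1_def power_mult_distrib[symmetric])
    finally have 1: "prob {x \<in> space ?P. R\<^sup>2 < ?Q x} \<le> b1 ^ N" .
    have 2: "prob {x \<in> space ?P. N \<le> n + M \<and> ?Q x < r\<^sup>2} \<le> sqrt (1 + s) ^ M * b2 ^ N"
    proof (cases "N \<le> n + M")
      case True
      have "emeasure ?P {x \<in> space ?P. N \<le> n + M \<and> ?Q x < r\<^sup>2} \<le>
          ennreal (exp (s / 2 * r\<^sup>2) ^ N) * (\<integral>\<^sup>+x. ennreal (exp (- s / 2 * N * ?Q x)) \<partial>?P)"
      proof (rule emeasure_le_nn_integral)
        fix x :: "nat \<times> nat \<Rightarrow> real" assume "N \<le> n + M \<and> ?Q x < r\<^sup>2"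
        then have "s / 2 * N * ?Q x \<le> s / 2 * N * r\<^sup>2" using s by (intro mult_left_mono) auto
        moreover have "exp (s / 2 * r\<^sup>2) ^ N = exp (s / 2 * N * r\<^sup>2)"
          by (simp add: exp_of_nat_mult[symmetric] algebra_simps)
        ultimately have "1 \<le> exp (s / 2 * r\<^sup>2) ^ N * exp (- s / 2 * N * ?Q x)" by (simp add: mult_exp_exp)
        then show "1 \<le> ennreal (exp (s / 2 * r\<^sup>2) ^ N) * ennreal (exp (- s / 2 * N * ?Q x))"
          by (simp add: ennreal_mult[symmetric])
      qed measurable
      also have "\<dots> = ennreal (exp (s / 2 * r\<^sup>2) ^ N * (1 / sqrt (1 + s)) ^ n)"
        using s by (subst nn_integral_exp_column[OF N, of "- s" n]) (auto simp: ennreal_mult)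
      finally have "prob {x \<in> space ?P. N \<le> n + M \<and> ?Q x < r\<^sup>2} \<le> exp (s / 2 * r\<^sup>2) ^ N * (1 / sqrt (1 + s)) ^ n"
        using s by (simp add: emeasure_eq_measure)
      also have "(1 / sqrt (1 + s)) ^ n \<le> sqrt (1 + s) ^ M * (1 / sqrt (1 + s)) ^ N"
      proof -
        have "sqrt (1 + s) ^ N \<le> sqrt (1 + s) ^ (n + M)" using True s by (intro power_increasing) auto
        then show ?thesis using s by (simp add: power_one_over field_simps power_add)
      qed
      finally show ?thesis using s by (simp add: b2_def power_divide mult_ac mult_left_mono)
    qed (use s b in simp)
    have "prob {x \<in> space ?P. \<not> column_good \<tau> R r (N \<le> n + M) n x} \<le>
      prob ({x \<in> space ?P. \<tau> < \<bar>x (n, n)\<bar>} \<union> ({x \<in> space ?P. R\<^sup>2 < ?Q x} \<union> {x \<in> space ?P. N \<le> n + M \<and> ?Q x < r\<^sup>2}))"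
      using m0 m1 m2 by (intro finite_measure_mono) (auto simp: column_good_def)
    also have "\<dots> \<le> prob {x \<in> space ?P. \<tau> < \<bar>x (n, n)\<bar>} +
       prob ({x \<in> space ?P. R\<^sup>2 < ?Q x} \<union> {x \<in> space ?P. N \<le> n + M \<and> ?Q x < r\<^sup>2})"
      using m0 m1 m2 by (intro measure_Un_le) auto
    also have "\<dots> \<le> prob {x \<in> space ?P. \<tau> < \<bar>x (n, n)\<bar>} +
       (prob {x \<in> space ?P. R\<^sup>2 < ?Q x} + prob {x \<in> space ?P. N \<le> n + M \<and> ?Q x < r\<^sup>2})"
      using m0 m1 m2 by (intro add_left_mono measure_Un_le) auto
    also have "\<dots> \<le> \<beta> ^ N * sqrt 2 + (\<beta> ^ N + sqrt (1 + s) ^ M * \<beta> ^ N)"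
    proof -
      have "b0 ^ N \<le> \<beta> ^ N" "b1 ^ N \<le> \<beta> ^ N" "b2 ^ N \<le> \<beta> ^ N"
        using b \<beta> by (auto intro!: power_mono)
      then have "b0 ^ N * sqrt 2 \<le> \<beta> ^ N * sqrt 2" "sqrt (1 + s) ^ M * b2 ^ N \<le> sqrt (1 + s) ^ M * \<beta> ^ N"
        using s by (auto intro!: mult_right_mono mult_left_mono)
      with 0 1 2 \<open>b1 ^ N \<le> \<beta> ^ N\<close> show ?thesis by linarith
    qed
    also have "\<dots> = C * \<beta> ^ N" by (simp add: C_def algebra_simps)
    finally have "prob {x \<in> space ?P. \<not> column_good \<tau> R r (N \<le> n + M) n x} \<le> C * \<beta> ^ N" .
    moreover have "prob {x \<in> space ?P. \<not> column_good \<tau> R r (N \<le> n + M) n x} =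
      1 - prob {x \<in> space ?P. column_good \<tau> R r (N \<le> n + M) n x}"
      by (rule prob_neg) (rule sets_column_good)
    ultimately show "1 - C * \<beta> ^ N \<le> prob {x \<in> space ?P. column_good \<tau> R r (N \<le> n + M) n x}" by simp
  qed
qed

text \<open>Tridiagonalisation as an induction on the block size. Given the last column, the block
  conjugated by the reflection that this column determines has the same law as the block itself, so
  the probabilities of a good column and of a good block multiply. The truncated difference
  \<open>n + M - N\<close> stays 0 until only \<open>M\<close> columns remain and then grows by one
  link per column, reaching \<open>M\<close> at \<open>n = N\<close>.\<close>

lemma prob_axis_good:
  assumes N: "0 < N" and M: "M < N"
    and p: "\<And>n. n < N \<Longrightarrow> measure (Pi\<^sub>M (last_column n) (entry_law N))
      {x \<in> space (Pi\<^sub>M (last_column n) (entry_law N)). column_good \<tau> R r (N \<le> n + M) n x} \<ge> 1 - p"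
    and R: "0 < R" and r: "0 < r" and n: "n \<le> N"
  shows "\<exists>B\<in>sets (Pi\<^sub>M (upper_triangle n) (entry_law N)).
    measure (Pi\<^sub>M (upper_triangle n) (entry_law N)) B \<ge> 1 - n * p \<and>
    (\<forall>w\<in>B. quadratic_upper \<tau> R n w (axis_n n) \<and> (0 < n \<longrightarrow> geometric_test \<tau> r (n + M - N) n w (axis_n n)))"
  using n
proof (induction n)
  case 0
  interpret prob_space "Pi\<^sub>M (upper_triangle 0) (entry_law N)" by (intro prob_space_PiM_entry_law N)
  show ?case
    by (intro bexI[of _ "space (Pi\<^sub>M (upper_triangle 0) (entry_law N))"])
      (use prob_space in \<open>auto simp: quadratic_upper_def inner_n_def sym_form_def\<close>)
next
  case (Suc n)
  then obtain B where B: "B \<in> sets (Pi\<^sub>M (upper_triangle n) (entry_law N))"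
    "measure (Pi\<^sub>M (upper_triangle n) (entry_law N)) B \<ge> 1 - n * p"
    and BU: "\<And>w. w \<in> B \<Longrightarrow> quadratic_upper \<tau> R n w (axis_n n)"
    and BL: "\<And>w. w \<in> B \<Longrightarrow> 0 < n \<Longrightarrow> geometric_test \<tau> r (n + M - N) n w (axis_n n)"
    by auto
  let ?S = "Pi\<^sub>M (upper_triangle (Suc n)) (entry_law N)"
  let ?U = "Pi\<^sub>M (upper_triangle n) (entry_law N)"
  let ?C = "Pi\<^sub>M (last_column n) (entry_law N)"
  interpret S: prob_space ?S by (intro prob_space_PiM_entry_law N)
  interpret U: prob_space ?U by (intro prob_space_PiM_entry_law N)
  interpret C: prob_space ?C by (intro prob_space_PiM_entry_law N)
  interpret product_sigma_finite "entry_law N"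
    by (intro product_sigma_finite.intro prob_space_imp_sigma_finite prob_space_entry_law N)
  \<comment> \<open>The reflection along this vector sends the last column, without its diagonal
    entry, to its norm times the last axis of the block.\<close>
  define d where "d x i = x (i, n) - sqrt (inner_n n (\<lambda>i. x (i, n)) (\<lambda>i. x (i, n))) * axis_n n i"
    for x :: "nat \<times> nat \<Rightarrow> real" and i
  define G where "G = {x \<in> space ?C. column_good \<tau> R r (N \<le> n + M) n x}"
  define B' where "B' = {x \<in> space ?S. column_good \<tau> R r (N \<le> n + M) n x \<and> sym_conj n (d x) x \<in> B}"
  have comp: "(\<lambda>x. x q) \<in> borel_measurable ?S" if "q \<in> upper_triangle (Suc n)" for q
    using measurable_component_singleton[OF that, of "entry_law N"] by (simp cong: measurable_cong_sets)
  have dm: "(\<lambda>x. d x i) \<in> borel_measurable ?S" if "i < n" for i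
    unfolding d_def inner_n_def using that
    by (intro borel_measurable_diff borel_measurable_times borel_measurable_sqrt borel_measurable_const
        borel_measurable_sum comp measurable_compose[OF _ borel_measurable_sqrt]) (auto simp: upper_triangle_def)
  have "(\<lambda>x. sym_conj n (d x) x) \<in> measurable ?S (Pi\<^sub>M (upper_triangle n) (\<lambda>_. borel))"
    by (intro measurable_sym_conj dm comp) (auto simp: upper_triangle_Suc)
  then have cm: "(\<lambda>x. sym_conj n (d x) x) \<in> measurable ?S ?U"
    by (simp add: sets_PiM_entry_law cong: measurable_cong_sets)
  have Qm [measurable]: "(\<lambda>x. \<Sum>i<n. (x (i, n))\<^sup>2) \<in> borel_measurable ?S"
    by (intro borel_measurable_sum borel_measurable_power comp) (auto simp: upper_triangle_def)
  have nn [measurable]: "(\<lambda>x. x (n, n)) \<in> borel_measurable ?S"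
    by (intro comp) (auto simp: upper_triangle_def)
  have "{x \<in> space ?S. column_good \<tau> R r (N \<le> n + M) n x} \<in> sets ?S"
    unfolding column_good_def by measurable
  then have "{x \<in> space ?S. column_good \<tau> R r (N \<le> n + M) n x} \<inter> ((\<lambda>x. sym_conj n (d x) x) -` B \<inter> space ?S) \<in> sets ?S"
    using measurable_sets[OF cm B(1)] by (rule sets.Int)
  moreover have "{x \<in> space ?S. column_good \<tau> R r (N \<le> n + M) n x} \<inter> ((\<lambda>x. sym_conj n (d x) x) -` B \<inter> space ?S) = B'"
    by (auto simp: B'_def)
  ultimately have B'm: "B' \<in> sets ?S" by simp
  have Gm: "G \<in> sets ?C" unfolding G_def by (rule sets_column_good)
  let ?mg = "\<lambda>x y. merge (last_column n) (upper_triangle n) (x, y)"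
  have mg1: "?mg x y (i, n) = x (i, n)" if "i \<le> n" for x y i
    using that by (auto simp: merge_def last_column_def)
  have mg2: "?mg x y q = y q" if "q \<in> upper_triangle n" for x y q
    using that last_column_disjoint by (auto simp: merge_def)
  \<comment> \<open>For a fixed column the event factorises, because neither
    \<open>column_good\<close> nor \<open>d\<close> looks at the block.\<close>
  have ind: "indicator B' (?mg x y) = indicator G x * (indicator (sym_conj n (d x) -` B \<inter> space ?U) y :: ennreal)"
    if x: "x \<in> space ?C" and y: "y \<in> space ?U" for x y
  proof -
    have 1: "?mg x y \<in> space ?S"
      by (auto simp: space_PiM_entry_law upper_triangle_Suc merge_def extensional_def)
    have 2: "column_good \<tau> R r (N \<le> n + M) n (?mg x y) = column_good \<tau> R r (N \<le> n + M) n x"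
      by (simp add: column_good_def mg1)
    have "inner_n n (\<lambda>i. ?mg x y (i, n)) (\<lambda>i. ?mg x y (i, n)) = inner_n n (\<lambda>i. x (i, n)) (\<lambda>i. x (i, n))"
      by (intro inner_n_cong) (auto simp: mg1)
    then have "sym_conj n (d (?mg x y)) (?mg x y) = sym_conj n (d x) y"
      by (intro sym_conj_cong) (auto simp: d_def mg1 mg2)
    then show ?thesis using 1 2 x y by (auto simp: B'_def G_def indicator_def)
  qed
  have "emeasure ?S B' = (\<integral>\<^sup>+z. indicator B' z \<partial>?S)"
    using B'm by simp
  also have "\<dots> = (\<integral>\<^sup>+x. (\<integral>\<^sup>+y. indicator B' (?mg x y) \<partial>?U) \<partial>?C)"
    unfolding upper_triangle_Suc
    by (rule product_nn_integral_fold) (use last_column_disjoint B'm in \<open>auto simp: upper_triangle_Suc\<close>)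
  also have "\<dots> = (\<integral>\<^sup>+x. (\<integral>\<^sup>+y. indicator G x * indicator (sym_conj n (d x) -` B \<inter> space ?U) y \<partial>?U) \<partial>?C)"
    by (intro nn_integral_cong ind)
  also have "\<dots> = (\<integral>\<^sup>+x. indicator G x * emeasure ?U B \<partial>?C)"
  proof (rule nn_integral_cong)
    fix x
    have "sym_conj n (d x) -` B \<inter> space ?U \<in> sets ?U"
      using measurable_sym_conj_entry_law B(1) by (rule measurable_sets)
    then show "(\<integral>\<^sup>+y. indicator G x * indicator (sym_conj n (d x) -` B \<inter> space ?U) y \<partial>?U) = indicator G x * emeasure ?U B"
      by (simp add: nn_integral_cmult_indicator emeasure_sym_conj[OF N B(1)])
  qed
  also have "\<dots> = emeasure ?C G * emeasure ?U B"
    using Gm by (simp add: nn_integral_multc)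
  finally have "measure ?S B' = measure ?C G * measure ?U B"
    by (simp add: S.emeasure_eq_measure C.emeasure_eq_measure U.emeasure_eq_measure ennreal_mult'[symmetric])
  moreover have "measure ?C G \<ge> 1 - p" unfolding G_def using p Suc.prems by simp
  \<comment> \<open>Gives P Q \<ge> P + Q - 1 for the two probabilities, so each column costs at
    most \<open>p\<close>.\<close>
  moreover have "(1 - measure ?C G) * (1 - measure ?U B) \<ge> 0"
    using C.prob_le_1 U.prob_le_1 by (intro mult_nonneg_nonneg) auto
  ultimately have prob: "measure ?S B' \<ge> 1 - Suc n * p"
    using B(2) by (simp add: algebra_simps)
  have good: "quadratic_upper \<tau> R (Suc n) w (axis_n (Suc n)) \<and> geometric_test \<tau> r (Suc n + M - N) (Suc n) w (axis_n (Suc n))"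
    if w: "w \<in> B'" for w
  proof -
    define b where "b = sqrt (inner_n n (\<lambda>i. w (i, n)) (\<lambda>i. w (i, n)))"
    have g: "column_good \<tau> R r (N \<le> n + M) n w" and wB: "sym_conj n (d w) w \<in> B"
      using w by (auto simp: B'_def)
    have Q: "inner_n n (\<lambda>i. w (i, n)) (\<lambda>i. w (i, n)) = (\<Sum>i<n. (w (i, n))\<^sup>2)"
      by (simp add: inner_n_def power2_eq_square)
    have bR: "0 \<le> b" "b \<le> R" and br: "N \<le> n + M \<Longrightarrow> r \<le> b"
      using g R r inner_n_nonneg[of n "\<lambda>i. w (i, n)"]
      by (auto simp: b_def Q column_good_def intro!: real_le_lsqrt real_le_rsqrt)
    have a: "w (n, n) \<le> \<tau>" "- \<tau> \<le> w (n, n)" using g by (auto simp: column_good_def)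
    have c: "reflect n (d w) (\<lambda>i. w (i, n)) i = b * axis_n n i" if i: "i < n" for i
      unfolding b_def
    proof (rule reflect_to_axis)
      show "inner_n n (axis_n n) (axis_n n) = 1" using i by (simp add: inner_axis_n) (simp add: axis_n_def)
    qed (use i in \<open>auto simp: d_def\<close>)
    have "quadratic_upper \<tau> R (Suc n) w (axis_n (Suc n))"
      by (rule quadratic_upper_Suc[OF BU[OF wB] c bR a(1)])
    moreover have "geometric_test \<tau> r (Suc n + M - N) (Suc n) w (axis_n (Suc n))"
    proof (cases "N \<le> n + M")
      case True
      \<comment> \<open>\<open>M < N\<close> keeps the first link away from the empty block, which
        has no test vector.\<close>
      then have "0 < n" using M by (cases n) auto
      have "geometric_test \<tau> r (Suc (n + M - N)) (Suc n) w (axis_n (Suc n))"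
        by (rule geometric_test_Suc[OF BL[OF wB \<open>0 < n\<close>] c br[OF True] a(2)])
      then show ?thesis using True by (simp add: Suc_diff_le)
    next
      case False
      then show ?thesis using geometric_test_0[where w = w and n = n, OF a(2)] by simp
    qed
    ultimately show ?thesis by blast
  qed
  show ?case using B'm prob good by (intro bexI[of _ B']) auto
qed

text \<open>Reflecting \<open>e\<close> onto the last axis preserves the noise law, so
  \<open>p\<close> does not depend on \<open>e\<close>; this matters because the spike and its tilts
  change with N. The factor N in \<open>p\<close> counts the columns and is beaten by the
  exponential rate.\<close>

lemma prob_direction_good:
  fixes \<tau> R r :: real
  assumes \<tau>: "\<tau> > 0" and R: "R > 1" and r: "0 < r" "r < 1"
  obtains p :: "nat \<Rightarrow> real" where "p \<longlonglongrightarrow> 0" "\<And>N e. M < N \<Longrightarrow> inner_n N e e = 1 \<Longrightarrow>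
    \<exists>B\<in>sets (noise_law N). measure (noise_law N) B \<ge> 1 - p N \<and>
      (\<forall>w\<in>B. quadratic_upper \<tau> R N w e \<and> geometric_test \<tau> r M N w e)"
proof -
  obtain \<beta> C where \<beta>: "0 \<le> \<beta>" "\<beta> < 1" and C: "\<And>N n. 0 < N \<Longrightarrow> n < N \<Longrightarrow>
    measure (Pi\<^sub>M (last_column n) (entry_law N))
      {x \<in> space (Pi\<^sub>M (last_column n) (entry_law N)). column_good \<tau> R r (N \<le> n + M) n x} \<ge> 1 - C * \<beta> ^ N"
    by (rule prob_column_good[OF assms, where M = M]) (rule that)
  define p where "p N = real N * (C * \<beta> ^ N)" for N
  have "(\<lambda>N. C * (real N * \<beta> ^ N)) \<longlonglongrightarrow> C * 0"
    using \<beta> by (intro tendsto_mult tendsto_const powser_times_n_limit_0) auto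
  then have "p \<longlonglongrightarrow> 0" by (simp add: p_def[abs_def] mult_ac)
  then show thesis
  proof (rule that)
    fix N e assume N: "M < N" and e: "inner_n N e e = 1"
    let ?U = "Pi\<^sub>M (upper_triangle N) (entry_law N)"
    obtain B where B: "B \<in> sets ?U" "measure ?U B \<ge> 1 - p N"
      and good: "\<And>w. w \<in> B \<Longrightarrow> quadratic_upper \<tau> R N w (axis_n N)" "\<And>w. w \<in> B \<Longrightarrow> geometric_test \<tau> r M N w (axis_n N)"
      using prob_axis_good[where N = N and M = M and n = N and \<tau> = \<tau> and R = R and r = r and p = "C * \<beta> ^ N"] C N R r
      by (auto simp: p_def)
    define d where "d i = e i - axis_n N i" for i
    have re: "reflect N d e i = axis_n N i" if "i < N" for i
      using reflect_to_axis[of N "axis_n N" d e i] that N e by (simp add: inner_axis_n d_def) (simp add: axis_n_def)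
    have m: "sym_conj N d \<in> measurable ?U ?U" by (rule measurable_sym_conj_entry_law)
    let ?B = "sym_conj N d -` B \<inter> space ?U"
    have "measure ?U ?B = measure ?U B"
      using emeasure_sym_conj[of N B N d] B N by (simp add: measure_def)
    then show "\<exists>B\<in>sets (noise_law N). measure (noise_law N) B \<ge> 1 - p N \<and>
      (\<forall>w\<in>B. quadratic_upper \<tau> R N w e \<and> geometric_test \<tau> r M N w e)"
      unfolding noise_law_eq using B measurable_sets[OF m B(1)] good re
      by (intro bexI[of _ ?B]) (auto intro: quadratic_upper_reflect geometric_test_reflect)
  qed
qed

section \<open>Perturbation bounds for the top eigenvector\<close>

definition sym_apply :: "nat \<Rightarrow> (nat \<times> nat \<Rightarrow> real) \<Rightarrow> (nat \<Rightarrow> real) \<Rightarrow> nat \<Rightarrow> real" where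
  "sym_apply n w y i = (\<Sum>j<n. w (min i j, max i j) * y j)"

lemma sym_form_eq_inner: "sym_form n w y = inner_n n y (sym_apply n w y)"
  by (simp add: sym_form_def inner_n_def sym_apply_def sum_distrib_left algebra_simps)

lemma inner_sym_apply_commute: "inner_n n x (sym_apply n w y) = inner_n n y (sym_apply n w x)"
proof -
  have "inner_n n x (sym_apply n w y) = (\<Sum>i<n. \<Sum>j<n. x i * (w (min i j, max i j) * y j))"
    by (simp add: inner_n_def sym_apply_def sum_distrib_left)
  also have "\<dots> = (\<Sum>j<n. \<Sum>i<n. x i * (w (min i j, max i j) * y j))" by (rule sum.swap)
  also have "\<dots> = inner_n n y (sym_apply n w x)"
    by (simp add: inner_n_def sym_apply_def sum_distrib_left min.commute max.commute mult_ac)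
  finally show ?thesis .
qed

lemma sym_form_add_scale:
  "sym_form n w (\<lambda>i. x i + t * y i) = sym_form n w x + 2 * t * inner_n n y (sym_apply n w x) + t\<^sup>2 * sym_form n w y"
proof -
  have "sym_apply n w (\<lambda>i. x i + t * y i) = (\<lambda>i. sym_apply n w x i + t * sym_apply n w y i)"
    by (simp add: fun_eq_iff sym_apply_def distrib_left distrib_right sum.distrib sum_distrib_left mult_ac)
  then have "sym_form n w (\<lambda>i. x i + t * y i) = sym_form n w x + t * inner_n n x (sym_apply n w y) +
      t * inner_n n y (sym_apply n w x) + t * (t * sym_form n w y)"
    by (simp add: sym_form_eq_inner inner_n_linear algebra_simps)
  then show ?thesis
    by (simp add: inner_sym_apply_commute[of n x w y] power2_eq_square algebra_simps)
qed

lemma sym_form_attains_max: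
  assumes "n > 0"
  obtains z where "inner_n n z z = 1" "\<And>y. sym_form n w y \<le> sym_form n w z * inner_n n y y"
proof -
  \<comment> \<open>Vectors are functions on all natural numbers, and \<open>inner_n\<close> ignores
    the coordinates from \<open>n\<close> on. Pinning those to 0 makes the unit sphere a closed
    subset of a box that is compact by Tychonoff.\<close>
  define B where "B i = (if i < n then {-1..1} else {0 :: real})" for i :: nat
  define S where "S = Pi\<^sub>E UNIV B \<inter> {z. inner_n n z z = 1}"
  have c: "continuous_on A (\<lambda>z. z i)" for A :: "(nat \<Rightarrow> real) set" and i
    by (rule continuous_on_subset[OF continuous_on_product_coordinates]) auto
  have "compactin (product_topology (\<lambda>i. euclidean) UNIV) (Pi\<^sub>E UNIV B)"
    unfolding compactin_PiE by (auto simp: B_def)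
  then have "compact (Pi\<^sub>E UNIV B)" by (simp add: euclidean_product_topology)
  moreover have "closed {z. inner_n n z z = 1}"
    unfolding inner_n_def by (intro closed_Collect_eq continuous_intros c)
  ultimately have "compact S" unfolding S_def by (rule compact_Int_closed)
  moreover have "(\<lambda>i. if i = 0 then 1 else 0) \<in> S"
    using assms by (auto simp: S_def B_def inner_n_def if_distrib[of "\<lambda>x. x * _"] cong: if_cong)
  then have "S \<noteq> {}" by blast
  moreover have "continuous_on S (sym_form n w)"
    unfolding sym_form_def by (intro continuous_intros c)
  ultimately obtain z where z: "z \<in> S" "\<And>y. y \<in> S \<Longrightarrow> sym_form n w y \<le> sym_form n w z"
    using continuous_attains_sup by metis
  have "sym_form n w y \<le> sym_form n w z * inner_n n y y" for y
  proof (cases "inner_n n y y = 0")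
    case True
    then have "sym_form n w y = 0" by (auto simp: sym_form_def dest: inner_n_eq_0 intro!: sum.neutral)
    then show ?thesis by (simp add: True)
  next
    case False
    then have pos: "inner_n n y y > 0" using inner_n_nonneg[of n y] by simp
    define c where "c = 1 / sqrt (inner_n n y y)"
    have c2: "c\<^sup>2 * inner_n n y y = 1" using pos by (simp add: c_def power_divide)
    define y' where "y' i = (if i < n then c * y i else 0)" for i
    have "inner_n n y' y' = inner_n n (\<lambda>i. c * y i) (\<lambda>i. c * y i)"
      by (intro inner_n_cong) (auto simp: y'_def)
    also have "\<dots> = 1" using c2 by (simp add: inner_n_linear power2_eq_square mult_ac)
    finally have y': "inner_n n y' y' = 1" .
    have "(y' i)\<^sup>2 \<le> 1" if "i < n" for i
    proof -
      have "(y' i)\<^sup>2 \<le> (\<Sum>i<n. (y' i)\<^sup>2)" using that by (intro member_le_sum) auto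
      then show ?thesis using y' by (simp add: inner_n_def power2_eq_square)
    qed
    then have "y' \<in> S" using y' by (auto simp: S_def B_def abs_square_le_1 abs_le_iff) (auto simp: y'_def)
    then have "sym_form n w y' \<le> sym_form n w z" by (rule z)
    moreover have "sym_form n w y' = sym_form n w (\<lambda>i. c * y i)"
      by (intro sym_form_cong) (auto simp: y'_def)
    ultimately have "c\<^sup>2 * sym_form n w y \<le> sym_form n w z" by (simp add: sym_form_scale)
    then have "c\<^sup>2 * sym_form n w y * inner_n n y y \<le> sym_form n w z * inner_n n y y"
      using pos by (intro mult_right_mono) auto
    moreover have "c\<^sup>2 * sym_form n w y * inner_n n y y = sym_form n w y * (c\<^sup>2 * inner_n n y y)" by simp
    ultimately show ?thesis by (simp only: c2 mult_1_right)
  qed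
  then show ?thesis using z(1) by (intro that) (auto simp: S_def)
qed

text \<open>First-order optimality: moving \<open>z\<close> by \<open>t\<close> times the residual
  \<open>g\<close> would raise the Rayleigh quotient to first order by 2 t (g, g), which is
  impossible unless \<open>g\<close> vanishes.\<close>

lemma sym_form_max_eigen:
  assumes z: "inner_n n z z = 1" and max: "\<And>y. sym_form n w y \<le> sym_form n w z * inner_n n y y" and i: "i < n"
  shows "sym_apply n w z i = sym_form n w z * z i"
proof -
  define l where "l = sym_form n w z"
  define g where "g i = sym_apply n w z i - l * z i" for i
  define C where "C = l * inner_n n g g - sym_form n w g"
  have gg: "inner_n n g (sym_apply n w z) - l * inner_n n g z = inner_n n g g"
  proof -
    have "inner_n n g g = inner_n n g (\<lambda>i. sym_apply n w z i - l * z i)"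
      by (intro inner_n_cong) (auto simp: g_def)
    then show ?thesis by (simp add: inner_n_linear)
  qed
  have key: "2 * t * inner_n n g g \<le> t\<^sup>2 * C" for t
  proof -
    have "inner_n n (\<lambda>i. z i + t * g i) (\<lambda>i. z i + t * g i) = 1 + 2 * t * inner_n n g z + t\<^sup>2 * inner_n n g g"
      using z by (simp add: inner_n_linear inner_n_commute[of n z g] power2_eq_square algebra_simps)
    with max[of "\<lambda>i. z i + t * g i"]
    have "l + 2 * t * inner_n n g (sym_apply n w z) + t\<^sup>2 * sym_form n w g \<le>
       l * (1 + 2 * t * inner_n n g z + t\<^sup>2 * inner_n n g g)"
      by (simp add: sym_form_add_scale l_def)
    then have "2 * t * (inner_n n g (sym_apply n w z) - l * inner_n n g z) \<le> t\<^sup>2 * C"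
      by (simp add: C_def algebra_simps)
    then show ?thesis by (simp add: gg)
  qed
  have "inner_n n g g = 0"
  proof (rule ccontr)
    assume "inner_n n g g \<noteq> 0"
    then have pos: "inner_n n g g > 0" using inner_n_nonneg[of n g] by simp
    \<comment> \<open>Small enough that the quadratic term \<open>t^2 * C\<close> cannot outweigh
      the linear one, whatever the sign of \<open>C\<close>.\<close>
    define t where "t = inner_n n g g / (\<bar>C\<bar> + 1)"
    have t: "t > 0" "t * (\<bar>C\<bar> + 1) = inner_n n g g" using pos by (auto simp: t_def)
    have "t * (2 * inner_n n g g) \<le> t * (t * C)" using key[of t] by (simp add: power2_eq_square mult_ac)
    then have "2 * inner_n n g g \<le> t * C" using t(1) by simp
    also have "\<dots> \<le> t * (\<bar>C\<bar> + 1)" using t(1) by (intro mult_left_mono) auto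
    finally show False using pos t(2) by simp
  qed
  then have "g i = 0" using i by (rule inner_n_eq_0)
  then show ?thesis by (simp add: g_def l_def)
qed

lemma eigenvector_sym_mat_iff:
  "eigenvector (sym_mat n w) x \<mu> \<longleftrightarrow> dim_vec x = n \<and> x \<noteq> 0\<^sub>v n \<and>
     (\<forall>i<n. sym_apply n w (\<lambda>i. vec_index x i) i = \<mu> * vec_index x i)"
proof -
  have 1: "vec_index (sym_mat n w *\<^sub>v x) i = sym_apply n w (\<lambda>i. vec_index x i) i" if "dim_vec x = n" "i < n" for i
    using that by (simp add: sym_mat_def scalar_prod_def sym_apply_def lessThan_atLeast0)
  have 2: "dim_vec (sym_mat n w *\<^sub>v x) = n" "dim_row (sym_mat n w) = n" by (simp_all add: sym_mat_def)
  have 3: "sym_mat n w *\<^sub>v x = \<mu> \<cdot>\<^sub>v x \<longleftrightarrow> (\<forall>i<n. sym_apply n w (\<lambda>i. vec_index x i) i = \<mu> * vec_index x i)"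
    if "dim_vec x = n"
    using that 1[OF that] 2(1) unfolding vec_eq_iff by simp
  have 4: "x \<in> carrier_vec n \<longleftrightarrow> dim_vec x = n" by (metis carrier_vec_dim_vec carrier_vecD)
  show ?thesis
    unfolding eigenvector_def 2(2) 4 using 3 by blast
qed

text \<open>\<open>largest_eigenvalue\<close> compares eigenvalues only, whereas the estimates need
  a bound on the whole form. The maximiser of the form on the sphere is an eigenvector, so the
  maximum is at most \<open>\<mu>\<close>.\<close>

lemma principal_eigenvector_sym_mat:
  assumes "principal_eigenvector K (sym_mat n w) x"
  obtains \<mu> where "dim_vec x = n" "inner_n n (\<lambda>i. vec_index x i) (\<lambda>i. vec_index x i) = real K"
    "0 \<le> (\<Sum>i<n. vec_index x i)" "sym_form n w (\<lambda>i. vec_index x i) = \<mu> * real K"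
    "\<And>y. sym_form n w y \<le> \<mu> * inner_n n y y"
proof -
  let ?x = "\<lambda>i. vec_index x i"
  obtain \<mu> where le: "largest_eigenvalue (sym_mat n w) \<mu>" and ev: "eigenvector (sym_mat n w) x \<mu>"
    and K: "scalar_prod x x = real K" and s: "(\<Sum>i<dim_vec x. ?x i) \<ge> 0"
    using assms by (auto simp: principal_eigenvector_def)
  have x: "dim_vec x = n" "x \<noteq> 0\<^sub>v n" and ap: "\<And>i. i < n \<Longrightarrow> sym_apply n w ?x i = \<mu> * ?x i"
    using ev by (auto simp: eigenvector_sym_mat_iff)
  have K': "inner_n n ?x ?x = real K"
    using K x by (simp add: inner_n_def scalar_prod_def lessThan_atLeast0)
  have "sym_form n w ?x = inner_n n ?x (\<lambda>i. \<mu> * ?x i)"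
    unfolding sym_form_eq_inner by (intro inner_n_cong ap refl)
  then have form: "sym_form n w ?x = \<mu> * real K" by (simp add: inner_n_linear K')
  have n: "n > 0"
  proof (rule ccontr)
    assume "\<not> n > 0"
    then have "x = 0\<^sub>v n" using x(1) by (intro eq_vecI) auto
    with x(2) show False by contradiction
  qed
  obtain z where z: "inner_n n z z = 1" "\<And>y. sym_form n w y \<le> sym_form n w z * inner_n n y y"
    using sym_form_attains_max[OF n] by metis
  have "sym_apply n w (\<lambda>i. vec_index (vec n z) i) i = sym_form n w z * vec_index (vec n z) i" if "i < n" for i
    using sym_form_max_eigen[OF z that] that by (simp add: sym_apply_def)
  moreover have "vec n z \<noteq> 0\<^sub>v n"
  proof
    assume "vec n z = 0\<^sub>v n"
    then have "z i = 0" if "i < n" for i using index_vec[OF that, of z] that by simp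
    then show False using z(1) by (simp add: inner_n_def)
  qed
  ultimately have "eigenvalue (sym_mat n w) (sym_form n w z)"
    unfolding eigenvalue_def by (intro exI[of _ "vec n z"]) (simp add: eigenvector_sym_mat_iff)
  then have "sym_form n w z \<le> \<mu>" using le by (auto simp: largest_eigenvalue_def)
  then have "sym_form n w y \<le> \<mu> * inner_n n y y" for y
    using z(2)[of y] mult_right_mono[OF _ inner_n_nonneg[of n y], of "sym_form n w z" \<mu>] by linarith
  with x K' s form that show ?thesis by auto
qed

section \<open>Inequalities for the spiked form\<close>

lemma observation_eq_sym_mat:
  assumes "dim_vec v = n"
  shows "observation n lam v w = sym_mat n (\<lambda>(i, j)\<in>upper_triangle n. lam / real n * (vec_index v i * vec_index v j) + w (i, j))"
proof -
  have "(min i j, max i j) \<in> upper_triangle n" if "i < n" "j < n" for i j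
    using that by (auto simp: upper_triangle_def min_def max_def)
  then show ?thesis
    by (intro eq_matI) (auto simp: observation_def sym_mat_def min_def max_def)
qed

lemma sym_form_observation:
  "sym_form n (\<lambda>(i, j)\<in>upper_triangle n. c * (a i * a j) + w (i, j)) y = c * (inner_n n a y)\<^sup>2 + sym_form n w y"
proof -
  have m: "(min i j, max i j) \<in> upper_triangle n" if "i < n" "j < n" for i j
    using that by (auto simp: upper_triangle_def min_def max_def)
  have "sym_form n (\<lambda>(i, j)\<in>upper_triangle n. c * (a i * a j) + w (i, j)) y =
    (\<Sum>i<n. \<Sum>j<n. c * ((a i * y i) * (a j * y j)) + w (min i j, max i j) * y i * y j)"
    unfolding sym_form_def
  proof (intro sum.cong refl)
    fix i j assume "i \<in> {..<n}" "j \<in> {..<n}"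
    then have "(\<lambda>(i, j)\<in>upper_triangle n. c * (a i * a j) + w (i, j)) (min i j, max i j) =
        c * (a i * a j) + w (min i j, max i j)"
      using m[of i j] by (simp add: min_def max_def mult.commute)
    then show "(\<lambda>(i, j)\<in>upper_triangle n. c * (a i * a j) + w (i, j)) (min i j, max i j) * y i * y j =
        c * ((a i * y i) * (a j * y j)) + w (min i j, max i j) * y i * y j"
      by (simp only: distrib_right) (simp add: mult_ac)
  qed
  also have "\<dots> = c * (inner_n n a y)\<^sup>2 + sym_form n w y"
  proof -
    have "(inner_n n a y)\<^sup>2 = (\<Sum>i<n. \<Sum>j<n. (a i * y i) * (a j * y j))"
      unfolding inner_n_def power2_eq_square by (rule sum_product)
    then show ?thesis by (simp only: sum.distrib sym_form_def sum_distrib_left)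
  qed
  finally show ?thesis .
qed

text \<open>With \<open>q = 1 / \<theta>\<close> the geometric test vector is a truncation of the top eigenvector of the
  limiting Jacobi matrix, whose eigenvalue is \<open>\<theta> + 1 / \<theta>\<close>.\<close>

lemma top_eigenvalue_lower_bound:
  assumes L: "geometric_test \<tau> r M n w u"
    and max: "\<And>y. sym_form n w y + \<theta> * (inner_n n u y)\<^sup>2 \<le> \<mu> * inner_n n y y"
    and \<theta>: "1 \<le> \<theta>" and r: "0 \<le> r" "r \<le> 1"
  shows "\<theta> + 1 / \<theta> - \<tau> - 2 * (1 - r) - 2 * (1 / \<theta>) ^ (2 * M) \<le> \<mu>"
proof -
  \<comment> \<open>At this q the spike contributes \<open>\<theta> / P \<ge> \<theta> - q\<close>
    to the Rayleigh quotient and the links nearly \<open>2 * q\<close>, together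
    \<open>\<theta> + q\<close>. The remaining errors come from \<open>\<tau>\<close>, from
    \<open>1 - r\<close> and from the truncation after \<open>M\<close> links.\<close>
  define q where "q = 1 / \<theta>"
  have q: "0 < q" "q \<le> 1" "\<theta> * q = 1" using \<theta> by (auto simp: q_def)
  define P where "P = (\<Sum>k<Suc M. q ^ (2 * k))"
  obtain y where y: "inner_n n u y = 1" "inner_n n y y = P"
    "sym_form n w y \<ge> - \<tau> * P + 2 * r * (\<Sum>k<M. q ^ (2 * k + 1))"
    using L q(1) by (auto simp: geometric_test_def P_def)
  have "P = (\<Sum>k<M. q ^ (2 * k)) + q ^ (2 * M)" by (simp add: P_def)
  then have s: "(\<Sum>k<M. q ^ (2 * k + 1)) = q * (P - q ^ (2 * M))"
    by (simp add: sum_distrib_left)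
  have P1: "1 \<le> P"
  proof -
    have "(\<Sum>k<M. q ^ (2 * Suc k)) \<ge> 0" using q by (intro sum_nonneg) auto
    then show ?thesis unfolding P_def by (subst sum.lessThan_Suc_shift) simp
  qed
  have "P = (\<Sum>k<Suc M. (q\<^sup>2) ^ k)" by (simp only: P_def power_mult)
  then have "(1 - q\<^sup>2) * P = 1 - (q\<^sup>2) ^ Suc M" by (simp only: one_diff_power_eq)
  then have "(1 - q\<^sup>2) * P \<le> 1" using q by simp
  then have "\<theta> * ((1 - q\<^sup>2) * P) \<le> \<theta>" using \<theta> mult_left_mono[of "(1 - q\<^sup>2) * P" 1 \<theta>] by simp
  moreover have "\<theta> * ((1 - q\<^sup>2) * P) = P * (\<theta> - q * (\<theta> * q))" by (simp add: power2_eq_square algebra_simps)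
  ultimately have th: "P * (\<theta> - q) \<le> \<theta>" using q by simp
  have e1: "2 * r * q * q ^ (2 * M) \<le> P * (2 * q ^ (2 * M))"
  proof -
    have "r * q \<le> 1 * 1" using q r by (intro mult_mono) auto
    then have "r * q \<le> P" using P1 by simp
    then have "(r * q) * (2 * q ^ (2 * M)) \<le> P * (2 * q ^ (2 * M))" using q by (intro mult_right_mono) auto
    then show ?thesis by (simp add: mult_ac)
  qed
  have e2: "P * (2 * q * (1 - r)) \<le> P * (2 * (1 - r))"
  proof -
    have "q * (1 - r) \<le> 1 * (1 - r)" using q r by (intro mult_right_mono) auto
    then show ?thesis using P1 by (intro mult_left_mono) auto
  qed
  have "(\<theta> + q - \<tau> - 2 * (1 - r) - 2 * q ^ (2 * M)) * P =
     P * (\<theta> - q) + 2 * q * P - \<tau> * P - P * (2 * (1 - r)) - P * (2 * q ^ (2 * M))"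
    by (simp add: algebra_simps)
  also have "\<dots> \<le> \<theta> + 2 * q * P - \<tau> * P - P * (2 * q * (1 - r)) - 2 * r * q * q ^ (2 * M)"
    using th e1 e2 by linarith
  also have "\<dots> = - \<tau> * P + 2 * r * (q * (P - q ^ (2 * M))) + \<theta>" by (simp add: algebra_simps)
  also have "\<dots> \<le> \<mu> * P" using max[of y] y s by simp
  finally show ?thesis using P1 by (simp add: q_def)
qed

text \<open>At q = 1 the noise contributes at most about 2, and \<theta> + 1/\<theta> - 2 = \<theta>
  (1 - 1/\<theta>)^2 is left for the spike. As \<open>1 \<le> \<theta>\<close>, the errors may be
  multiplied by \<open>\<theta>\<close> before it is divided out.\<close>

lemma overlap_lower_bound:
  assumes U: "quadratic_upper \<tau> R n w u" and y: "inner_n n y y = 1"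
    and eq: "sym_form n w y + \<theta> * (inner_n n u y)\<^sup>2 = \<mu>"
    and \<mu>: "\<theta> + 1 / \<theta> - \<eta> \<le> \<mu>" and \<theta>: "1 \<le> \<theta>" and R: "1 \<le> R" and \<eta>: "0 \<le> \<eta>" "0 \<le> \<tau>"
  shows "(1 - 1 / \<theta>)\<^sup>2 - \<eta> - \<tau> - 2 * (R - 1) \<le> (inner_n n u y)\<^sup>2"
proof -
  let ?a = "inner_n n u y"
  have "sym_form n w y \<le> (\<tau> + R * (1 + 1 / 1)) * inner_n n y y - R / 1 * ?a\<^sup>2"
    using U unfolding quadratic_upper_def by (rule allE[of _ 1]) auto
  moreover have "R * ?a\<^sup>2 \<ge> 0" using R by simp
  ultimately have "sym_form n w y \<le> \<tau> + 2 * R" using y by simp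
  then have "\<theta> + 1 / \<theta> - 2 - (\<eta> + \<tau> + 2 * (R - 1)) \<le> \<theta> * ?a\<^sup>2" using eq \<mu> by simp
  moreover have "\<theta> + 1 / \<theta> - 2 = \<theta> * (1 - 1 / \<theta>)\<^sup>2"
    using \<theta> by (simp add: power2_eq_square field_simps)
  moreover have "\<eta> + \<tau> + 2 * (R - 1) \<le> \<theta> * (\<eta> + \<tau> + 2 * (R - 1))"
    using \<theta> \<eta> R mult_right_mono[of 1 \<theta> "\<eta> + \<tau> + 2 * (R - 1)"] by simp
  ultimately have "\<theta> * ((1 - 1 / \<theta>)\<^sup>2 - (\<eta> + \<tau> + 2 * (R - 1))) \<le> \<theta> * ?a\<^sup>2"
    by (simp add: right_diff_distrib)
  then show ?thesis using \<theta> by simp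
qed

text \<open>A spike of strength \<theta> + s^2 / \<theta> in this direction has the form \<theta>
  (u, y)^2 + 2 s (u, y) (f, y) + (s^2 / \<theta>) (f, y)^2: the original spike, the cross term to be
  bounded, and a nonnegative rest.\<close>

definition tilted :: "real \<Rightarrow> real \<Rightarrow> (nat \<Rightarrow> real) \<Rightarrow> (nat \<Rightarrow> real) \<Rightarrow> nat \<Rightarrow> real" where
  "tilted \<theta> s u f i = (\<theta> * u i + s * f i) / sqrt (\<theta>\<^sup>2 + s\<^sup>2)"

lemma tilted_unit:
  assumes "inner_n n u u = 1" "inner_n n f f = 1" "inner_n n u f = 0" "\<theta> > 0"
  shows "inner_n n (tilted \<theta> s u f) (tilted \<theta> s u f) = 1"
proof -
  define c where "c = 1 / sqrt (\<theta>\<^sup>2 + s\<^sup>2)"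
  have "\<theta>\<^sup>2 + s\<^sup>2 > 0" using assms by (simp add: add_pos_nonneg)
  then have c: "c\<^sup>2 * (\<theta>\<^sup>2 + s\<^sup>2) = 1" using assms(4) by (simp add: c_def power_divide)
  have "inner_n n (tilted \<theta> s u f) (tilted \<theta> s u f) = inner_n n (\<lambda>i. c * (\<theta> * u i + s * f i)) (\<lambda>i. c * (\<theta> * u i + s * f i))"
    by (intro inner_n_cong) (auto simp: tilted_def c_def)
  also have "\<dots> = c\<^sup>2 * (\<theta>\<^sup>2 + s\<^sup>2)"
    using assms by (simp add: inner_n_linear inner_n_commute[of n f u] power2_eq_square algebra_simps)
  finally show ?thesis by (simp only: c)
qed

text \<open>A first-order perturbation argument: tilting the spike from \<open>u\<close> towards \<open>f\<close> by \<open>s\<close> raises the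
  top eigenvalue by \<open>O(s\<^sup>2)\<close> only, so the linear term \<open>2 s (u, y) (f, y)\<close> must be small.\<close>

lemma overlap_product_bound:
  assumes U: "quadratic_upper \<tau> R n w (tilted \<theta> s u f)" and y: "inner_n n y y = 1"
    and eq: "sym_form n w y + \<theta> * (inner_n n u y)\<^sup>2 = \<mu>"
    and \<mu>: "\<theta> + 1 / \<theta> - \<eta> \<le> \<mu>" and \<theta>: "1 \<le> \<theta>" and R: "1 \<le> R"
  shows "2 * s * (inner_n n u y * inner_n n f y) \<le> \<tau> + (R - 1) * (\<theta> + s\<^sup>2 + 1) + s\<^sup>2 + \<eta>"
proof -
  let ?a = "inner_n n u y" and ?b = "inner_n n f y"
  define T where "T = \<theta> + s\<^sup>2 / \<theta>"
  have T: "\<theta> \<le> T" "T \<le> \<theta> + s\<^sup>2" "T > 0"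
    using \<theta> by (auto simp: T_def divide_le_eq mult_le_cancel_left1 add_pos_nonneg)
  have pos: "\<theta>\<^sup>2 + s\<^sup>2 > 0" using \<theta> by (simp add: add_pos_nonneg)
  define c where "c = 1 / sqrt (\<theta>\<^sup>2 + s\<^sup>2)"
  have c: "c\<^sup>2 * (\<theta>\<^sup>2 + s\<^sup>2) = 1" using pos \<theta> by (simp add: c_def power_divide)
  have "inner_n n (tilted \<theta> s u f) y = inner_n n (\<lambda>i. c * (\<theta> * u i + s * f i)) y"
    by (intro inner_n_cong) (auto simp: tilted_def c_def)
  also have "\<dots> = c * (\<theta> * ?a + s * ?b)" by (simp add: inner_n_linear)
  finally have tb: "inner_n n (tilted \<theta> s u f) y = c * (\<theta> * ?a + s * ?b)" .
  have "T * \<theta> = \<theta>\<^sup>2 + s\<^sup>2" using \<theta> by (simp add: T_def power2_eq_square field_simps)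
  then have "\<theta> * (T * (inner_n n (tilted \<theta> s u f) y)\<^sup>2) = (c\<^sup>2 * (\<theta>\<^sup>2 + s\<^sup>2)) * (\<theta> * ?a + s * ?b)\<^sup>2"
    by (simp add: tb power_mult_distrib mult_ac)
  also have "\<dots> = \<theta> * (\<theta> * ?a\<^sup>2 + 2 * s * (?a * ?b)) + (s * ?b)\<^sup>2"
    unfolding c by (simp add: power2_eq_square algebra_simps)
  also have "\<dots> \<ge> \<theta> * (\<theta> * ?a\<^sup>2 + 2 * s * (?a * ?b))" by simp
  finally have sq: "\<theta> * ?a\<^sup>2 + 2 * s * (?a * ?b) \<le> T * (inner_n n (tilted \<theta> s u f) y)\<^sup>2"
    using \<theta> by simp
  \<comment> \<open>At q = 1 / T the reserve term absorbs a tilted spike of strength T. What remains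
    is about T + 1 / T, which exceeds \<theta> + 1 / \<theta> by at most s^2.\<close>
  have "sym_form n w y \<le> (\<tau> + R * (1 / T + 1 / (1 / T))) * inner_n n y y - R / (1 / T) * (inner_n n (tilted \<theta> s u f) y)\<^sup>2"
    using U T(3) unfolding quadratic_upper_def by (metis zero_less_divide_1_iff)
  then have "sym_form n w y + R * (T * (inner_n n (tilted \<theta> s u f) y)\<^sup>2) \<le> \<tau> + R * (1 / T + T)"
    using y by (simp add: mult_ac)
  moreover have "T * (inner_n n (tilted \<theta> s u f) y)\<^sup>2 \<le> R * (T * (inner_n n (tilted \<theta> s u f) y)\<^sup>2)"
    using R T mult_right_mono[of 1 R "T * (inner_n n (tilted \<theta> s u f) y)\<^sup>2"] by simp
  ultimately have "\<mu> + 2 * s * (?a * ?b) \<le> \<tau> + R * (1 / T + T)" using sq eq by linarith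
  also have "\<dots> = \<tau> + (R - 1) * (1 / T + T) + 1 / T + T" by (simp only: left_diff_distrib) simp
  also have "\<dots> \<le> \<tau> + (R - 1) * (\<theta> + s\<^sup>2 + 1) + 1 / \<theta> + (\<theta> + s\<^sup>2)"
  proof -
    have "1 / T \<le> 1 / \<theta>" using T \<theta> by (simp add: frac_le)
    moreover have "1 / T \<le> 1" using T \<theta> by simp
    then have "1 / T + T \<le> \<theta> + s\<^sup>2 + 1" using T(2) by linarith
    then have "(R - 1) * (1 / T + T) \<le> (R - 1) * (\<theta> + s\<^sup>2 + 1)"
      using R by (intro mult_left_mono) auto
    ultimately show ?thesis using T by linarith
  qed
  finally show ?thesis using \<mu> by simp
qed

section \<open>Random rounding\<close>

text \<open>Removing \<open>i\<close> is the bijection. The predicate \<open>Q\<close> lets it be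
  used also when a second element is prescribed.\<close>

lemma card_subsets_with_element:
  assumes A: "finite A" and i: "i \<in> A"
  shows "card {T. T \<subseteq> A \<and> card T = Suc k \<and> i \<in> T \<and> Q (T - {i})} = card {U. U \<subseteq> A - {i} \<and> card U = k \<and> Q U}"
proof (rule bij_betw_same_card[of "\<lambda>T. T - {i}"], rule bij_betw_byWitness[where f' = "insert i"])
  show "\<forall>T\<in>{T. T \<subseteq> A \<and> card T = Suc k \<and> i \<in> T \<and> Q (T - {i})}. insert i (T - {i}) = T" by auto
  show "\<forall>U\<in>{U. U \<subseteq> A - {i} \<and> card U = k \<and> Q U}. insert i U - {i} = U" by auto
  show "(\<lambda>T. T - {i}) ` {T. T \<subseteq> A \<and> card T = Suc k \<and> i \<in> T \<and> Q (T - {i})} \<subseteq> {U. U \<subseteq> A - {i} \<and> card U = k \<and> Q U}"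
    by auto
  show "insert i ` {U. U \<subseteq> A - {i} \<and> card U = k \<and> Q U} \<subseteq> {T. T \<subseteq> A \<and> card T = Suc k \<and> i \<in> T \<and> Q (T - {i})}"
  proof safe
    fix U assume U: "U \<subseteq> A - {i}" "Q U" "k = card U"
    then have "finite U" "i \<notin> U" using A finite_subset by auto
    then show "card (insert i U) = Suc (card U)" "Q (insert i U - {i})" using U by auto
  qed (use i in auto)
qed

lemma card_subsets_one:
  assumes A: "finite A" and i: "i \<in> A" and K: "0 < K"
  shows "card A * card {T. T \<subseteq> A \<and> card T = K \<and> i \<in> T} = K * card {T. T \<subseteq> A \<and> card T = K}"
proof -
  obtain k where k: "K = Suc k" using K by (cases K) auto
  have "card {T. T \<subseteq> A \<and> card T = K \<and> i \<in> T} = card {U. U \<subseteq> A - {i} \<and> card U = k}"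
    using card_subsets_with_element[OF A i, of k "\<lambda>_. True"] by (simp add: k)
  also have "\<dots> = (card A - 1) choose k" using A i by (simp add: n_subsets)
  finally show ?thesis
    using binomial_absorption[of k "card A"] A by (simp add: n_subsets k)
qed

text \<open>Sampling without replacement is negatively correlated: among the sets containing
  \<open>i\<close>, the proportion that contain \<open>j\<close> is
  \<open>(K - 1) / (card A - 1)\<close>, at most \<open>K / card A\<close>. Covariances can
  therefore be dropped from the variance.\<close>

lemma card_subsets_two:
  assumes A: "finite A" and ij: "i \<in> A" "j \<in> A" "i \<noteq> j" and K: "0 < K" "K \<le> card A"
  shows "(card A)\<^sup>2 * card {T. T \<subseteq> A \<and> card T = K \<and> i \<in> T \<and> j \<in> T} \<le> K\<^sup>2 * card {T. T \<subseteq> A \<and> card T = K}"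
proof -
  let ?s = "card A"
  let ?n1 = "card {T. T \<subseteq> A \<and> card T = K \<and> i \<in> T}" and ?n2 = "card {T. T \<subseteq> A \<and> card T = K \<and> i \<in> T \<and> j \<in> T}"
  obtain k where k: "K = Suc k" using K by (cases K) auto
  have "{i, j} \<subseteq> A" using ij by auto
  then have s2: "2 \<le> ?s" using card_mono[OF A, of "{i, j}"] ij by simp
  have n1: "?n1 = card {U. U \<subseteq> A - {i} \<and> card U = k}"
    using card_subsets_with_element[OF A ij(1), of k "\<lambda>_. True"] by (simp add: k)
  have eq: "{T. T \<subseteq> A \<and> card T = Suc k \<and> i \<in> T \<and> j \<in> T - {i}} = {T. T \<subseteq> A \<and> card T = K \<and> i \<in> T \<and> j \<in> T}"
    using ij by (auto simp: k)
  have n2: "?n2 = card {U. U \<subseteq> A - {i} \<and> card U = k \<and> j \<in> U}"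
    using card_subsets_with_element[OF A ij(1), of k "\<lambda>T. j \<in> T"] unfolding eq .
  have "(?s - 1) * ?n2 = k * ?n1"
  proof (cases "k = 0")
    case True
    have "{U. U \<subseteq> A - {i} \<and> card U = k \<and> j \<in> U} = {}"
      using True A by (auto dest: finite_subset)
    then have "?n2 = 0" by (simp only: n2 card.empty)
    then show ?thesis using True by simp
  next
    case False
    then show ?thesis using card_subsets_one[of "A - {i}" j k] A ij by (simp add: n1 n2)
  qed
  moreover have "?s * ?n1 = K * card {T. T \<subseteq> A \<and> card T = K}"
    by (rule card_subsets_one[OF A ij(1) K(1)])
  ultimately have "(?s - 1) * (?s * ?n2) = k * (K * card {T. T \<subseteq> A \<and> card T = K})"
    by (simp only: mult.left_commute[of _ ?s]) (simp only: mult.left_commute[of ?s])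
  then have "(?s - 1) * (?s\<^sup>2 * ?n2) = ?s * k * (K * card {T. T \<subseteq> A \<and> card T = K})"
    by (simp add: power2_eq_square mult_ac)
  also have "\<dots> \<le> (?s - 1) * K * (K * card {T. T \<subseteq> A \<and> card T = K})"
  proof (rule mult_right_mono)
    have "?s * k + K \<le> ?s * k + ?s" using K by simp
    then show "?s * k \<le> (?s - 1) * K" by (simp add: k diff_mult_distrib)
  qed simp
  finally have "(?s - 1) * (?s\<^sup>2 * ?n2) \<le> (?s - 1) * (K\<^sup>2 * card {T. T \<subseteq> A \<and> card T = K})"
    by (simp add: power2_eq_square mult_ac)
  then show ?thesis using s2 by simp
qed

text \<open>Chebyshev's inequality: the variance of the hypergeometric distribution is at most its mean.\<close>

lemma hypergeometric_lower_tail: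
  assumes A: "finite A" and D: "D \<subseteq> A" and K: "0 < K" "K \<le> card A"
    and m: "m = real K * real (card D) / real (card A)" "m > 0"
  shows "measure_pmf.prob (pmf_of_set {T. T \<subseteq> A \<and> card T = K}) {T. real (card (T \<inter> D)) < m / 2} \<le> 4 / m"
proof -
  define \<Omega> where "\<Omega> = {T. T \<subseteq> A \<and> card T = K}"
  define n where "n = card \<Omega>"
  define p where "p = real K / real (card A)"
  have fin: "finite \<Omega>" using A by (simp add: \<Omega>_def)
  have finD: "finite D" using D A by (rule finite_subset)
  have n: "n > 0" using A K by (simp add: n_def \<Omega>_def n_subsets)
  then have ne: "\<Omega> \<noteq> {}" by (auto simp: n_def)
  have s: "real (card A) > 0" using K by simp
  have p: "p \<ge> 0" by (simp add: p_def)
  have mp: "m = real (card D) * p" by (simp add: m p_def)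
  have X: "real (card (T \<inter> D)) = (\<Sum>i\<in>D. of_bool (i \<in> T))" for T
    using finD by (simp add: Int_commute of_bool_def sum.If_cases Int_def conj_commute)
  have one: "(\<Sum>T\<in>\<Omega>. of_bool (i \<in> T)) = real n * p" if "i \<in> D" for i
  proof -
    have "(\<Sum>T\<in>\<Omega>. of_bool (i \<in> T)) = real (card {T. T \<subseteq> A \<and> card T = K \<and> i \<in> T})"
      using fin by (simp add: of_bool_def sum.If_cases \<Omega>_def Int_def conj_ac)
    moreover have "card A * card {T. T \<subseteq> A \<and> card T = K \<and> i \<in> T} = K * n"
      unfolding n_def \<Omega>_def using that D by (intro card_subsets_one A K) auto
    then have "real (card A) * real (card {T. T \<subseteq> A \<and> card T = K \<and> i \<in> T}) = real K * real n"
      by (simp only: of_nat_mult[symmetric])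
    ultimately show ?thesis using s by (simp add: p_def field_simps)
  qed
  have two: "(\<Sum>T\<in>\<Omega>. of_bool (i \<in> T) * of_bool (j \<in> T)) \<le> real n * p\<^sup>2" if "i \<in> D" "j \<in> D" "i \<noteq> j" for i j
  proof -
    have "(\<Sum>T\<in>\<Omega>. of_bool (i \<in> T) * of_bool (j \<in> T)) = real (card {T. T \<subseteq> A \<and> card T = K \<and> i \<in> T \<and> j \<in> T})"
    proof -
      have "(\<Sum>T\<in>\<Omega>. of_bool (i \<in> T) * of_bool (j \<in> T)) = (\<Sum>T\<in>\<Omega>. if i \<in> T \<and> j \<in> T then 1 else 0 :: real)"
        by (intro sum.cong) auto
      also have "\<dots> = real (card {T. T \<subseteq> A \<and> card T = K \<and> i \<in> T \<and> j \<in> T})"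
        using fin by (simp add: sum.If_cases \<Omega>_def Int_def conj_ac)
      finally show ?thesis .
    qed
    moreover have "real ((card A)\<^sup>2 * card {T. T \<subseteq> A \<and> card T = K \<and> i \<in> T \<and> j \<in> T}) \<le> real (K\<^sup>2 * n)"
      unfolding of_nat_le_iff n_def \<Omega>_def using that D by (intro card_subsets_two A K) auto
    ultimately show ?thesis using s by (simp add: p_def field_simps)
  qed
  have sum1: "(\<Sum>T\<in>\<Omega>. real (card (T \<inter> D))) = real n * m"
  proof -
    have "(\<Sum>T\<in>\<Omega>. real (card (T \<inter> D))) = (\<Sum>i\<in>D. \<Sum>T\<in>\<Omega>. of_bool (i \<in> T))"
      unfolding X by (rule sum.swap)
    also have "\<dots> = (\<Sum>i\<in>D. real n * p)" by (intro sum.cong refl one)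
    finally show ?thesis by (simp add: mp mult_ac)
  qed
  have sum2: "(\<Sum>T\<in>\<Omega>. (real (card (T \<inter> D)))\<^sup>2) \<le> real n * (m + m\<^sup>2)"
  proof -
    have "(\<Sum>T\<in>\<Omega>. (real (card (T \<inter> D)))\<^sup>2) = (\<Sum>T\<in>\<Omega>. \<Sum>i\<in>D. \<Sum>j\<in>D. of_bool (i \<in> T) * of_bool (j \<in> T))"
      unfolding X power2_eq_square sum_product ..
    also have "\<dots> = (\<Sum>i\<in>D. \<Sum>T\<in>\<Omega>. \<Sum>j\<in>D. of_bool (i \<in> T) * of_bool (j \<in> T))" by (rule sum.swap)
    also have "\<dots> = (\<Sum>i\<in>D. \<Sum>j\<in>D. \<Sum>T\<in>\<Omega>. of_bool (i \<in> T) * of_bool (j \<in> T))"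
      by (intro sum.cong refl sum.swap)
    also have "\<dots> \<le> (\<Sum>i\<in>D. \<Sum>j\<in>D. (if i = j then real n * p else 0) + real n * p\<^sup>2)"
    proof (intro sum_mono)
      fix i j assume ij: "i \<in> D" "j \<in> D"
      show "(\<Sum>T\<in>\<Omega>. of_bool (i \<in> T) * of_bool (j \<in> T)) \<le> (if i = j then real n * p else 0) + real n * p\<^sup>2"
      proof (cases "i = j")
        case True
        have "(\<Sum>T\<in>\<Omega>. of_bool (i \<in> T) * of_bool (i \<in> T)) = (\<Sum>T\<in>\<Omega>. of_bool (i \<in> T) :: real)"
          by (intro sum.cong) auto
        then show ?thesis using one[OF ij(1)] True by simp
      qed (use two ij in simp)
    qed
    also have "\<dots> = real (card D) * (real n * p) + real (card D) * (real (card D) * (real n * p\<^sup>2))"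
      using finD by (simp add: sum.distrib distrib_left)
    finally show ?thesis by (simp add: mp power2_eq_square algebra_simps)
  qed
  \<comment> \<open>Chebyshev by counting: each bad set deviates from the mean by at least
    \<open>m / 2\<close>, and by \<open>sum1\<close> and \<open>sum2\<close> all squared deviations
    add up to at most \<open>n * m\<close>.\<close>
  let ?bad = "\<Omega> \<inter> {T. real (card (T \<inter> D)) < m / 2}"
  have "real (card ?bad) * (m / 2)\<^sup>2 = (\<Sum>T\<in>?bad. (m / 2)\<^sup>2)" by simp
  also have "\<dots> \<le> (\<Sum>T\<in>?bad. (real (card (T \<inter> D)) - m)\<^sup>2)"
  proof (rule sum_mono)
    fix T assume "T \<in> ?bad"
    then have "m / 2 \<le> m - real (card (T \<inter> D))" by auto
    then have "(m / 2)\<^sup>2 \<le> (m - real (card (T \<inter> D)))\<^sup>2" using m by (intro power_mono) auto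
    then show "(m / 2)\<^sup>2 \<le> (real (card (T \<inter> D)) - m)\<^sup>2" by (simp add: power2_commute)
  qed
  also have "\<dots> \<le> (\<Sum>T\<in>\<Omega>. (real (card (T \<inter> D)) - m)\<^sup>2)"
    using fin by (intro sum_mono2) auto
  also have "\<dots> = (\<Sum>T\<in>\<Omega>. (real (card (T \<inter> D)))\<^sup>2) - 2 * m * (\<Sum>T\<in>\<Omega>. real (card (T \<inter> D))) + real n * m\<^sup>2"
    by (simp add: power2_diff sum.distrib sum_subtractf sum_distrib_left n_def mult_ac)
  also have "\<dots> \<le> real n * m" using sum2 sum1 by (simp add: power2_eq_square algebra_simps)
  finally have "real (card ?bad) * (m * m) \<le> (4 * real n) * m" by (simp add: power2_eq_square field_simps)
  then have "real (card ?bad) * m \<le> 4 * real n" using m(2) by (simp add: mult.assoc[symmetric])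
  then have "real (card ?bad) / real n \<le> 4 / m" using n m(2) by (simp add: field_simps)
  then show ?thesis
    unfolding \<Omega>_def[symmetric] using fin ne by (simp add: measure_pmf_of_set n_def)
qed

text \<open>Both branches sample from a nonempty family, as \<open>pmf_of_set\<close> requires; in
  the first branch this rests on \<open>K \<le> N\<close>.\<close>

lemma set_pmf_rounded_set:
  assumes T: "T \<in> set_pmf (rounded_set N K \<delta> x)" and K: "K \<le> N"
  shows "T \<subseteq> {..<N} \<and> card T = K"
proof -
  define S where "S = threshold_set N \<delta> x"
  have S: "S \<subseteq> {..<N}" "finite S" by (auto simp: S_def threshold_set_def)
  show ?thesis
  proof (cases "card S < K")
    case True
    let ?\<Omega> = "{U. U \<subseteq> {..<N} - S \<and> card U = K - card S}"
    have "finite ?\<Omega>" by simp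
    moreover have "card ?\<Omega> > 0"
      using S K by (simp add: n_subsets card_Diff_subset)
    then have "?\<Omega> \<noteq> {}" by force
    ultimately obtain U where U: "T = S \<union> U" "U \<subseteq> {..<N} - S" "card U = K - card S"
      using T True by (auto simp: rounded_set_def Let_def S_def[symmetric])
    then have "finite U" using finite_subset[of U "{..<N} - S"] by auto
    moreover have "S \<inter> U = {}" using U(2) by auto
    ultimately have "card T = card S + card U" unfolding U(1) by (rule card_Un_disjoint[OF S(2)])
    then show ?thesis using U S True by auto
  next
    case False
    let ?\<Omega> = "{U. U \<subseteq> S \<and> card U = K}"
    have "finite ?\<Omega>" using S by simp
    moreover have "card ?\<Omega> > 0" using S False by (simp add: n_subsets)
    then have "?\<Omega> \<noteq> {}" by force
    ultimately show ?thesis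
      using T False S by (auto simp: rounded_set_def Let_def S_def[symmetric])
  qed
qed

text \<open>Coordinates of \<open>S\<close> below the threshold \<open>c / 2\<close> carry at most
  half of the correlation, so those in \<open>D\<close> carry at least c K / 2, and Cauchy-Schwarz
  gives at least c^2 K / 4 elements of \<open>D\<close>. The norm bounds the size of the threshold
  set by 4 K / c^2. A uniform K-subset of it then meets \<open>D\<close> in at least m = c^4 K / 16
  points on average; 32 comes from half of this mean and 64 from 4 / m.\<close>

lemma rounded_set_overlap:
  fixes x :: "real vec"
  assumes S: "S \<subseteq> {..<N}" and cS: "card S = K" and K: "0 < K"
    and norm: "(\<Sum>i<N. (vec_index x i)\<^sup>2) = real K"
    and c: "0 < c" "c \<le> 1" and corr: "(\<Sum>i\<in>S. vec_index x i) \<ge> c * real K"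
  shows "measure_pmf.prob (rounded_set N K c x) {T. real (card (T \<inter> S)) < c ^ 4 / 32 * real K} \<le> 64 / (c ^ 4 * real K)"
proof -
  define A where "A = threshold_set N c x"
  define D where "D = A \<inter> S"
  have A: "A \<subseteq> {..<N}" "finite A" by (auto simp: A_def threshold_set_def)
  have finS: "finite S" using S by (rule finite_subset) simp
  have D: "D \<subseteq> A" "finite D" using A by (auto simp: D_def)
  have "(\<Sum>i\<in>D. vec_index x i)\<^sup>2 \<le> (\<Sum>i\<in>D. 1\<^sup>2) * (\<Sum>i\<in>D. (vec_index x i)\<^sup>2)"
    using Cauchy_Schwarz_ineq_sum[of "\<lambda>_. 1" "vec_index x" D] by simp
  also have "\<dots> \<le> real (card D) * real K"
  proof -
    have "(\<Sum>i\<in>D. (vec_index x i)\<^sup>2) \<le> (\<Sum>i<N. (vec_index x i)\<^sup>2)"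
      using A D by (intro sum_mono2) auto
    then show ?thesis using norm by (simp add: mult_left_mono)
  qed
  finally have cs: "(\<Sum>i\<in>D. vec_index x i)\<^sup>2 \<le> real (card D) * real K" .
  have "(\<Sum>i\<in>S - D. vec_index x i) \<le> (\<Sum>i\<in>S - D. c / 2)"
    using S by (intro sum_mono) (auto simp: D_def A_def threshold_set_def)
  also have "\<dots> \<le> real K * (c / 2)"
    using c cS card_mono[OF finS, of "S - D"] by (simp add: mult_right_mono)
  finally have "(\<Sum>i\<in>S - D. vec_index x i) \<le> c * real K / 2" by (simp add: mult.commute)
  moreover have "(\<Sum>i\<in>S. vec_index x i) = (\<Sum>i\<in>S - D. vec_index x i) + (\<Sum>i\<in>D. vec_index x i)"
    using finS by (intro sum.subset_diff) (auto simp: D_def)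
  ultimately have "c * real K / 2 \<le> (\<Sum>i\<in>D. vec_index x i)" using corr by linarith
  then have "(c * real K / 2)\<^sup>2 \<le> (\<Sum>i\<in>D. vec_index x i)\<^sup>2" using c by (intro power_mono) auto
  with cs have "(c\<^sup>2 / 4 * real K) * real K \<le> real (card D) * real K"
    by (simp add: power2_eq_square field_simps)
  then have cD: "c\<^sup>2 / 4 * real K \<le> real (card D)" using K by simp
  have "real (card A) * (c / 2)\<^sup>2 = (\<Sum>i\<in>A. (c / 2)\<^sup>2)" by simp
  also have "\<dots> \<le> (\<Sum>i\<in>A. (vec_index x i)\<^sup>2)"
    using c by (intro sum_mono power_mono) (auto simp: A_def threshold_set_def)
  also have "\<dots> \<le> (\<Sum>i<N. (vec_index x i)\<^sup>2)" using A by (intro sum_mono2) auto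
  finally have cA: "real (card A) * c\<^sup>2 \<le> 4 * real K" using norm by (simp add: power2_eq_square field_simps)
  define e where "e = c\<^sup>2"
  have cp: "0 < e" "e \<le> 1" using c by (auto simp: e_def power_le_one)
  have c4: "c ^ 4 = e * e" by (simp add: e_def power2_eq_square power4_eq_xxxx)
  note cD = cD[folded e_def] and cA = cA[folded e_def]
  have rhs: "0 \<le> 64 / (c ^ 4 * real K)" using c by simp
  show ?thesis
  proof (cases "card A < K")
    case True
    let ?\<Omega> = "{T. T \<subseteq> {..<N} - A \<and> card T = K - card A}"
    have eq: "rounded_set N K c x = map_pmf (\<lambda>T. A \<union> T) (pmf_of_set ?\<Omega>)"
      using True by (simp add: rounded_set_def Let_def A_def[symmetric])
    have "finite ?\<Omega>" by simp
    \<comment> \<open>A threshold set that is too small is kept entirely, and \<open>D\<close> alone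
      exceeds the required overlap, so failure is impossible.\<close>
    have "measure_pmf.prob (rounded_set N K c x) {T. real (card (T \<inter> S)) < c ^ 4 / 32 * real K} = 0"
    proof (subst measure_pmf_zero_iff, rule ccontr)
      assume "set_pmf (rounded_set N K c x) \<inter> {T. real (card (T \<inter> S)) < c ^ 4 / 32 * real K} \<noteq> {}"
      then obtain U where U: "real (card ((A \<union> U) \<inter> S)) < c ^ 4 / 32 * real K"
        unfolding eq by auto
      have "card D \<le> card ((A \<union> U) \<inter> S)" using finS by (intro card_mono) (auto simp: D_def)
      with U cD have "e / 4 * real K < c ^ 4 / 32 * real K" by linarith
      then have "e / 4 < e * e / 32"
        unfolding c4 by (rule mult_right_less_imp_less) simp
      moreover have "e * e \<le> e * 1" using cp by (intro mult_left_mono) auto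
      ultimately show False using cp by simp
    qed
    then show ?thesis using rhs by simp
  next
    case False
    have eq: "rounded_set N K c x = pmf_of_set {T. T \<subseteq> A \<and> card T = K}"
      using False by (simp add: rounded_set_def Let_def A_def[symmetric])
    define m where "m = real K * real (card D) / real (card A)"
    have pA: "real (card A) > 0" using False K by simp
    have "c ^ 4 / 16 * real K * real (card A) = e / 16 * real K * (real (card A) * e)"
      by (simp add: c4)
    also have "\<dots> \<le> e / 16 * real K * (4 * real K)"
      using cA cp by (intro mult_left_mono) auto
    also have "\<dots> = real K * (e / 4 * real K)" by simp
    also have "\<dots> \<le> real K * real (card D)" using cD by (intro mult_left_mono) auto
    finally have mge: "c ^ 4 / 16 * real K \<le> m" using pA by (simp add: m_def pos_le_divide_eq)
    have mpos: "0 < c ^ 4 / 16 * real K" using c K by simp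
    have "measure_pmf.prob (rounded_set N K c x) {T. real (card (T \<inter> S)) < c ^ 4 / 32 * real K}
       \<le> measure_pmf.prob (rounded_set N K c x) ({T. real (card (T \<inter> D)) < m / 2})"
    proof (rule measure_pmf.finite_measure_mono)
      show "{T. real (card (T \<inter> S)) < c ^ 4 / 32 * real K} \<subseteq> {T. real (card (T \<inter> D)) < m / 2}"
      proof safe
        fix T assume "real (card (T \<inter> S)) < c ^ 4 / 32 * real K"
        moreover have "card (T \<inter> D) \<le> card (T \<inter> S)" using finS by (intro card_mono) (auto simp: D_def)
        ultimately show "real (card (T \<inter> D)) < m / 2" using mge by simp
      qed
    qed simp
    also have "\<dots> \<le> 4 / m"
      unfolding eq using mpos mge False by (intro hypergeometric_lower_tail[OF A(2) D(1) K _ m_def]) auto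
    also have "\<dots> \<le> 4 / (c ^ 4 / 16 * real K)" using mge mpos by (intro divide_left_mono) auto
    finally show ?thesis by simp
  qed
qed

section \<open>Correlation of the top eigenvector with the spike\<close>

lemma binary_vecsD:
  assumes "v \<in> binary_vecs N K"
  shows "dim_vec v = N" "\<And>i. i < N \<Longrightarrow> vec_index v i = 0 \<or> vec_index v i = 1"
    "(\<Sum>i<N. vec_index v i) = real K"
  using assms by (auto simp: binary_vecs_def)

lemma sum_support:
  fixes N :: nat
  assumes "\<And>i. i < N \<Longrightarrow> a i = 0 \<or> a i = (1 :: real)"
  shows "(\<Sum>i<N. a i * y i) = (\<Sum>i\<in>{i. i < N \<and> a i = 1}. y i)"
proof -
  have "(\<Sum>i<N. a i * y i) = (\<Sum>i\<in>{..<N}. if a i = 1 then y i else 0)"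
  proof (intro sum.cong refl)
    fix i assume "i \<in> {..<N}"
    with assms[of i] show "a i * y i = (if a i = 1 then y i else 0)" by auto
  qed
  also have "\<dots> = (\<Sum>i\<in>{i \<in> {..<N}. a i = 1}. y i)"
    by (rule sum.inter_filter[symmetric]) simp
  finally show ?thesis by simp
qed

definition spike :: "nat \<Rightarrow> real vec \<Rightarrow> nat \<Rightarrow> real" where
  "spike K v i = vec_index v i / sqrt (real K)"

text \<open>\<open>sqrt K * spike + sqrt (N - K) * cospike\<close> is the all-ones vector, which
  turns the sign condition on the coordinate sum into a relation between two overlaps.\<close>

definition cospike :: "nat \<Rightarrow> nat \<Rightarrow> real vec \<Rightarrow> nat \<Rightarrow> real" where
  "cospike N K v i = (1 - vec_index v i) / sqrt (real N - real K)"

lemma spike_cospike_orthonormal: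
  assumes v: "v \<in> binary_vecs N K" and K: "0 < K" "K < N"
  shows "inner_n N (spike K v) (spike K v) = 1" "inner_n N (cospike N K v) (cospike N K v) = 1"
    "inner_n N (spike K v) (cospike N K v) = 0"
proof -
  note v = binary_vecsD[OF v]
  have "inner_n N (spike K v) (spike K v) = (\<Sum>i<N. vec_index v i / real K)"
    unfolding inner_n_def
  proof (intro sum.cong refl)
    fix i assume "i \<in> {..<N}"
    with v(2)[of i] show "spike K v i * spike K v i = vec_index v i / real K"
      by (auto simp: spike_def)
  qed
  then show "inner_n N (spike K v) (spike K v) = 1"
    using K v(3) by (simp add: sum_divide_distrib[symmetric])
  have "inner_n N (cospike N K v) (cospike N K v) = (\<Sum>i<N. (1 - vec_index v i) / (real N - real K))"
    unfolding inner_n_def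
  proof (intro sum.cong refl)
    fix i assume "i \<in> {..<N}"
    with v(2)[of i] K show "cospike N K v i * cospike N K v i = (1 - vec_index v i) / (real N - real K)"
      by (auto simp: cospike_def)
  qed
  then show "inner_n N (cospike N K v) (cospike N K v) = 1"
    using K v(3) by (simp add: sum_divide_distrib[symmetric] sum_subtractf)
  show "inner_n N (spike K v) (cospike N K v) = 0"
    unfolding inner_n_def
  proof (intro sum.neutral ballI)
    fix i assume "i \<in> {..<N}"
    with v(2)[of i] show "spike K v i * cospike N K v i = 0" by (auto simp: spike_def cospike_def)
  qed
qed

text \<open>If a = (u, y) were negative, the nonnegative coordinate sum would give sqrt K a^2 \<le>
  sqrt (N - K) |a b| with b = (f, y), contradicting a^2 \<ge> \<kappa> and |a b| < \<omega> \<le>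
  sqrt (K / N) \<kappa>. The product suffices; b itself is never bounded.\<close>

lemma principal_eigenvector_correlation:
  fixes \<theta> \<kappa> \<omega> t \<xi> \<Theta> :: real
  assumes v: "v \<in> binary_vecs N K" and K: "0 < K" "K < N"
    and pe: "principal_eigenvector K (observation N lam v w) x"
    and \<theta>_eq: "\<theta> = lam * real K / real N" and \<theta>: "1 \<le> \<theta>" "\<theta> \<le> \<Theta>"
    and U: "quadratic_upper \<xi> (1 + \<xi>) N w (spike K v)" and L: "geometric_test \<xi> (1 - \<xi>) M N w (spike K v)"
    and Up: "quadratic_upper \<xi> (1 + \<xi>) N w (tilted \<theta> t (spike K v) (cospike N K v))"
    and Um: "quadratic_upper \<xi> (1 + \<xi>) N w (tilted \<theta> (- t) (spike K v) (cospike N K v))"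
    and \<xi>: "0 < \<xi>" "\<xi> < 1" "(1 / \<theta>) ^ (2 * M) \<le> \<xi>" "8 * \<xi> \<le> \<kappa>" "\<xi> * (8 + \<Theta>) \<le> t * \<omega>"
    and \<kappa>: "0 < \<kappa>" "2 * \<kappa> \<le> (1 - 1 / \<theta>)\<^sup>2"
    and t: "0 < t" "t \<le> 1" "2 * t \<le> \<omega>" and \<omega>: "\<omega> \<le> sqrt (real K / real N) * \<kappa>"
  shows "sqrt \<kappa> * real K \<le> (\<Sum>i\<in>{i. i < N \<and> vec_index v i = 1}. vec_index x i)"
    and "(\<Sum>i<N. (vec_index x i)\<^sup>2) = real K"
proof -
  note vD = binary_vecsD[OF v]
  define u where "u = spike K v"
  define f where "f = cospike N K v"
  define y where "y i = 1 / sqrt (real K) * vec_index x i" for i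
  define a b where "a = inner_n N u y" and "b = inner_n N f y"
  have Kp: "real K > 0" "real N - real K > 0" using K by auto
  let ?w = "\<lambda>(i, j)\<in>upper_triangle N. lam / real N * (vec_index v i * vec_index v j) + w (i, j)"
  obtain \<mu> where "dim_vec x = N" and x: "inner_n N (\<lambda>i. vec_index x i) (\<lambda>i. vec_index x i) = real K"
    "0 \<le> (\<Sum>i<N. vec_index x i)" "sym_form N ?w (\<lambda>i. vec_index x i) = \<mu> * real K"
    and max: "\<And>z. sym_form N ?w z \<le> \<mu> * inner_n N z z"
    by (rule principal_eigenvector_sym_mat[OF pe[unfolded observation_eq_sym_mat[OF vD(1)]]]) (rule that)
  show norm: "(\<Sum>i<N. (vec_index x i)\<^sup>2) = real K"
    using x(1) by (simp add: inner_n_def power2_eq_square)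
  have vu: "inner_n N (\<lambda>i. vec_index v i) z = sqrt (real K) * inner_n N u z" for z
  proof -
    have "inner_n N (\<lambda>i. vec_index v i) z = inner_n N (\<lambda>i. sqrt (real K) * u i) z"
      using Kp by (intro inner_n_cong) (auto simp: u_def spike_def)
    then show ?thesis by (simp add: inner_n_linear)
  qed
  have form: "sym_form N ?w z = sym_form N w z + \<theta> * (inner_n N u z)\<^sup>2" for z
    using Kp by (simp only: sym_form_observation[of N "lam / real N" "\<lambda>i. vec_index v i" w z] vu)
      (simp add: \<theta>_eq power_mult_distrib)
  have max': "sym_form N w z + \<theta> * (inner_n N u z)\<^sup>2 \<le> \<mu> * inner_n N z z" for z
    using max[of z] unfolding form .
  have yy: "inner_n N y y = 1"
    unfolding y_def using x(1) Kp by (simp only: inner_n_linear) simp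
  have eq: "sym_form N w y + \<theta> * (inner_n N u y)\<^sup>2 = \<mu>"
    unfolding form[symmetric] y_def using x(3) Kp by (simp only: sym_form_scale) (simp add: power_divide)
  have "\<theta> + 1 / \<theta> - \<xi> - 2 * (1 - (1 - \<xi>)) - 2 * (1 / \<theta>) ^ (2 * M) \<le> \<mu>"
    using \<xi> \<theta> by (intro top_eigenvalue_lower_bound[OF L max'[unfolded u_def]]) auto
  \<comment> \<open>The errors of \<open>top_eigenvalue_lower_bound\<close> are
    \<open>\<xi>\<close>, \<open>2 * \<xi>\<close> and \<open>2 * \<xi>\<close>. The overlap bound
    adds \<open>\<xi>\<close> and \<open>2 * \<xi>\<close>, which explains
    \<open>8 * \<xi> \<le> \<kappa>\<close>.\<close>
  then have \<mu>: "\<theta> + 1 / \<theta> - 5 * \<xi> \<le> \<mu>" using \<xi>(3) by simp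
  have "(1 - 1 / \<theta>)\<^sup>2 - 5 * \<xi> - \<xi> - 2 * (1 + \<xi> - 1) \<le> a\<^sup>2"
    unfolding a_def using \<xi> \<theta> U \<mu> eq yy by (intro overlap_lower_bound) (auto simp: u_def)
  then have a2: "\<kappa> \<le> a\<^sup>2" using \<xi>(4) \<kappa>(2) by simp
  \<comment> \<open>Used for both \<open>t\<close> and \<open>- t\<close>. Division by
    \<open>t\<close> leaves \<open>\<omega> + t\<close>, which is below
    \<open>2 * \<omega>\<close>.\<close>
  have st: "2 * s * (a * b) \<le> t * \<omega> + t\<^sup>2" if s: "s\<^sup>2 = t\<^sup>2" and Us: "quadratic_upper \<xi> (1 + \<xi>) N w (tilted \<theta> s u f)" for s
  proof -
    have "2 * s * (a * b) \<le> \<xi> + (1 + \<xi> - 1) * (\<theta> + s\<^sup>2 + 1) + s\<^sup>2 + 5 * \<xi>"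
      unfolding a_def b_def using \<xi> \<theta> Us \<mu> eq yy by (intro overlap_product_bound) auto
    also have "\<dots> = \<xi> * (7 + \<theta> + t\<^sup>2) + t\<^sup>2" by (simp add: s algebra_simps)
    also have "\<dots> \<le> \<xi> * (8 + \<Theta>) + t\<^sup>2"
    proof -
      have "t\<^sup>2 \<le> 1" using t by (simp add: power_le_one)
      then show ?thesis using \<theta> \<xi> by (intro add_right_mono mult_left_mono) auto
    qed
    finally show ?thesis using \<xi>(5) by linarith
  qed
  have "t * (2 * (a * b)) \<le> t * (\<omega> + t)" "t * (- 2 * (a * b)) \<le> t * (\<omega> + t)"
    using st[of t] st[of "- t"] Up Um by (auto simp: u_def f_def power2_eq_square algebra_simps)
  then have "2 * (a * b) \<le> \<omega> + t" "- 2 * (a * b) \<le> \<omega> + t"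
    using t(1) by (simp_all only: mult_le_cancel_left_pos)
  moreover have "t < \<omega>" using t by linarith
  ultimately have ab: "\<bar>a * b\<bar> < \<omega>" by (auto simp: abs_less_iff)
  have sum_y: "(\<Sum>i<N. y i) = sqrt (real K) * a + sqrt (real N - real K) * b"
  proof -
    have "sqrt (real K) * a + sqrt (real N - real K) * b =
        inner_n N (\<lambda>i. sqrt (real K) * u i + sqrt (real N - real K) * f i) y"
      by (simp add: a_def b_def inner_n_linear)
    also have "\<dots> = inner_n N (\<lambda>i. 1) y"
      using Kp by (intro inner_n_cong) (auto simp: u_def f_def spike_def cospike_def)
    finally show ?thesis by (simp add: inner_n_def)
  qed
  have "(\<Sum>i<N. y i) = 1 / sqrt (real K) * (\<Sum>i<N. vec_index x i)"
    by (simp add: y_def sum_distrib_left)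
  then have pos: "0 \<le> sqrt (real K) * a + sqrt (real N - real K) * b"
    using x(2) Kp by (simp add: sum_y[symmetric])
  have "0 \<le> a"
  proof (rule ccontr)
    assume "\<not> 0 \<le> a"
    then have a: "- a > 0" by simp
    have "sqrt (real K) * (- a) \<le> sqrt (real N - real K) * b" using pos by simp
    then have "sqrt (real K) * (- a) * (- a) \<le> sqrt (real N - real K) * b * (- a)"
      using a by (intro mult_right_mono) auto
    then have "sqrt (real K) * a\<^sup>2 \<le> sqrt (real N - real K) * - (a * b)"
      by (simp add: power2_eq_square mult_ac)
    also have "\<dots> \<le> sqrt (real N - real K) * \<bar>a * b\<bar>"
      using Kp by (intro mult_left_mono) auto
    also have "\<dots> \<le> sqrt (real N) * \<bar>a * b\<bar>"
      by (intro mult_right_mono) auto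
    finally have "sqrt (real K) * \<kappa> \<le> sqrt (real N) * \<bar>a * b\<bar>"
      using mult_left_mono[OF a2, of "sqrt (real K)"] by simp
    moreover have "sqrt (real N) * \<bar>a * b\<bar> < sqrt (real N) * \<omega>" using ab K by simp
    moreover have "sqrt (real N) * \<omega> \<le> sqrt (real N) * (sqrt (real K / real N) * \<kappa>)"
      using \<omega> by (intro mult_left_mono) auto
    moreover have "sqrt (real N) * (sqrt (real K / real N) * \<kappa>) = sqrt (real K) * \<kappa>"
      using K by (simp add: real_sqrt_divide)
    ultimately show False by linarith
  qed
  then have "sqrt \<kappa> \<le> a" using a2 real_le_lsqrt[of a \<kappa>] by (simp add: real_le_lsqrt)
  then have "sqrt \<kappa> * real K \<le> a * real K" by (intro mult_right_mono) auto
  also have "a * real K = inner_n N (\<lambda>i. vec_index v i) (\<lambda>i. vec_index x i)"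
  proof -
    have "a = 1 / sqrt (real K) * inner_n N u (\<lambda>i. vec_index x i)"
      unfolding a_def y_def by (simp only: inner_n_linear)
    then have h: "a * sqrt (real K) = inner_n N u (\<lambda>i. vec_index x i)" using Kp by simp
    have "a * real K = sqrt (real K) * (a * sqrt (real K))" by simp
    then show ?thesis by (simp only: h vu)
  qed
  also have "\<dots> = (\<Sum>i\<in>{i. i < N \<and> vec_index v i = 1}. vec_index x i)"
    unfolding inner_n_def using vD(2) by (rule sum_support)
  finally show "sqrt \<kappa> * real K \<le> (\<Sum>i\<in>{i. i < N \<and> vec_index v i = 1}. vec_index x i)" .
qed

section \<open>Law of the output\<close>

text \<open>The threshold set takes finitely many values, so finitely many coordinate conditions
  decide measurability. The observation is rewritten as \<open>sym_mat N (sh w)\<close> because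
  \<open>eigenvector_selection\<close> speaks of matrices in this form.\<close>

lemma measurable_threshold_set:
  assumes sel: "eigenvector_selection N K x" and v: "dim_vec v = N"
  shows "(\<lambda>w. threshold_set N \<delta> (x (observation N lam v w))) \<in> measurable (noise_law N) (count_space (Pow {..<N}))"
proof -
  define sh where "sh w = (\<lambda>(i, j)\<in>upper_triangle N. lam / real N * (vec_index v i * vec_index v j) + w (i, j))"
    for w :: "nat \<times> nat \<Rightarrow> real"
  have sh: "sh \<in> measurable (noise_law N) (Pi\<^sub>M (upper_triangle N) (\<lambda>_. borel))"
  proof (rule measurable_PiM_borel)
    fix p assume p: "p \<in> upper_triangle N"
    obtain i j where ij: "p = (i, j)" by (cases p)
    have "(\<lambda>w. w p) \<in> measurable (noise_law N) (entry_law N p)"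
      unfolding noise_law_eq using p by (rule measurable_component_singleton)
    then have "(\<lambda>w. w p) \<in> borel_measurable (noise_law N)" by (simp cong: measurable_cong_sets)
    then have "(\<lambda>w. lam / real N * (vec_index v i * vec_index v j) + w p) \<in> borel_measurable (noise_law N)"
      by (intro borel_measurable_add borel_measurable_const)
    then show "(\<lambda>w. sh w p) \<in> borel_measurable (noise_law N)"
      using p by (simp add: sh_def ij)
  qed (simp add: sh_def)
  have xi: "(\<lambda>w. vec_index (x (sym_mat N w)) i) \<in> borel_measurable (Pi\<^sub>M (upper_triangle N) (\<lambda>_. borel))" if "i < N" for i
    using sel that by (simp add: eigenvector_selection_def)
  have comp: "(\<lambda>w. vec_index (x (sym_mat N (sh w))) i) \<in> borel_measurable (noise_law N)" if "i < N" for i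
    using measurable_compose[OF sh xi[OF that]] .
  have obs: "observation N lam v w = sym_mat N (sh w)" for w
    unfolding sh_def by (rule observation_eq_sym_mat[OF v])
  show ?thesis
  proof (rule measurable_count_space_eq2[THEN iffD2], goal_cases)
    case 1 then show ?case by simp
  next
    case 2
    have "(\<lambda>w. threshold_set N \<delta> (x (observation N lam v w))) -` {A} \<inter> space (noise_law N) \<in> sets (noise_law N)"
      if A: "A \<in> Pow {..<N}" for A
    proof -
      have "(\<lambda>w. threshold_set N \<delta> (x (observation N lam v w))) -` {A} \<inter> space (noise_law N) =
        {w \<in> space (noise_law N). \<forall>i\<in>{..<N}. (\<delta> / 2 \<le> vec_index (x (sym_mat N (sh w))) i) = (i \<in> A)}"
        using A by (auto simp: threshold_set_def obs)
      also have "\<dots> \<in> sets (noise_law N)"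
      proof (rule sets.sets_Collect_finite_All)
        fix i assume "i \<in> {..<N}"
        then have [measurable]: "(\<lambda>w. vec_index (x (sym_mat N (sh w))) i) \<in> borel_measurable (noise_law N)"
          by (intro comp) simp
        show "{w \<in> space (noise_law N). (\<delta> / 2 \<le> vec_index (x (sym_mat N (sh w))) i) = (i \<in> A)} \<in> sets (noise_law N)"
          by measurable
      qed simp
      finally show ?thesis .
    qed
    then show ?case by (auto simp: threshold_set_def)
  qed
qed

text \<open>All dependence on the noise passes through the threshold set, a variable in a finite
  discrete space on which every kernel is measurable. The output vectors can therefore carry the
  discrete sigma-algebra.\<close>

lemma measurable_rounding_kernel:
  assumes sel: "eigenvector_selection N K x" and v: "dim_vec v = N"
  shows "(\<lambda>w. measure_pmf (map_pmf (indicator_vec N) (rounded_set N K \<delta> (x (observation N lam v w)))))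
    \<in> measurable (noise_law N) (subprob_algebra (count_space UNIV))"
proof -
  define g where "g S = measure_pmf (map_pmf (indicator_vec N) (if card S < K
     then map_pmf (\<lambda>T. S \<union> T) (pmf_of_set {T. T \<subseteq> {..<N} - S \<and> card T = K - card S})
     else pmf_of_set {T. T \<subseteq> S \<and> card T = K}))" for S
  have "g \<in> measurable (count_space (Pow {..<N})) (subprob_algebra (count_space UNIV))"
    by (auto simp: g_def measure_pmf_in_subprob_algebra)
  with measurable_threshold_set[OF assms]
  have "(\<lambda>w. g (threshold_set N \<delta> (x (observation N lam v w)))) \<in> measurable (noise_law N) (subprob_algebra (count_space UNIV))"
    by (rule measurable_compose)
  then show ?thesis by (simp add: g_def rounded_set_def Let_def)
qed

lemma prob_space_noise_law: "0 < N \<Longrightarrow> prob_space (noise_law N)"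
  unfolding noise_law_eq by (rule prob_space_PiM_entry_law)

lemma scalar_prod_indicator_vec:
  assumes v: "v \<in> binary_vecs N K"
  shows "scalar_prod v (indicator_vec N T) = real (card (T \<inter> {i. i < N \<and> vec_index v i = 1}))"
proof -
  note v = binary_vecsD[OF v]
  have "scalar_prod v (indicator_vec N T) = (\<Sum>i<N. vec_index v i * (if i \<in> T then 1 else 0))"
    by (simp add: scalar_prod_def indicator_vec_def lessThan_atLeast0)
  also have "\<dots> = (\<Sum>i\<in>{i. i < N \<and> vec_index v i = 1}. if i \<in> T then 1 else 0)"
    using v(2) by (rule sum_support)
  also have "\<dots> = real (card ({i. i < N \<and> vec_index v i = 1} \<inter> T))"
    by (simp add: sum.If_cases)
  finally show ?thesis by (simp add: Int_commute)
qed

lemma indicator_vec_in_binary_vecs: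
  assumes "T \<subseteq> {..<N}" "card T = K"
  shows "indicator_vec N T \<in> binary_vecs N K"
proof -
  have "(\<Sum>i<N. vec_index (indicator_vec N T) i) = (\<Sum>i<N. if i \<in> T then 1 else 0)"
    by (intro sum.cong) (auto simp: indicator_vec_def)
  also have "\<dots> = real (card ({..<N} \<inter> T))" by (simp add: sum.If_cases)
  also have "{..<N} \<inter> T = T" using assms by auto
  finally show ?thesis using assms by (auto simp: binary_vecs_def indicator_vec_def)
qed

lemma AE_spectral_rounding:
  assumes sel: "eigenvector_selection N K x" and v: "dim_vec v = N" and K: "K \<le> N"
  shows "AE u in spectral_rounding N K \<delta> lam v x. u \<in> binary_vecs N K"
  unfolding spectral_rounding_def
  by (subst AE_bind[OF measurable_rounding_kernel[OF sel v]])
    (auto simp: AE_measure_pmf_iff intro!: AE_I2 indicator_vec_in_binary_vecs dest!: set_pmf_rounded_set[OF _ K])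

lemma sets_spectral_rounding:
  assumes sel: "eigenvector_selection N K x" and v: "dim_vec v = N" and N: "0 < N"
  shows "sets (spectral_rounding N K \<delta> lam v x) = UNIV" "prob_space (spectral_rounding N K \<delta> lam v x)"
proof -
  interpret prob_space "noise_law N" by (rule prob_space_noise_law[OF N])
  show "sets (spectral_rounding N K \<delta> lam v x) = UNIV"
    unfolding spectral_rounding_def
    by (subst sets_bind[where N = "count_space UNIV"]) (auto simp: not_empty)
  show "prob_space (spectral_rounding N K \<delta> lam v x)"
    unfolding spectral_rounding_def
    by (rule prob_space_bind[OF _ measurable_rounding_kernel[OF sel v]]) (auto intro!: AE_I2 prob_space_measure_pmf)
qed

text \<open>Conditionally on the noise, only outcomes in \<open>B\<close> are credited, each with at
  least \<open>1 - a\<close>.\<close>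

lemma measure_spectral_rounding_ge:
  assumes sel: "eigenvector_selection N K x" and v: "dim_vec v = N" and N: "0 < N"
    and B: "B \<in> sets (noise_law N)" "measure (noise_law N) B \<ge> 1 - \<eta>" and a: "0 \<le> a" "a \<le> 1"
    and P: "\<And>w. w \<in> B \<Longrightarrow> measure_pmf.prob (rounded_set N K \<delta> (x (observation N lam v w))) {T. \<not> P (indicator_vec N T)} \<le> a"
  shows "measure (spectral_rounding N K \<delta> lam v x) {u \<in> space (spectral_rounding N K \<delta> lam v x). P u} \<ge> 1 - a - \<eta>"
proof -
  interpret W: prob_space "noise_law N" by (rule prob_space_noise_law[OF N])
  interpret Q: prob_space "spectral_rounding N K \<delta> lam v x" by (rule sets_spectral_rounding[OF sel v N])
  let ?k = "\<lambda>w. measure_pmf (map_pmf (indicator_vec N) (rounded_set N K \<delta> (x (observation N lam v w))))"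
  have sp: "space (spectral_rounding N K \<delta> lam v x) = UNIV"
    using sets_spectral_rounding(1)[OF sel v N, of \<delta> lam] sets.sets_into_space by blast
  have "ennreal ((1 - a) * W.prob B) = (\<integral>\<^sup>+w. ennreal (1 - a) * indicator B w \<partial>noise_law N)"
    using B a by (simp add: nn_integral_cmult_indicator W.emeasure_eq_measure ennreal_mult)
  also have "\<dots> \<le> (\<integral>\<^sup>+w. emeasure (?k w) {u. P u} \<partial>noise_law N)"
  proof (rule nn_integral_mono)
    fix w
    let ?R = "rounded_set N K \<delta> (x (observation N lam v w))"
    show "ennreal (1 - a) * indicator B w \<le> emeasure (?k w) {u. P u}"
    proof (cases "w \<in> B")
      case True
      have "measure_pmf.prob ?R {T. \<not> P (indicator_vec N T)} = 1 - measure_pmf.prob ?R {T. P (indicator_vec N T)}"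
        using measure_pmf.prob_compl[of "{T. P (indicator_vec N T)}" ?R] by (simp add: Compl_eq[symmetric] Collect_neg_eq Compl_eq_Diff_UNIV)
      with P[OF True] have "1 - a \<le> measure_pmf.prob ?R {T. P (indicator_vec N T)}" by simp
      also have "\<dots> = measure (?k w) {u. P u}" by (simp add: vimage_def)
      finally show ?thesis using True by (simp add: measure_pmf.emeasure_eq_measure ennreal_leI)
    qed simp
  qed
  also have "\<dots> = emeasure (spectral_rounding N K \<delta> lam v x) {u. P u}"
    unfolding spectral_rounding_def
    by (rule emeasure_bind[symmetric, OF W.not_empty measurable_rounding_kernel[OF sel v]]) simp
  finally have "(1 - a) * W.prob B \<le> Q.prob {u. P u}"
    by (simp add: Q.emeasure_eq_measure)
  moreover have "a * W.prob B \<le> a" using a W.prob_le_1[of B] by (simp add: mult_left_le)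
  ultimately show ?thesis using B(2) by (simp add: sp algebra_simps)
qed

section \<open>Choice of constants and passage to the limit\<close>

theorem lemma1p6:
  fixes \<epsilon> :: real
  assumes "\<epsilon> > 0"
  shows "\<exists>\<delta>>0. \<exists>c>0.
    \<forall>(\<rho>::real) (lam::real) (\<rho>N :: nat \<Rightarrow> real) (K :: nat \<Rightarrow> nat) (v :: nat \<Rightarrow> real vec)
      (x :: nat \<Rightarrow> real mat \<Rightarrow> real vec).
      0 < \<rho> \<longrightarrow> \<rho> < 1 \<longrightarrow> lam > (1 + \<epsilon>) * (1 / \<rho>) \<longrightarrow>
      sparsity_sequence \<rho> \<rho>N K \<longrightarrow>
      (\<forall>N. v N \<in> binary_vecs N (K N)) \<longrightarrow>
      (\<forall>N. K N > 0 \<longrightarrow> eigenvector_selection N (K N) (x N)) \<longrightarrow>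
      recovers_approximately c \<rho> K v (\<lambda>N. spectral_rounding N (K N) \<delta> lam (v N) (x N))"
proof -
  \<comment> \<open>For large N, \<theta> > 1 + \<epsilon> and hence (1 - 1/\<theta>)^2 \<ge>
    (\<epsilon> / (1 + \<epsilon>))^2; half of this is given up to the errors. Only \<epsilon> may
    enter, as \<delta> and c are chosen before \<rho>.\<close>
  define \<kappa> where "\<kappa> = (\<epsilon> / (1 + \<epsilon>))\<^sup>2 / 2"
  \<comment> \<open>The guaranteed mean of the eigenvector over the support, which
    \<open>rounded_set_overlap\<close> takes as its threshold parameter.\<close>
  define \<delta> where "\<delta> = sqrt \<kappa>"
  \<comment> \<open>The overlap is at least \<delta>^4 K / 32 and K > \<rho> N / 2, which leaves a
    factor 2 to spare.\<close>
  define c where "c = \<delta> ^ 4 / 128"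
  have "0 < \<epsilon> / (1 + \<epsilon>)" "\<epsilon> / (1 + \<epsilon>) \<le> 1" using assms by auto
  then have \<kappa>: "0 < \<kappa>" "\<kappa> \<le> 1" by (auto simp: \<kappa>_def power_le_one intro: order.trans[of _ 1])
  have \<delta>: "0 < \<delta>" "\<delta> \<le> 1" using \<kappa> by (auto simp: \<delta>_def)
  have c: "0 < c" using \<delta> by (simp add: c_def)
  have "recovers_approximately c \<rho> K v (\<lambda>N. spectral_rounding N (K N) \<delta> lam (v N) (x N))"
    if \<rho>: "0 < \<rho>" "\<rho> < 1" and lam: "lam > (1 + \<epsilon>) * (1 / \<rho>)" and sparse: "sparsity_sequence \<rho> \<rho>N K"
      and v: "\<And>N. v N \<in> binary_vecs N (K N)" and sel: "\<And>N. K N > 0 \<Longrightarrow> eigenvector_selection N (K N) (x N)"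
    for \<rho> lam :: real and \<rho>N :: "nat \<Rightarrow> real" and K :: "nat \<Rightarrow> nat" and v :: "nat \<Rightarrow> real vec"
      and x :: "nat \<Rightarrow> real mat \<Rightarrow> real vec"
  proof -
    \<comment> \<open>\<open>\<Theta>\<close> bounds \<theta> for large N, and
      \<open>\<omega>\<close> uses K / N > \<rho> / 2. The order matters: the tilt \<open>t\<close>
      is small against \<open>\<omega>\<close>, and the accuracy \<open>\<xi>\<close> is small
      against \<open>t * \<omega>\<close>, since the bound on the product of overlaps is divided by
      \<open>t\<close>.\<close>
    define \<Theta> where "\<Theta> = lam * \<rho> + 1"
    define \<omega> where "\<omega> = sqrt (\<rho> / 2) * \<kappa>"
    define t where "t = min 1 (\<omega> / 2)"
    define \<xi> where "\<xi> = min (1 / 2) (min (\<kappa> / 8) (t * \<omega> / (8 + \<Theta>)))"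
    have lr: "1 + \<epsilon> < lam * \<rho>" using lam \<rho> by (simp add: field_simps)
    then have \<Theta>: "0 < 8 + \<Theta>" using assms by (simp add: \<Theta>_def)
    have lam0: "0 < lam"
    proof -
      have "0 < (1 + \<epsilon>) * (1 / \<rho>)" using assms \<rho> by simp
      with lam show ?thesis by linarith
    qed
    have \<omega>: "0 < \<omega>" using \<rho> \<kappa> by (simp add: \<omega>_def)
    have t: "0 < t" "t \<le> 1" "2 * t \<le> \<omega>" using \<omega> by (auto simp: t_def)
    have \<xi>: "0 < \<xi>" "\<xi> < 1" "8 * \<xi> \<le> \<kappa>" using \<kappa> t \<omega> \<Theta> by (auto simp: \<xi>_def)
    have "\<xi> \<le> t * \<omega> / (8 + \<Theta>)" by (simp add: \<xi>_def)
    then have \<xi>': "\<xi> * (8 + \<Theta>) \<le> t * \<omega>" using \<Theta> by (simp add: pos_le_divide_eq)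
    have "(\<lambda>M. (1 / (1 + \<epsilon>)) ^ M) \<longlonglongrightarrow> 0" using assms by (intro LIMSEQ_power_zero) simp
    \<comment> \<open>The number of links depends on \<open>\<xi>\<close> and
      \<open>\<epsilon>\<close> but not on N, so \<open>M < N\<close> eventually.\<close>
    then obtain M where M0: "(1 / (1 + \<epsilon>)) ^ M < \<xi>"
      using \<xi>(1) by (metis (no_types, lifting) eventually_sequentially order_refl order_tendstoD(2))
    have M: "q ^ (2 * M) \<le> \<xi>" if "0 \<le> q" "q \<le> 1 / (1 + \<epsilon>)" for q
    proof -
      have "q \<le> 1" using that assms by (auto intro: order.trans)
      then have "q ^ (2 * M) \<le> q ^ M" using that by (intro power_decreasing) auto
      also have "\<dots> \<le> (1 / (1 + \<epsilon>)) ^ M" using that by (intro power_mono)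
      finally show ?thesis using M0 by simp
    qed
    obtain p where p: "p \<longlonglongrightarrow> 0" and dir: "\<And>N e. M < N \<Longrightarrow> inner_n N e e = 1 \<Longrightarrow>
        \<exists>B\<in>sets (noise_law N). measure (noise_law N) B \<ge> 1 - p N \<and>
          (\<forall>w\<in>B. quadratic_upper \<xi> (1 + \<xi>) N w e \<and> geometric_test \<xi> (1 - \<xi>) M N w e)"
      by (rule prob_direction_good[of \<xi> "1 + \<xi>" "1 - \<xi>" M]) (use \<xi> in auto)
    have lim: "\<rho>N \<longlonglongrightarrow> \<rho>" and K: "\<And>N. real (K N) = real N * \<rho>N N"
      using sparse by (auto simp: sparsity_sequence_def)
    \<comment> \<open>\<open>\<rho>N N < 1\<close> gives \<open>K N < N\<close>, so that
      \<open>cospike\<close> is a unit vector; the last conjunct gives \<open>a N \<le> 1\<close>,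
      as \<open>measure_spectral_rounding_ge\<close> requires.\<close>
    define reg where "reg N \<longleftrightarrow> M < N \<and> \<rho> / 2 < \<rho>N N \<and> \<rho>N N < 1 \<and> 1 + \<epsilon> < lam * \<rho>N N \<and> lam * \<rho>N N < \<Theta> \<and>
       128 / (\<delta> ^ 4 * \<rho>) \<le> real N" for N
    have reg: "eventually reg sequentially"
    proof -
      have "(\<lambda>N. lam * \<rho>N N) \<longlonglongrightarrow> lam * \<rho>" by (intro tendsto_intros lim)
      then have "eventually (\<lambda>N. 1 + \<epsilon> < lam * \<rho>N N) sequentially" "eventually (\<lambda>N. lam * \<rho>N N < \<Theta>) sequentially"
        using lr by (auto simp: \<Theta>_def intro: order_tendstoD)
      moreover have "eventually (\<lambda>N. \<rho> / 2 < \<rho>N N) sequentially"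
        by (rule order_tendstoD(1)[OF lim]) (use \<rho> in simp)
      moreover have "eventually (\<lambda>N. \<rho>N N < 1) sequentially"
        by (rule order_tendstoD(2)[OF lim]) (use \<rho> in simp)
      moreover have "eventually (\<lambda>N. 128 / (\<delta> ^ 4 * \<rho>) \<le> real N) sequentially"
        using filterlim_real_sequentially by (simp add: filterlim_at_top)
      ultimately show ?thesis
        unfolding reg_def using eventually_gt_at_top[of M] by (simp add: eventually_conj_iff)
    qed
    define a where "a N = 128 / (\<delta> ^ 4 * \<rho> * real N)" for N
    have facts: "0 < N" "0 < K N" "K N < N" "eigenvector_selection N (K N) (x N)" "dim_vec (v N) = N" if "reg N" for N
    proof -
      show N: "0 < N" using that by (auto simp: reg_def)
      then have "0 < real N * \<rho>N N" "real N * \<rho>N N < real N * 1" using that \<rho> by (auto simp: reg_def)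
      then have "0 < real (K N)" "real (K N) < real N" by (simp_all add: K)
      then show "0 < K N" "K N < N" by simp_all
      then show "eigenvector_selection N (K N) (x N)" by (intro sel)
      show "dim_vec (v N) = N" using v by (rule binary_vecsD)
    qed
    have ge: "measure (spectral_rounding N (K N) \<delta> lam (v N) (x N))
        {u \<in> space (spectral_rounding N (K N) \<delta> lam (v N) (x N)). scalar_prod (v N) u > c * \<rho> * real N} \<ge> 1 - a N - 3 * p N"
      if regN: "reg N" for N
    proof -
      note fN = facts[OF regN]
      have rN: "M < N" "\<rho> / 2 < \<rho>N N" "1 + \<epsilon> < lam * \<rho>N N" "lam * \<rho>N N < \<Theta>" "128 / (\<delta> ^ 4 * \<rho>) \<le> real N"
        using regN by (auto simp: reg_def)
      have Kr: "real (K N) / real N = \<rho>N N" using fN(1) by (simp add: K)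
      define \<theta> where "\<theta> = lam * real (K N) / real N"
      have \<theta>_eq: "\<theta> = lam * \<rho>N N" unfolding Kr[symmetric] by (simp add: \<theta>_def)
      define u where "u = spike (K N) (v N)"
      define f where "f = cospike N (K N) (v N)"
      have ortho: "inner_n N u u = 1" "inner_n N f f = 1" "inner_n N u f = 0"
        unfolding u_def f_def by (rule spike_cospike_orthonormal[OF v fN(2,3)])+
      have \<theta>0: "0 < \<theta>" "1 + \<epsilon> < \<theta>" using rN assms by (auto simp: \<theta>_eq)
      interpret W: prob_space "noise_law N" by (rule prob_space_noise_law[OF fN(1)])
      obtain B0 where B0: "B0 \<in> W.events" "W.prob B0 \<ge> 1 - p N"
        and g0: "\<And>w. w \<in> B0 \<Longrightarrow> quadratic_upper \<xi> (1 + \<xi>) N w u" "\<And>w. w \<in> B0 \<Longrightarrow> geometric_test \<xi> (1 - \<xi>) M N w u"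
        using dir[OF rN(1) ortho(1)] by blast
      obtain B1 where B1: "B1 \<in> W.events" "W.prob B1 \<ge> 1 - p N"
        and g1: "\<And>w. w \<in> B1 \<Longrightarrow> quadratic_upper \<xi> (1 + \<xi>) N w (tilted \<theta> t u f)"
        using dir[OF rN(1) tilted_unit[OF ortho \<theta>0(1)]] by blast
      obtain B2 where B2: "B2 \<in> W.events" "W.prob B2 \<ge> 1 - p N"
        and g2: "\<And>w. w \<in> B2 \<Longrightarrow> quadratic_upper \<xi> (1 + \<xi>) N w (tilted \<theta> (- t) u f)"
        using dir[OF rN(1) tilted_unit[OF ortho \<theta>0(1)]] by blast
      define B where "B = B0 \<inter> (B1 \<inter> B2)"
      have B: "B \<in> W.events" using B0 B1 B2 by (simp add: B_def)
      have PB: "W.prob B \<ge> 1 - 3 * p N"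
      proof -
        have "W.prob (space (noise_law N) - B) \<le> W.prob ((space (noise_law N) - B0) \<union> ((space (noise_law N) - B1) \<union> (space (noise_law N) - B2)))"
          using B0 B1 B2 by (intro W.finite_measure_mono) (auto simp: B_def)
        also have "\<dots> \<le> W.prob (space (noise_law N) - B0) + W.prob ((space (noise_law N) - B1) \<union> (space (noise_law N) - B2))"
          using B0 B1 B2 by (intro measure_Un_le) auto
        also have "\<dots> \<le> W.prob (space (noise_law N) - B0) + (W.prob (space (noise_law N) - B1) + W.prob (space (noise_law N) - B2))"
          using B0 B1 B2 by (intro add_left_mono measure_Un_le) auto
        finally show ?thesis using B0 B1 B2 B by (simp add: W.prob_compl)
      qed
      have cK: "c * \<rho> * real N < \<delta> ^ 4 / 32 * real (K N)"
      proof -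
        have "c * \<rho> * real N = \<delta> ^ 4 / 64 * (real N * (\<rho> / 2))" by (simp add: c_def)
        also have "\<dots> < \<delta> ^ 4 / 32 * (real N * \<rho>N N)"
          using rN(2) fN(1) \<delta> \<rho> by (auto intro!: mult_strict_mono[of "\<delta> ^ 4 / 64"] mult_strict_left_mono)
        finally show ?thesis by (simp add: K)
      qed
      have aK: "64 / (\<delta> ^ 4 * real (K N)) \<le> a N"
      proof -
        have "\<delta> ^ 4 * \<rho> * real N \<le> 2 * (\<delta> ^ 4 * (real N * \<rho>N N))"
          using rN(2) fN(1) \<delta> by simp
        then have "128 / (2 * (\<delta> ^ 4 * (real N * \<rho>N N))) \<le> 128 / (\<delta> ^ 4 * \<rho> * real N)"
          using fN(1) \<delta> \<rho> by (intro divide_left_mono mult_pos_pos) (use rN(2) in auto)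
        then show ?thesis by (simp add: K a_def mult_ac)
      qed
      have a01: "0 \<le> a N" "a N \<le> 1"
      proof -
        have pos: "0 < \<delta> ^ 4 * \<rho>" using \<delta> \<rho> by simp
        then show "0 \<le> a N" by (simp add: a_def)
        have "128 \<le> real N * (\<delta> ^ 4 * \<rho>)"
          using rN(5) by (simp only: pos_divide_le_eq[OF pos])
        then show "a N \<le> 1" using pos fN(1) unfolding a_def by (subst pos_divide_le_eq) (auto simp: mult_ac)
      qed
      show ?thesis
      proof (rule measure_spectral_rounding_ge[OF fN(4,5,1) B PB a01])
        fix w assume w: "w \<in> B"
        let ?y = "x N (observation N lam (v N) w)"
        let ?S = "{i. i < N \<and> vec_index (v N) i = 1}"
        have pe: "principal_eigenvector (K N) (observation N lam (v N) w) ?y"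
          using fN(4) unfolding eigenvector_selection_def observation_eq_sym_mat[OF fN(5)] by blast
        have q: "(1 / \<theta>) ^ (2 * M) \<le> \<xi>" using \<theta>0 assms by (intro M) (auto intro: frac_le)
        have \<kappa>2: "2 * \<kappa> \<le> (1 - 1 / \<theta>)\<^sup>2"
        proof -
          have "1 / \<theta> \<le> 1 / (1 + \<epsilon>)" using \<theta>0 assms by (intro frac_le) auto
          moreover have "\<epsilon> / (1 + \<epsilon>) = 1 - 1 / (1 + \<epsilon>)" using assms by (simp add: field_simps)
          ultimately have "\<epsilon> / (1 + \<epsilon>) \<le> 1 - 1 / \<theta>" by simp
          then have "(\<epsilon> / (1 + \<epsilon>))\<^sup>2 \<le> (1 - 1 / \<theta>)\<^sup>2" using assms by (intro power_mono) auto
          then show ?thesis by (simp add: \<kappa>_def)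
        qed
        have \<omega>N: "\<omega> \<le> sqrt (real (K N) / real N) * \<kappa>"
          unfolding \<omega>_def Kr using rN(2) \<kappa> by (intro mult_right_mono) auto
        have b: "w \<in> B0" "w \<in> B1" "w \<in> B2" using w by (auto simp: B_def)
        have th: "1 \<le> \<theta>" "\<theta> \<le> \<Theta>" using \<theta>0 assms rN by (auto simp: \<theta>_eq)
        note corr = principal_eigenvector_correlation[OF v fN(2,3) pe \<theta>_def th g0(1)[OF b(1), unfolded u_def]
          g0(2)[OF b(1), unfolded u_def] g1[OF b(2), unfolded u_def f_def] g2[OF b(3), unfolded u_def f_def]
          \<xi>(1,2) q \<xi>(3) \<xi>' \<kappa>(1) \<kappa>2 t \<omega>N]
        have cS: "card ?S = K N"
        proof -
          have "real (card ?S) = (\<Sum>i<N. vec_index (v N) i * 1)"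
            using binary_vecsD(2)[OF v] by (subst sum_support) auto
          then show ?thesis using binary_vecsD(3)[OF v, of N] by simp
        qed
        have "measure_pmf.prob (rounded_set N (K N) \<delta> ?y) {T. real (card (T \<inter> ?S)) < \<delta> ^ 4 / 32 * real (K N)}
            \<le> 64 / (\<delta> ^ 4 * real (K N))"
          using corr \<delta> fN(2) cS by (intro rounded_set_overlap) (auto simp: \<delta>_def)
        moreover have "measure_pmf.prob (rounded_set N (K N) \<delta> ?y) {T. \<not> c * \<rho> * real N < scalar_prod (v N) (indicator_vec N T)}
          \<le> measure_pmf.prob (rounded_set N (K N) \<delta> ?y) {T. real (card (T \<inter> ?S)) < \<delta> ^ 4 / 32 * real (K N)}"
          using cK by (intro measure_pmf.finite_measure_mono) (auto simp: scalar_prod_indicator_vec[OF v])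
        ultimately show "measure_pmf.prob (rounded_set N (K N) \<delta> ?y) {T. \<not> c * \<rho> * real N < scalar_prod (v N) (indicator_vec N T)} \<le> a N"
          using aK by linarith
      qed
    qed
    have "(\<lambda>N. 1 - a N - 3 * p N) \<longlonglongrightarrow> 1 - 0 - 3 * 0"
    proof (intro tendsto_intros p)
      have "(\<lambda>N. 128 / (\<delta> ^ 4 * \<rho>) * (1 / real N)) \<longlonglongrightarrow> 128 / (\<delta> ^ 4 * \<rho>) * 0"
        by (intro tendsto_intros lim_1_over_n)
      then show "a \<longlonglongrightarrow> 0" by (simp add: a_def[abs_def])
    qed
    then have low: "(\<lambda>N. 1 - a N - 3 * p N) \<longlonglongrightarrow> 1" by simp
    have "(\<lambda>N. measure (spectral_rounding N (K N) \<delta> lam (v N) (x N))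
        {u \<in> space (spectral_rounding N (K N) \<delta> lam (v N) (x N)). scalar_prod (v N) u > c * \<rho> * real N}) \<longlonglongrightarrow> 1"
    proof (rule tendsto_sandwich[OF _ _ low tendsto_const])
      show "eventually (\<lambda>N. 1 - a N - 3 * p N \<le> measure (spectral_rounding N (K N) \<delta> lam (v N) (x N))
        {u \<in> space (spectral_rounding N (K N) \<delta> lam (v N) (x N)). scalar_prod (v N) u > c * \<rho> * real N}) sequentially"
        using reg by (rule eventually_mono) (rule ge)
      show "eventually (\<lambda>N. measure (spectral_rounding N (K N) \<delta> lam (v N) (x N))
        {u \<in> space (spectral_rounding N (K N) \<delta> lam (v N) (x N)). scalar_prod (v N) u > c * \<rho> * real N} \<le> 1) sequentially"
        using reg by (rule eventually_mono) (rule prob_space.prob_le_1[OF sets_spectral_rounding(2)[OF facts(4,5,1)]])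
    qed
    moreover have "eventually (\<lambda>N. AE u in spectral_rounding N (K N) \<delta> lam (v N) (x N). u \<in> binary_vecs N (K N)) sequentially"
      using reg by (rule eventually_mono) (intro AE_spectral_rounding facts less_imp_le)
    ultimately show ?thesis by (simp add: recovers_approximately_def)
  qed
  then show ?thesis using \<delta> c by blast
qed

end
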